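(* For every $\gamma>0$ there exist $\eta>0$ and $n_0\in\mathbb{N}$ such that the following holds for every $n>n_0$. Suppose that $T$ is an $n$-vertex tree with maximum degree $\Delta(T)\le \frac{\eta n}{\log n}$. Then there exists a $\lceil(1+\gamma)n\rceil$-graceful labelling $\psi:V(T)\rightarrow \{1,2,\ldots,\lceil(1+\gamma)n\rceil\}$.
   Context: $\log$ denotes the natural logarithm. For a graph $G$ and a positive integer $m$, a map $\psi:V(G)\to\{1,\ldots,m\}$ is an $m$-graceful labelling of $G$ if $\psi$ is injective and the induced edge map $\psi_*:E(G)\to\{1,\ldots,m-1\}$, $\psi_*(xy):=|\psi(x)-\psi(y)|$, is also injective. *)

theory Defs
  imports Complex_Main
begin

text \<open>
  A graph is given by its vertex set \<open>V\<close> and its set \<open>E\<close> of undirected edges, each edge being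
  a two-element set of vertices. The notion of tree from the AFP entry Graph-Theory is not usable
  here: it forbids directed cycles, and \<open>u, v, u\<close> counts as a cycle of a symmetric digraph.
\<close>

definition fin_simple_graph :: "'a set \<Rightarrow> 'a set set \<Rightarrow> bool" where
  "fin_simple_graph V E \<longleftrightarrow> finite V \<and> (\<forall>e\<in>E. e \<subseteq> V \<and> card e = 2)"

definition vertex_degree :: "'a set set \<Rightarrow> 'a \<Rightarrow> nat" where
  "vertex_degree E v = card {e \<in> E. v \<in> e}"

text \<open>Only meaningful for finite nonempty \<open>V\<close>; trees below are finite and nonempty.\<close>

definition max_vertex_degree :: "'a set \<Rightarrow> 'a set set \<Rightarrow> nat" where
  "max_vertex_degree V E = Max (vertex_degree E ` V)"

definition connected_graph :: "'a set \<Rightarrow> 'a set set \<Rightarrow> bool" where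
  "connected_graph V E \<longleftrightarrow>
     V \<noteq> {} \<and> (\<forall>u\<in>V. \<forall>v\<in>V. (u, v) \<in> {(x, y). {x, y} \<in> E}\<^sup>*)"

definition graph_cycle :: "'a set set \<Rightarrow> 'a list \<Rightarrow> bool" where
  "graph_cycle E vs \<longleftrightarrow>
     length vs \<ge> 3 \<and> distinct vs \<and>
     (\<forall>i < length vs. {vs ! i, vs ! (Suc i mod length vs)} \<in> E)"

definition tree_graph :: "'a set \<Rightarrow> 'a set set \<Rightarrow> bool" where
  "tree_graph V E \<longleftrightarrow>
     fin_simple_graph V E \<and> connected_graph V E \<and> \<not> (\<exists>vs. graph_cycle E vs)"

text \<open>The induced edge map; it is well defined on two-element sets by the lemma that follows.\<close>

definition induced_edge_map :: "('a \<Rightarrow> int) \<Rightarrow> 'a set \<Rightarrow> int" where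
  "induced_edge_map \<psi> e = (THE d. \<exists>x y. e = {x, y} \<and> d = \<bar>\<psi> x - \<psi> y\<bar>)"

lemma induced_edge_map_doubleton: "induced_edge_map \<psi> {x, y} = \<bar>\<psi> x - \<psi> y\<bar>"
  unfolding induced_edge_map_def
  by (rule the_equality) (auto simp: doubleton_eq_iff)

definition graceful_labelling :: "int \<Rightarrow> 'a set \<Rightarrow> 'a set set \<Rightarrow> ('a \<Rightarrow> int) \<Rightarrow> bool" where
  "graceful_labelling m V E \<psi> \<longleftrightarrow>
     \<psi> ` V \<subseteq> {1..m} \<and> inj_on \<psi> V \<and>
     induced_edge_map \<psi> ` E \<subseteq> {1..m - 1} \<and> inj_on (induced_edge_map \<psi>) E"

end

theory Submission
  imports Defs
begin

text \<open>
  The tree is rooted and its vertices are labelled one at a time, parents before children. Vertex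
  \<open>t\<close> has a prescribed window \<open>J t\<close> of \<open>L\<close> consecutive labels. If its parent carries the label
  \<open>p\<close>, then choosing \<open>y\<close> for \<open>t\<close> consumes two resources, the label \<open>y\<close> and the difference
  \<open>\<bar>y - p\<bar>\<close>; the set of both is the move \<open>move p y\<close>. A labelling that never consumes a resource
  twice is graceful. The choice is greedy and random in spirit: among the moves that are still
  available, one is taken with probability proportional to the product of the normalised
  availabilities of its two resources, where the normalised availability of an unused resource is
  the inverse of the fraction \<open>\<alpha>\<close> of such resources that are planned to be unused at that time.

  Why the plan leaves room everywhere. The \<open>(1 + \<gamma>) n\<close> labels are cut into \<open>h\<close> blocks of length
  \<open>L\<close>. For \<open>1 \<le> k < h\<close> two blocks at distance \<open>k\<close>, whose indices add up to about \<open>h\<close>, are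
  paired: this is the zigzag labelling of a path, viewed coarsely. Each block lies in at most two
  pairs, and for each \<open>d\<close> the numbers of pairs of labels at difference \<open>d\<close>, added over all \<open>k\<close>,
  are at most \<open>L\<close> (\<open>sum_shift_count\<close>). Boundedly many vertices cut the tree into pieces of size at
  most \<open>\<mu> n\<close> (\<open>cut_into_small_pieces\<close>). Every piece is sent to one pair, one colour class to each
  block, in such a way that all pairs receive the same load in both orientations
  (\<open>balanced_bins\<close>). Hence every label and every difference is planned to be used with total
  weight at most \<open>1 - \<kappa>\<close> (\<open>balanced_windows\<close>), except for the few edges at the cut vertices,
  called jumps, which are few because the maximum degree is \<open>o(n)\<close>.

  Why the choice follows the plan. It suffices that the total normalised availability of the moves
  into the window of the current vertex stays close to its initial value \<open>L\<close>. This quantity is the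
  first of a hierarchy of statistics. A statistic is a positive functional \<open>F\<close> on functions of
  finite resource sets, evaluated at the availability of such sets. In a step with parent label \<open>p\<close>
  the expected change of \<open>F\<close> is, up to small errors, \<open>1 / L\<close> times the difference of two further
  statistics: both run over the pairs of a set \<open>f\<close> of \<open>F\<close> and a move \<open>m\<close> that meets \<open>f\<close> in one
  resource, one evaluated at \<open>f\<close> and the other at \<open>f \<union> m\<close> (\<open>expected_change\<close>). These two start with
  the same value, so only their deviations matter. The relative deviations
  \<open>\<sigma>\<^sub>k\<close> of the statistics of level \<open>k\<close> therefore satisfy \<open>\<sigma>\<^sub>k' \<le> C (k + 2) \<sigma>\<^sub>k\<^sub>+\<^sub>1 / L\<close> up to a
  small error, and \<open>\<sigma>\<^sub>k \<le> 1\<close> always. Over \<open>L / (4 C)\<close> steps this infinite hierarchy is controlled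
  by the supersolution \<open>\<mu> a\<^sup>k\<^sup>+\<^sup>2\<close> with \<open>a' = C a\<^sup>2 / L\<close>, so that smallness of many levels at the
  beginning of such a period gives smallness of fewer levels at its end; boundedly many periods
  cover the whole process (\<open>hierarchy_bound\<close>).

  Two error terms need an idea. First, a move may lie inside \<open>f\<close>. Since a label and a
  difference form a move for at most two values of \<open>p\<close>, and few vertices share a parent, double
  counting bounds the sum of these errors (\<open>sum_double_hits_steps\<close>). Secondly, the plan for
  differences averages over the position of the parent in its window, while the actual position is
  one point. The error vanishes on average over that position, so it is charged to the
  step that labels the parent, where it becomes part of a martingale difference (\<open>compensated\<close>,
  \<open>mean_grad\<close>); this needs that children in a piece follow their parent within \<open>\<mu> n\<close> steps.

  The increments of these martingales are bounded by a constant times the number of children, and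
  polynomially many statistics have to be controlled. This is where the bound \<open>\<eta> n / log n\<close> on the
  degree enters. Instead of a probability space, a sum of exponentials of the
  martingales is kept small: at each step some choice does not exceed the average
  (\<open>potential_step\<close>, \<open>labelling_exists\<close>).
\<close>

section \<open>Bounding a hierarchy of deviations\<close>

text \<open>
  One period. The function \<open>a\<close> solves \<open>a' = C a\<^sup>2 / L\<close> and grows from 2 to at most 4, so
  \<open>\<mu> a\<^sup>k\<^sup>+\<^sup>2\<close> solves the hierarchy with equality, for all levels at once. The top level is not
  controlled by the recursion; there the trivial bound 1 lies below \<open>\<mu> 2\<^sup>K\<^sup>+\<^sup>3\<close>.
\<close>

lemma hierarchy_step:
  fixes \<sigma> :: "nat \<Rightarrow> nat \<Rightarrow> real"
  assumes "C > 0" "L > 0" "\<mu> > 0"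
    and top: "1 \<le> \<mu> * 2 ^ (K + 3)"
    and le1: "\<And>k t. t \<le> N \<Longrightarrow> \<sigma> k t \<le> 1"
    and step: "\<And>k t. k \<le> K \<Longrightarrow> T \<le> t \<Longrightarrow> t \<le> N \<Longrightarrow>
        \<sigma> k t \<le> \<sigma> k T + \<nu> + C * real (k + 2) / L * (\<Sum>s\<in>{T..<t}. \<sigma> (k + 1) s)"
    and init: "\<And>k. k \<le> K \<Longrightarrow> \<sigma> k T + \<nu> \<le> \<mu>"
    and t: "T \<le> t" "t \<le> N" "C * real (t - T) / L \<le> 1 / 4" and "k \<le> K"
  shows "\<sigma> k t \<le> \<mu> * 4 ^ (k + 2)"
proof -
  define a where "a = (\<lambda>s. 1 / (1 / 2 - C * real (s - T) / L))"
  have rng: "2 \<le> a s" "a s \<le> 4" if "s \<le> t" for s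
  proof -
    have "C * real (s - T) / L \<le> C * real (t - T) / L"
      using that assms by (intro divide_right_mono mult_left_mono) auto
    then have *: "C * real (s - T) / L \<le> 1 / 4" using t by linarith
    moreover have "0 \<le> C * real (s - T) / L" using assms by simp
    ultimately have "1 / 4 \<le> 1 / 2 - C * real (s - T) / L" "1 / 2 - C * real (s - T) / L \<le> 1 / 2" by linarith+
    then have "1 / (1 / 2) \<le> a s" "a s \<le> 1 / (1 / 4)" unfolding a_def
      by (intro divide_left_mono mult_pos_pos; linarith)+
    then show "2 \<le> a s" "a s \<le> 4" by simp_all
  qed
  have inc: "\<mu> * a s ^ (k + 2) + C * real (k + 2) / L * (\<mu> * a s ^ (k + 3)) \<le> \<mu> * a (Suc s) ^ (k + 2)"
    if "T \<le> s" "Suc s \<le> t" for s k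
  proof -
    define b where "b = 1 / 2 - C * real (s - T) / L"
    have as: "a s = 1 / b" unfolding a_def b_def ..
    have as': "a (Suc s) = 1 / (b - C / L)"
    proof -
      have "real (Suc s - T) = real (s - T) + 1" using that by simp
      then have "C * real (Suc s - T) / L = C * real (s - T) / L + C / L"
        by (simp only: distrib_left add_divide_distrib mult_1_right)
      then show ?thesis unfolding a_def b_def by (simp add: algebra_simps)
    qed
    have bp: "b - C / L > 0"
    proof -
      have "a (Suc s) > 0" using rng(1)[OF that(2)] by linarith
      then show ?thesis unfolding as' by (simp add: zero_less_divide_1_iff)
    qed
    have CL: "C / L > 0" using assms by simp
    have "b > 0" using bp CL by linarith
    have "a s * (1 + C / L * a s) \<le> a (Suc s)"
    proof -
      have "(1 + C / L * (1/b)) * (b - C/L) \<le> b"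
      proof -
        have "(1 + C / L * (1/b)) * (b - C/L) = b - (C/L)^2 / b"
        proof -
          have "(1 + c * (1/b)) * (b - c) = b - c^2 / b" for c
            using \<open>b > 0\<close> by (simp add: field_simps power2_eq_square)
          then show ?thesis .
        qed
        then show ?thesis using \<open>b > 0\<close> by simp
      qed
      then have "1 + C / L * (1/b) \<le> b / (b - C/L)" using bp by (simp add: pos_le_divide_eq)
      then have "(1/b) * (1 + C / L * (1/b)) \<le> (1/b) * (b / (b - C/L))"
        using \<open>b > 0\<close> by (intro mult_left_mono) auto
      then show ?thesis using \<open>b > 0\<close> unfolding as as' by simp
    qed
    moreover have as0: "a s \<ge> 2" using rng(1)[of s] that by simp
    ultimately have "(a s * (1 + C / L * a s)) ^ (k + 2) \<le> a (Suc s) ^ (k + 2)"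
    proof (intro power_mono)
      have "0 \<le> C / L * a s" using CL as0 by (intro mult_nonneg_nonneg) auto
      then show "0 \<le> a s * (1 + C / L * a s)" using as0 by (intro mult_nonneg_nonneg) auto
    qed
    moreover have "a s ^ (k + 2) * (1 + real (k + 2) * (C / L * a s)) \<le> (a s * (1 + C / L * a s)) ^ (k + 2)"
    proof -
      have "1 + real (k + 2) * (C / L * a s) \<le> (1 + C / L * a s) ^ (k + 2)"
        using CL as0 by (intro Bernoulli_inequality) (smt (verit) mult_nonneg_nonneg)
      then show ?thesis using as0 unfolding power_mult_distrib by (intro mult_left_mono) auto
    qed
    ultimately have "\<mu> * (a s ^ (k + 2) * (1 + real (k + 2) * (C / L * a s))) \<le> \<mu> * a (Suc s) ^ (k + 2)"
      using assms(3) by (intro mult_left_mono) auto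
    moreover have "a s ^ (k + 3) = a s ^ (k + 2) * a s" by (simp add: power_add eval_nat_numeral)
    ultimately show ?thesis by (simp add: algebra_simps)
  qed
  have main: "\<sigma> k s \<le> \<mu> * a s ^ (k + 2)" if "T \<le> s" "s \<le> t" "k \<le> K + 1" for k s
    using that
  proof (induction s arbitrary: k rule: less_induct)
    case (less s)
    show ?case
    proof (cases "k = K + 1")
      case True
      have "(2::real) ^ (k + 2) \<le> a s ^ (k + 2)" using rng(1) less.prems by (intro power_mono) auto
      then have "\<mu> * 2 ^ (k + 2) \<le> \<mu> * a s ^ (k + 2)" using assms(3) by simp
      then have "1 \<le> \<mu> * a s ^ (k + 2)" using top True by (simp add: eval_nat_numeral)
      then show ?thesis using le1[of s k] less.prems t by linarith
    next
      case False
      then have kK: "k \<le> K" using less.prems by simp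
      have tel: "(\<mu> * a T ^ (k + 2)) + C * real (k + 2) / L * (\<Sum>r\<in>{T..<m}. \<mu> * a r ^ (k + 3)) \<le> \<mu> * a m ^ (k + 2)"
        if "T \<le> m" "m \<le> s" for m
        using that
      proof (induction m rule: dec_induct)
        case base then show ?case by simp
      next
        case (step m)
        have "C * real (k + 2) / L * (\<Sum>r\<in>{T..<Suc m}. \<mu> * a r ^ (k + 3))
            = C * real (k + 2) / L * (\<Sum>r\<in>{T..<m}. \<mu> * a r ^ (k + 3)) + C * real (k + 2) / L * (\<mu> * a m ^ (k + 3))"
          using step(1) by (simp add: distrib_left)
        then show ?case using step inc[of m k] less.prems by linarith
      qed
      have "\<sigma> k s \<le> \<sigma> k T + \<nu> + C * real (k + 2) / L * (\<Sum>r\<in>{T..<s}. \<sigma> (k + 1) r)"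
        using less.prems t kK by (intro step) auto
      also have "(\<Sum>r\<in>{T..<s}. \<sigma> (k + 1) r) \<le> (\<Sum>r\<in>{T..<s}. \<mu> * a r ^ (k + 3))"
        using less kK by (intro sum_mono) (force simp: eval_nat_numeral)
      then have "C * real (k + 2) / L * (\<Sum>r\<in>{T..<s}. \<sigma> (k + 1) r) \<le> C * real (k + 2) / L * (\<Sum>r\<in>{T..<s}. \<mu> * a r ^ (k + 3))"
        using assms by (intro mult_left_mono) auto
      moreover have "\<sigma> k T + \<nu> \<le> \<mu> * a T ^ (k + 2)"
      proof -
        have "(1::real) \<le> a T ^ (k + 2)" using rng(1)[of T] t by (intro one_le_power) auto
        then have "\<mu> * 1 \<le> \<mu> * a T ^ (k + 2)" using assms(3) by (intro mult_left_mono) auto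
        then show ?thesis using init[OF kK] by linarith
      qed
      ultimately show ?thesis using tel[of s] less.prems by linarith
    qed
  qed
  have "\<sigma> k t \<le> \<mu> * a t ^ (k + 2)" using main[of t k] t assms by auto
  also have "\<dots> \<le> \<mu> * 4 ^ (k + 2)"
    using rng[of t] assms(3) by (intro mult_left_mono power_mono) auto
  finally show ?thesis .
qed

text \<open>
  The recursion satisfied by the relative deviations: \<open>\<nu>\<close> collects all errors between the times \<open>T\<close>
  and \<open>t\<close>. Level \<open>k\<close> is driven by level \<open>k + 1\<close>, so \<open>K\<close> limits the levels for which it is known.
\<close>

definition closed_hierarchy :: "real \<Rightarrow> nat \<Rightarrow> real \<Rightarrow> real \<Rightarrow> nat \<Rightarrow> (nat \<Rightarrow> nat \<Rightarrow> real) \<Rightarrow> bool" where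
  "closed_hierarchy C K \<nu> L N \<sigma> \<longleftrightarrow>
     (\<forall>k t. t \<le> N \<longrightarrow> \<sigma> k t \<le> 1) \<and> (\<forall>k. \<sigma> k 0 \<le> 0) \<and>
     (\<forall>k T t. k \<le> K \<and> T \<le> t \<and> t \<le> N \<longrightarrow>
        \<sigma> k t \<le> \<sigma> k T + \<nu> + C * real (k + 2) / L * (\<Sum>s\<in>{T..<t}. \<sigma> (k + 1) s))"

lemma closed_hierarchy_mono:
  assumes "closed_hierarchy C K \<nu> L N \<sigma>" "K' \<le> K" "\<nu> \<le> \<nu>'"
  shows "closed_hierarchy C K' \<nu>' L N \<sigma>"
  using assms unfolding closed_hierarchy_def by (smt (verit) le_trans)

text \<open>
  Induction on the number \<open>j\<close> of periods of length \<open>h\<close>. To reach \<open>\<epsilon>\<close> on the levels up to \<open>k0\<close> after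
  one more period, the previous ones must reach a much smaller bound on many more levels; therefore
  \<open>K\<close> and \<open>\<nu>\<close> are chosen backwards.
\<close>

lemma hierarchy_periods:
  fixes C :: real
  assumes "C > 0"
  shows "\<forall>k0 \<epsilon>. \<epsilon> > 0 \<longrightarrow> (\<exists>K \<nu>. \<nu> > 0 \<and> (\<forall>L N \<sigma> h. L > 0 \<longrightarrow> C * real h / L \<le> 1 / 4 \<longrightarrow>
            closed_hierarchy C K \<nu> L N \<sigma> \<longrightarrow> (\<forall>k\<le>k0. \<forall>t\<le>N. t \<le> j * h \<longrightarrow> \<sigma> k t \<le> \<epsilon>)))"
proof (induction j)
  case 0
  have "\<exists>K \<nu>. \<nu> > 0 \<and> (\<forall>L N \<sigma> h. L > 0 \<longrightarrow> C * real h / L \<le> 1 / 4 \<longrightarrow>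
            closed_hierarchy C K \<nu> L N \<sigma> \<longrightarrow> (\<forall>k\<le>k0. \<forall>t\<le>N. t \<le> 0 * h \<longrightarrow> \<sigma> k t \<le> \<epsilon>))" if "\<epsilon> > 0" for k0 :: nat and \<epsilon> :: real
  proof (rule exI[of _ "0::nat"], rule exI[of _ "1::real"], intro conjI allI impI)
    fix L :: real and N :: nat and \<sigma> and h k t :: nat
    assume "closed_hierarchy C 0 1 L N \<sigma>" "t \<le> 0 * h"
    then have "\<sigma> k t \<le> 0" by (simp add: closed_hierarchy_def)
    then show "\<sigma> k t \<le> \<epsilon>" using that by linarith
  qed simp
  then show ?case by blast
next
  case (Suc j)
  show ?case
  proof (intro allI impI)
    fix k0 :: nat and \<epsilon> :: real
    assume "\<epsilon> > 0"
    obtain K1 where K1: "(1/2) ^ K1 < \<epsilon> / 4 ^ (k0 + 2)"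
      using real_arch_pow_inv[of "\<epsilon> / 4 ^ (k0 + 2)" "1/2"] \<open>\<epsilon> > 0\<close> by auto
    define K2 where "K2 = max K1 k0"
    (* The smallest value for which the top level satisfies its trivial bound. *)
    define \<mu> :: real where "\<mu> = (1/2) ^ (K2 + 3)"
    have \<mu>: "\<mu> > 0" "1 \<le> \<mu> * 2 ^ (K2 + 3)" by (auto simp: \<mu>_def power_one_over)
    have "\<mu> \<le> (1/2) ^ K1" unfolding \<mu>_def by (rule power_decreasing) (auto simp: K2_def)
    then have \<mu>e: "\<mu> * 4 ^ (k0 + 2) \<le> \<epsilon>" using K1
      by (meson less_eq_real_def order_le_less_trans pos_less_divide_eq zero_less_numeral zero_less_power)
    obtain K3 \<nu>3 where K3: "\<nu>3 > 0" "\<And>L N \<sigma> h. L > 0 \<Longrightarrow> C * real h / L \<le> 1 / 4 \<Longrightarrow>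
            closed_hierarchy C K3 \<nu>3 L N \<sigma> \<Longrightarrow> (\<forall>k\<le>K2. \<forall>t\<le>N. t \<le> j * h \<longrightarrow> \<sigma> k t \<le> \<mu> / 2)"
      using Suc.IH[rule_format, of "\<mu> / 2" K2] half_gt_zero[OF \<mu>(1)] by blast
    define K where "K = max K2 K3"
    define \<nu> where "\<nu> = min \<nu>3 (\<mu> / 2)"
    show "\<exists>K \<nu>. \<nu> > 0 \<and> (\<forall>L N \<sigma> h. L > 0 \<longrightarrow> C * real h / L \<le> 1 / 4 \<longrightarrow>
            closed_hierarchy C K \<nu> L N \<sigma> \<longrightarrow> (\<forall>k\<le>k0. \<forall>t\<le>N. t \<le> Suc j * h \<longrightarrow> \<sigma> k t \<le> \<epsilon>))"
    proof (intro exI conjI allI impI)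
      show "\<nu> > 0" unfolding \<nu>_def using K3 \<mu> by simp
      fix L :: real and N :: nat and \<sigma> and h k t :: nat
      assume L: "L > 0" "C * real h / L \<le> 1 / 4" and cl: "closed_hierarchy C K \<nu> L N \<sigma>"
        and k: "k \<le> k0" and t: "t \<le> N" "t \<le> Suc j * h"
      have prev: "\<And>k t. k \<le> K2 \<Longrightarrow> t \<le> N \<Longrightarrow> t \<le> j * h \<Longrightarrow> \<sigma> k t \<le> \<mu> / 2"
        using K3(2)[OF L closed_hierarchy_mono[OF cl]] by (auto simp: K_def \<nu>_def)
      have cl2: "closed_hierarchy C K2 (\<mu>/2) L N \<sigma>"
        using closed_hierarchy_mono[OF cl] by (auto simp: K_def \<nu>_def)
      have "\<sigma> k t \<le> \<mu> * 4 ^ (k + 2)"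
      proof (cases "t \<le> j * h")
        case True
        have "\<sigma> k t \<le> \<mu> / 2" using prev True t k by (auto simp: K2_def)
        moreover have "\<mu> * 1 \<le> \<mu> * 4 ^ (k + 2)" using \<mu> by (intro mult_left_mono one_le_power) auto
        ultimately show ?thesis using \<mu> by linarith
      next
        case False
        show ?thesis
        proof (rule hierarchy_step[where K=K2 and T="j*h" and N=N and \<nu>="\<mu>/2" and C=C and L=L])
          have "real (t - j * h) \<le> real h" using t(2) by (intro of_nat_mono) simp
          then have "C * real (t - j * h) / L \<le> C * real h / L"
            using L assms by (intro divide_right_mono mult_left_mono) auto
          then show "C * real (t - j * h) / L \<le> 1 / 4" using L by linarith
          show "\<sigma> k (j * h) + \<mu> / 2 \<le> \<mu>" if "k \<le> K2" for k
            using prev[OF that, of "j*h"] False t by auto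
          show "\<sigma> k t \<le> 1" if "t \<le> N" for k t
            using cl2 that by (simp add: closed_hierarchy_def)
          show "\<sigma> k t \<le> \<sigma> k (j * h) + \<mu> / 2 + C * real (k + 2) / L * (\<Sum>s\<in>{j * h..<t}. \<sigma> (k + 1) s)"
            if "k \<le> K2" "j * h \<le> t" "t \<le> N" for k t
            using cl2 that unfolding closed_hierarchy_def by blast
        qed (use L assms \<mu> False t k in \<open>simp_all add: K2_def\<close>)
      qed
      also have "\<mu> * 4 ^ (k + 2) \<le> \<mu> * 4 ^ (k0 + 2)"
        using \<mu> k by (intro mult_left_mono power_increasing) auto
      finally show "\<sigma> k t \<le> \<epsilon>" using \<mu>e by linarith
    qed
  qed
qed

lemma hierarchy_bound:
  fixes C H \<epsilon> :: real
  assumes "C > 0" "H > 0" "\<epsilon> > 0"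
  shows "\<exists>K \<nu>. \<nu> > 0 \<and> (\<forall>L N \<sigma>. L \<ge> 8 * C \<longrightarrow> real N \<le> H * L \<longrightarrow>
            closed_hierarchy C K \<nu> L N \<sigma> \<longrightarrow> (\<forall>t\<le>N. \<sigma> 0 t \<le> \<epsilon>))"
proof -
  define j where "j = nat \<lceil>8 * C * H\<rceil>"
  obtain K \<nu> where K: "\<nu> > 0" "\<And>L N \<sigma> h. L > 0 \<Longrightarrow> C * real h / L \<le> 1 / 4 \<Longrightarrow>
            closed_hierarchy C K \<nu> L N \<sigma> \<Longrightarrow> (\<forall>k\<le>0. \<forall>t\<le>N. t \<le> j * h \<longrightarrow> \<sigma> k t \<le> \<epsilon>)"
    using hierarchy_periods[OF assms(1), of j, rule_format, of \<epsilon> 0, OF assms(3)] by blast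
  show ?thesis
  proof (intro exI conjI allI impI)
    show "\<nu> > 0" by fact
    fix L :: real and N :: nat and \<sigma> and t :: nat
    assume L: "8 * C \<le> L" and N: "real N \<le> H * L" and cl: "closed_hierarchy C K \<nu> L N \<sigma>" and t: "t \<le> N"
    define h where "h = nat \<lfloor>L / (4 * C)\<rfloor>"
    have Lp: "L > 0" using L assms by linarith
    have h1: "real h \<le> L / (4 * C)" unfolding h_def using Lp assms by simp
    have h2: "real h \<ge> L / (8 * C)"
    proof -
      have "real h \<ge> L / (4 * C) - 1" unfolding h_def using Lp assms by linarith
      moreover have "L / (8 * C) \<ge> 1" using L assms by (simp add: field_simps)
      moreover have "L / (4 * C) = L / (8 * C) + L / (8 * C)" by (simp add: field_simps)
      ultimately show ?thesis by linarith
    qed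
    have "C * real h / L \<le> 1/4" using h1 Lp assms by (simp add: field_simps)
    moreover have "t \<le> j * h"
    proof -
      have "real N \<le> (8 * C * H) * (L / (8 * C))" using N assms by (simp add: field_simps)
      also have "\<dots> \<le> real j * real h"
      proof (rule mult_mono)
        show "8 * C * H \<le> real j" unfolding j_def by (rule real_nat_ceiling_ge)
      qed (use h2 Lp assms in auto)
      finally have "real t \<le> real (j * h)" using t by simp
      then show ?thesis by linarith
    qed
    ultimately show "\<sigma> 0 t \<le> \<epsilon>" using K(2)[OF Lp _ cl] t by auto
  qed
qed

section \<open>Balanced distribution of small pieces\<close>

text \<open>
  Putting a new item into a uniformly random bin changes the deviations of the loads from their mean
  by vectors that average to zero, so the cross terms cancel and the sum of squares grows on
  average by at most the square of the item. Some bin is no worse than the average.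
\<close>

lemma balanced_bins:
  fixes a b :: "'p \<Rightarrow> real" and B :: nat
  assumes "finite P" "B > 0"
  shows "\<exists>f. f ` P \<subseteq> {..<B} \<and>
     (\<Sum>i<B. ((\<Sum>p\<in>{p\<in>P. f p = i}. a p) - sum a P / B)\<^sup>2 + ((\<Sum>p\<in>{p\<in>P. f p = i}. b p) - sum b P / B)\<^sup>2)
       \<le> (\<Sum>p\<in>P. (a p)\<^sup>2 + (b p)\<^sup>2)"
  using assms(1)
proof (induction P rule: finite_induct)
  case empty
  then show ?case by simp
next
  case (insert p P)
  define dev :: "('p \<Rightarrow> real) \<Rightarrow> ('p \<Rightarrow> nat) \<Rightarrow> 'p set \<Rightarrow> nat \<Rightarrow> real" where
    "dev = (\<lambda>a f P i. (\<Sum>p\<in>{p\<in>P. f p = i}. a p) - sum a P / B)"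
  obtain f where f: "f ` P \<subseteq> {..<B}"
    "(\<Sum>i<B. (dev a f P i)\<^sup>2 + (dev b f P i)\<^sup>2) \<le> (\<Sum>p\<in>P. (a p)\<^sup>2 + (b p)\<^sup>2)"
    using insert.IH unfolding dev_def by blast
  define e :: "nat \<Rightarrow> nat \<Rightarrow> real" where "e = (\<lambda>j i. (if j = i then 1 else 0) - 1 / B)"
  have dev': "dev c (f(p := j)) (insert p P) i = dev c f P i + c p * e j i" for c j i
  proof -
    have "{q \<in> insert p P. (f(p := j)) q = i} = (if j = i then insert p {q\<in>P. f q = i} else {q\<in>P. f q = i})"
      using insert.hyps by auto
    then have "(\<Sum>q\<in>{q \<in> insert p P. (f(p := j)) q = i}. c q) = (if j = i then c p else 0) + (\<Sum>q\<in>{q\<in>P. f q = i}. c q)"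
      using insert.hyps by (auto split: if_splits)
    then show ?thesis
      unfolding dev_def e_def using insert.hyps by (simp add: add_divide_distrib algebra_simps)
  qed
  have sumdev: "(\<Sum>i<B. dev c f P i) = 0" for c
  proof -
    have "(\<Sum>i<B. (\<Sum>p\<in>{p\<in>P. f p = i}. c p)) = sum c P"
      using sum.group[OF insert.hyps(1) finite_lessThan f(1), of c] .
    then show ?thesis unfolding dev_def using assms(2) by (simp add: sum_subtractf)
  qed
  have avg: "(\<Sum>j<B. \<Sum>i<B. (dev c f P i + c p * e j i)\<^sup>2) \<le> B * ((\<Sum>i<B. (dev c f P i)\<^sup>2) + (c p)\<^sup>2)" for c
  proof -
    have esum: "(\<Sum>j<B. e j i) = 0" if "i < B" for i
      unfolding e_def using that assms(2) by (simp add: sum_subtractf sum.If_cases)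
    have esq: "(\<Sum>i<B. (e j i)\<^sup>2) \<le> 1" if "j < B" for j
    proof -
      have "(\<Sum>i<B. (e j i)\<^sup>2) = (\<Sum>i<B. (if j = i then 1 - 2 / real B else 0) + (1 / B)^2)"
        by (intro sum.cong) (auto simp: e_def power2_eq_square algebra_simps)
      also have "\<dots> = 1 - 2 / B + B * (1 / B)^2" using that by (simp add: sum.distrib)
      also have "\<dots> = 1 - 1 / B" using assms(2) by (simp add: power2_eq_square field_simps)
      finally show ?thesis by simp
    qed
    have "(\<Sum>j<B. \<Sum>i<B. (dev c f P i + c p * e j i)\<^sup>2)
       = (\<Sum>j<B. \<Sum>i<B. (dev c f P i)\<^sup>2) + (\<Sum>j<B. \<Sum>i<B. 2 * dev c f P i * c p * e j i) + (\<Sum>j<B. \<Sum>i<B. (c p)\<^sup>2 * (e j i)\<^sup>2)"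
      by (simp add: power2_sum sum.distrib power_mult_distrib algebra_simps)
    also have "(\<Sum>j<B. \<Sum>i<B. 2 * dev c f P i * c p * e j i) = 0"
      by (subst sum.swap) (simp add: sum_distrib_left[symmetric] esum)
    also have "(\<Sum>j<B. \<Sum>i<B. (c p)\<^sup>2 * (e j i)\<^sup>2) \<le> (\<Sum>j<B. (c p)\<^sup>2 * 1)"
      using esq by (intro sum_mono) (simp only: sum_distrib_left[symmetric], intro mult_left_mono, auto)
    finally show ?thesis by (simp add: algebra_simps)
  qed
  have "\<exists>j<B. (\<Sum>i<B. (dev a f P i + a p * e j i)\<^sup>2 + (dev b f P i + b p * e j i)\<^sup>2)
      \<le> (\<Sum>i<B. (dev a f P i)\<^sup>2 + (dev b f P i)\<^sup>2) + ((a p)\<^sup>2 + (b p)\<^sup>2)" (is "\<exists>j<B. ?g j \<le> ?r")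
  proof (rule ccontr)
    assume "\<not> ?thesis"
    then have "(\<Sum>j<B. ?g j) > (\<Sum>j<B. ?r)" using assms(2) by (intro sum_strict_mono) auto
    moreover have "(\<Sum>j<B. ?g j) \<le> (\<Sum>j<B. ?r)"
      using avg[of a] avg[of b] by (simp add: sum.distrib algebra_simps)
    ultimately show False by linarith
  qed
  then obtain j where j: "j < B" "?g j \<le> ?r" by blast
  have "(f(p := j)) ` insert p P \<subseteq> {..<B}" using f(1) j(1) by auto
  moreover have "(\<Sum>i<B. (dev a (f(p:=j)) (insert p P) i)\<^sup>2 + (dev b (f(p:=j)) (insert p P) i)\<^sup>2) \<le> (\<Sum>p\<in>insert p P. (a p)\<^sup>2 + (b p)\<^sup>2)"
    unfolding dev' using j(2) f(2) insert.hyps by simp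
  ultimately show ?case unfolding dev_def by blast
qed

text \<open>
  All squares together are at most \<open>M\<close> times the total size, so small items give small deviations in
  each single bin.
\<close>

lemma balanced_bins_small_pieces:
  fixes a b :: "'p \<Rightarrow> real" and B :: nat
  assumes "finite P" "B > 0" and nn: "\<And>p. p \<in> P \<Longrightarrow> 0 \<le> a p \<and> 0 \<le> b p \<and> a p + b p \<le> M"
    and tot: "sum a P + sum b P \<le> n" and e: "M * n \<le> e\<^sup>2" "e \<ge> 0"
  shows "\<exists>f. f ` P \<subseteq> {..<B} \<and> (\<forall>i<B.
     (\<Sum>p\<in>{p\<in>P. f p = i}. a p) \<le> sum a P / B + e \<and> (\<Sum>p\<in>{p\<in>P. f p = i}. b p) \<le> sum b P / B + e)"
proof -
  obtain f where f: "f ` P \<subseteq> {..<B}"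
     "(\<Sum>i<B. ((\<Sum>p\<in>{p\<in>P. f p = i}. a p) - sum a P / B)\<^sup>2 + ((\<Sum>p\<in>{p\<in>P. f p = i}. b p) - sum b P / B)\<^sup>2)
       \<le> (\<Sum>p\<in>P. (a p)\<^sup>2 + (b p)\<^sup>2)" (is "(\<Sum>i<B. ?x i + ?y i) \<le> _")
    using balanced_bins[OF assms(1,2), of a b] by blast
  have "(\<Sum>p\<in>P. (a p)\<^sup>2 + (b p)\<^sup>2) \<le> (\<Sum>p\<in>P. M * (a p + b p))"
  proof (intro sum_mono)
    fix p assume "p \<in> P"
    note h = nn[OF this]
    then have "a p * a p \<le> M * a p" "b p * b p \<le> M * b p" by (auto intro!: mult_right_mono)
    then show "(a p)\<^sup>2 + (b p)\<^sup>2 \<le> M * (a p + b p)" by (simp add: power2_eq_square algebra_simps)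
  qed
  also have "\<dots> = M * (sum a P + sum b P)" by (simp add: sum_distrib_left[symmetric] sum.distrib)
  also have "\<dots> \<le> e\<^sup>2"
  proof (cases "P = {}")
    case False
    then obtain p where "p \<in> P" by blast
    then have "M \<ge> 0" using nn[of p] by linarith
    then show ?thesis using mult_left_mono[OF tot] e by fastforce
  qed auto
  finally have le: "(\<Sum>i<B. ?x i + ?y i) \<le> e\<^sup>2" using f(2) by linarith
  have "?x i \<le> e\<^sup>2 \<and> ?y i \<le> e\<^sup>2" if "i < B" for i
  proof -
    have "?x i + ?y i \<le> (\<Sum>i<B. ?x i + ?y i)" using that by (intro member_le_sum) auto
    then show ?thesis using le by (smt (verit) zero_le_power2)
  qed
  then have "(\<Sum>p\<in>{p\<in>P. f p = i}. a p) - sum a P / B \<le> e \<and> (\<Sum>p\<in>{p\<in>P. f p = i}. b p) - sum b P / B \<le> e" if "i < B" for i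
    using that power2_le_imp_le[OF _ e(2)] by (meson)
  then show ?thesis using f(1) by (intro exI[of _ f]) (auto simp: algebra_simps)
qed

section \<open>Rooted enumeration of a tree\<close>

text \<open>
  A step to a vertex that has been visited before is replaced by cutting the path off there.
\<close>

lemma tree_walk_path:
  assumes "(u, w) \<in> {(x, y). {x, y} \<in> E}\<^sup>*"
  shows "\<exists>vs. vs \<noteq> [] \<and> hd vs = u \<and> last vs = w \<and> distinct vs \<and> (\<forall>i. Suc i < length vs \<longrightarrow> {vs ! i, vs ! Suc i} \<in> E)"
  using assms
proof (induction rule: rtrancl_induct)
  case base
  show ?case by (rule exI[of _ "[u]"]) simp
next
  case (step y z)
  then obtain vs where vs: "vs \<noteq> []" "hd vs = u" "last vs = y" "distinct vs" "\<And>i. Suc i < length vs \<Longrightarrow> {vs ! i, vs ! Suc i} \<in> E"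
    by blast
  show ?case
  proof (cases "z \<in> set vs")
    case True
    then obtain i where i: "i < length vs" "vs ! i = z" by (auto simp: in_set_conv_nth)
    have "take (Suc i) vs \<noteq> []" "hd (take (Suc i) vs) = u" using vs by (auto simp: hd_take)
    moreover have "last (take (Suc i) vs) = z" using i by (simp add: take_Suc_conv_app_nth)
    moreover have "distinct (take (Suc i) vs)" using vs by simp
    ultimately show ?thesis using vs(5) by (intro exI[of _ "take (Suc i) vs"]) auto
  next
    case False
    have "{(vs @ [z]) ! i, (vs @ [z]) ! Suc i} \<in> E" if "Suc i < length (vs @ [z])" for i
    proof (cases "Suc i < length vs")
      case True
      then show ?thesis using vs(5)[of i] by (simp add: nth_append)
    next
      case F: False
      then have "length vs = Suc i" using that by simp
      moreover from this have "vs ! i = y" using vs(1,3) by (simp add: last_conv_nth)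
      ultimately show ?thesis using step(2) by (simp add: nth_append)
    qed
    then show ?thesis using vs False by (intro exI[of _ "vs @ [z]"]) (simp del: nth_append length_append)
  qed
qed

definition rooted_enum :: "'a set set \<Rightarrow> nat \<Rightarrow> (nat \<Rightarrow> 'a) \<Rightarrow> (nat \<Rightarrow> nat) \<Rightarrow> bool" where
  "rooted_enum E m v par \<longleftrightarrow> inj_on v {..<m} \<and> (\<forall>t<m. 0 < t \<longrightarrow> par t < t \<and> {v t, v (par t)} \<in> E)"

lemma connected_enum:
  assumes "finite V" "connected_graph V E" "\<And>e. e \<in> E \<Longrightarrow> e \<subseteq> V"
  shows "0 < m \<Longrightarrow> m \<le> card V \<Longrightarrow> \<exists>v par. rooted_enum E m v par \<and> v ` {..<m} \<subseteq> V"
proof (induction m)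
  case (Suc m)
  show ?case
  proof (cases "m = 0")
    case True
    obtain r where "r \<in> V" using assms(2) by (auto simp: connected_graph_def)
    then show ?thesis using True by (intro exI[of _ "\<lambda>_. r"] exI[of _ "\<lambda>_. 0"]) (auto simp: rooted_enum_def inj_on_def)
  next
    case False
    then obtain v par where v: "rooted_enum E m v par" "v ` {..<m} \<subseteq> V" using Suc by auto
    have cm: "card (v ` {..<m}) = m" using v(1) by (simp add: rooted_enum_def card_image)
    then obtain w where w: "w \<in> V" "w \<notin> v ` {..<m}" using v(2) Suc.prems
      by (metis Suc_n_not_le_n subsetI subset_antisym)
    have v0: "v 0 \<in> v ` {..<m}" using False by simp
    then have "(v 0, w) \<in> {(x, y). {x, y} \<in> E}\<^sup>*" using assms(2) w v(2) by (auto simp: connected_graph_def)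
    then have "\<exists>x y. x \<in> v ` {..<m} \<and> y \<notin> v ` {..<m} \<and> {x, y} \<in> E"
      using w(2)
    proof (induction rule: rtrancl_induct)
      case base then show ?case using v0 by blast
    next
      case (step y z) then show ?case by (cases "y \<in> v ` {..<m}") auto
    qed
    then obtain i y where y: "i < m" "y \<notin> v ` {..<m}" "{v i, y} \<in> E" by blast
    have "y \<in> V" using y(3) assms(3) by blast
    have "rooted_enum E (Suc m) (v(m := y)) (par(m := i))"
      unfolding rooted_enum_def
    proof (intro conjI allI impI)
      show "inj_on (v(m := y)) {..<Suc m}"
        using v(1) y(2) unfolding rooted_enum_def lessThan_Suc by (auto simp: inj_on_def)
      fix t assume t: "t < Suc m" "0 < t"
      have h: "par t < t" "{v t, v (par t)} \<in> E" if "t < m" using v(1) t that by (auto simp: rooted_enum_def)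
      show "(par(m := i)) t < t" using t y h by (cases "t = m") auto
      show "{(v(m := y)) t, (v(m := y)) ((par(m := i)) t)} \<in> E"
        using t y h by (cases "t = m") (auto simp: insert_commute)
    qed
    moreover have "(v(m := y)) ` {..<Suc m} \<subseteq> V" using v(2) \<open>y \<in> V\<close> by (auto simp: lessThan_Suc)
    ultimately show ?thesis by blast
  qed
qed simp

text \<open>
  Growing a connected set vertex by vertex yields a spanning tree \<open>T\<close> of edges to earlier vertices.
  An edge outside \<open>T\<close> would close a path of \<open>T\<close> to a cycle.
\<close>

lemma tree_enumeration:
  assumes "tree_graph V E" "card V = n" 
  shows "\<exists>v par. bij_betw v {..<n} V \<and> (\<forall>t. 0 < t \<longrightarrow> t < n \<longrightarrow> par t < t) \<and> E = (\<lambda>t. {v t, v (par t)}) ` {0<..<n}"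
proof -
  have fin: "finite V" and sub: "\<And>e. e \<in> E \<Longrightarrow> e \<subseteq> V" and c2: "\<And>e. e \<in> E \<Longrightarrow> card e = 2"
    and con: "connected_graph V E" and acyc: "\<And>vs. \<not> graph_cycle E vs"
    using assms(1) by (auto simp: tree_graph_def fin_simple_graph_def)
  have "n > 0" using con fin assms(2) by (auto simp: connected_graph_def card_gt_0_iff)
  then obtain v par where v: "rooted_enum E n v par" "v ` {..<n} \<subseteq> V" using connected_enum[OF fin con sub] assms(2) by blast
  have img: "v ` {..<n} = V" using v assms(2) fin by (intro card_subset_eq) (auto simp: rooted_enum_def card_image)
  then have bij: "bij_betw v {..<n} V" using v(1) by (simp add: bij_betw_def rooted_enum_def)
  have par: "par t < t" "{v t, v (par t)} \<in> E" if "0 < t" "t < n" for t using v(1) that by (auto simp: rooted_enum_def)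
  define T where "T = (\<lambda>t. {v t, v (par t)}) ` {0<..<n}"
  have TE: "T \<subseteq> E" unfolding T_def using par by auto
  have symT: "sym {(x, y). {x, y} \<in> T}" by (auto simp: sym_def insert_commute)
  have root: "(v t, v 0) \<in> {(x, y). {x, y} \<in> T}\<^sup>*" if "t < n" for t
    using that
  proof (induction t rule: less_induct)
    case (less t)
    show ?case
    proof (cases "t = 0")
      case False
      then have "(v t, v (par t)) \<in> {(x, y). {x, y} \<in> T}" using less.prems by (auto simp: T_def)
      moreover have "(v (par t), v 0) \<in> {(x, y). {x, y} \<in> T}\<^sup>*" using less False par(1)[of t] by auto
      ultimately show ?thesis by (rule converse_rtrancl_into_rtrancl)
    qed simp
  qed
  have conT: "(x, y) \<in> {(x, y). {x, y} \<in> T}\<^sup>*" if V: "x \<in> V" "y \<in> V" for x y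
  proof -
    obtain s t where st: "s < n" "t < n" "x = v s" "y = v t" using V unfolding img[symmetric] by blast
    have "(v 0, v t) \<in> {(x, y). {x, y} \<in> T}\<^sup>*" using root[OF st(2)] sym_rtrancl[OF symT] by (meson symD)
    then show ?thesis using root[OF st(1)] st by (meson rtrancl_trans)
  qed
  have "E \<subseteq> T"
  proof (rule ccontr)
    assume "\<not> E \<subseteq> T"
    then obtain e where e: "e \<in> E" "e \<notin> T" by blast
    then obtain x y where xy: "e = {x, y}" "x \<noteq> y" using c2 by (metis card_2_iff)
    have "x \<in> V" "y \<in> V" using sub e xy by auto
    then obtain vs where vs: "vs \<noteq> []" "hd vs = x" "last vs = y" "distinct vs" "\<And>i. Suc i < length vs \<Longrightarrow> {vs ! i, vs ! Suc i} \<in> T"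
      using tree_walk_path[OF conT] by blast
    have l3: "length vs \<ge> 3"
    proof (rule ccontr)
      assume "\<not> ?thesis"
      moreover have "length vs \<noteq> 0" using vs(1) by simp
      ultimately have "length vs = 1 \<or> length vs = 2" by linarith
      then show False
      proof
        assume "length vs = 1"
        then show False using vs xy by (auto simp: length_Suc_conv)
      next
        assume "length vs = 2"
        then obtain a b where "vs = [a, b]" by (auto simp: length_Suc_conv numeral_2_eq_2)
        then show False using vs(2,3) vs(5)[of 0] xy e by simp
      qed
    qed
    have "graph_cycle E vs"
      unfolding graph_cycle_def
    proof (intro conjI l3 vs(4) allI impI)
      fix i assume i: "i < length vs"
      show "{vs ! i, vs ! (Suc i mod length vs)} \<in> E"
      proof (cases "Suc i < length vs")
        case True then show ?thesis using vs(5)[of i] TE by auto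
      next
        case False
        then have "Suc i = length vs" using i by simp
        moreover from this have "vs ! i = y" using vs(1,3) by (metis diff_Suc_1 last_conv_nth)
        moreover have "vs ! 0 = x" using vs(1,2) by (simp add: hd_conv_nth)
        ultimately show ?thesis using e xy by (simp add: insert_commute)
      qed
    qed
    then show False using acyc by blast
  qed
  then have "E = T" using TE by blast
  then show ?thesis using bij par(1) unfolding T_def by blast
qed

lemma card_children_le_max_degree:
  fixes par :: "nat \<Rightarrow> nat"
  assumes "inj_on v {..<n}" "E = (\<lambda>t. {v t, v (par t)}) ` {0<..<n}" "finite V" "v ` {..<n} = V"
    "\<forall>t. 0 < t \<longrightarrow> t < n \<longrightarrow> par t < t" "s < n"
  shows "card {t. 0 < t \<and> t < n \<and> par t = s} \<le> max_vertex_degree V E"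
proof -
  let ?C = "{t. 0 < t \<and> t < n \<and> par t = s}"
  have "inj_on (\<lambda>t. {v t, v (par t)}) ?C"
  proof (rule inj_onI)
    fix t t' assume t: "t \<in> ?C" "t' \<in> ?C" "{v t, v (par t)} = {v t', v (par t')}"
    then have "v t = v t' \<or> v t = v s" by (auto simp: doubleton_eq_iff)
    then show "t = t'" using assms(1,5) t by (auto simp: inj_on_def)
  qed
  then have "card ?C = card ((\<lambda>t. {v t, v (par t)}) ` ?C)" by (rule card_image[symmetric])
  also have "\<dots> \<le> card {e \<in> E. v s \<in> e}"
  proof (rule card_mono)
    have "finite E" using assms(2) by simp
    then show "finite {e \<in> E. v s \<in> e}" by simp
  qed (use assms(2) in auto)
  also have "\<dots> = vertex_degree E (v s)" by (simp add: vertex_degree_def)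
  also have "\<dots> \<le> max_vertex_degree V E" unfolding max_vertex_degree_def
    by (rule Max_ge) (use assms in auto)
  finally show ?thesis .
qed

section \<open>Cutting a tree into small pieces\<close>

text \<open>
  The number of descendants of \<open>i\<close>, itself included, that remain attached to \<open>i\<close> when, from the last
  vertex to the first, each branch is cut off as soon as it has at least \<open>M\<close> vertices.
\<close>

function branch_size :: "nat \<Rightarrow> (nat \<Rightarrow> nat) \<Rightarrow> nat \<Rightarrow> nat \<Rightarrow> nat" where
  "branch_size n par M i = 1 + (\<Sum>c | i < c \<and> c < n \<and> par c = i. if branch_size n par M c < M then branch_size n par M c else 0)"
  by auto
termination
  by (relation "measure (\<lambda>(n, par, M, i). n - i)") auto

declare branch_size.simps [simp del]

text \<open>
  The first vertex of the piece of \<open>t\<close> after deletion of all edges at vertices of \<open>S\<close>; the test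
  \<open>t \<le> par t\<close> makes the recursion terminate for every \<open>par\<close>.
\<close>

function piece_root :: "(nat \<Rightarrow> nat) \<Rightarrow> nat set \<Rightarrow> nat \<Rightarrow> nat" where
  "piece_root par S t = (if t = 0 \<or> t \<in> S \<or> par t \<in> S \<or> t \<le> par t then t else piece_root par S (par t))"
  by auto
termination
  by (relation "measure (\<lambda>(par, S, t). t)") auto

declare piece_root.simps [simp del]

lemma piece_root_le: "piece_root par S t \<le> t"
proof (induction t rule: less_induct)
  case (less t)
  show ?case
  proof (cases "t = 0 \<or> t \<in> S \<or> par t \<in> S \<or> t \<le> par t")
    case True
    then show ?thesis by (subst piece_root.simps) auto
  next
    case False
    then have "piece_root par S t = piece_root par S (par t)" by (subst piece_root.simps) auto
    also have "\<dots> \<le> par t" using less[of "par t"] False by simp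
    finally show ?thesis using False by simp
  qed
qed

text \<open>
  The cut vertices are those whose branch has at least \<open>M\<close> vertices. Branches of different cut
  vertices are disjoint, which bounds their number. A cut vertex is a piece of its own, and every
  other piece is contained in a branch that was not cut off.
\<close>

lemma cut_into_small_pieces:
  fixes par :: "nat \<Rightarrow> nat"
  assumes par: "\<And>t. 0 < t \<Longrightarrow> t < n \<Longrightarrow> par t < t" and "M \<ge> 1"
  shows "\<exists>S\<subseteq>{..<n}. card S * M \<le> n \<and> (\<forall>r. card {t. t < n \<and> piece_root par S t = r} \<le> M)"
proof -
  define b where "b = branch_size n par M"
  define g where "g = (\<lambda>c. if b c < M then b c else 0)"
  define ch where "ch = (\<lambda>i. {c. i < c \<and> c < n \<and> par c = i})"
  have b: "b i = 1 + (\<Sum>c\<in>ch i. g c)" for i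
    unfolding b_def g_def ch_def by (subst branch_size.simps) simp
  define S where "S = {c. c < n \<and> M \<le> b c}"
  have finS: "finite S" "S \<subseteq> {..<n}" unfolding S_def by auto
  have "card S * M \<le> n"
  proof (cases "n = 0")
    case False
    have "(\<Sum>i<n. b i) = n + (\<Sum>i<n. \<Sum>c\<in>ch i. g c)" unfolding b by (subst sum.distrib) simp
    also have "(\<Sum>i<n. \<Sum>c\<in>ch i. g c) = (\<Sum>i\<in>{..<n}. \<Sum>c | c \<in> {0<..<n} \<and> par c = i. g c)"
      by (intro sum.cong refl arg_cong2[where f=sum]) (auto simp: ch_def dest: par)
    also have "\<dots> = (\<Sum>c\<in>{0<..<n}. g c)"
    proof (rule sum.group)
      show "par ` {0<..<n} \<subseteq> {..<n}" 
      proof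
        fix c assume "c \<in> par ` {0<..<n}"
        then obtain t where "0 < t" "t < n" "c = par t" by auto
        then show "c \<in> {..<n}" using par[of t] by simp
      qed
    qed auto
    also have "\<dots> \<le> (\<Sum>c<n. g c)" by (rule sum_mono2) auto
    also have "(\<Sum>c<n. g c) + card S * M \<le> (\<Sum>c<n. b c)"
    proof -
      have "card S * M = (\<Sum>c<n. if c \<in> S then M else 0)"
        using finS by (simp add: sum.If_cases Int_absorb1)
      also have "(\<Sum>c<n. g c) + \<dots> = (\<Sum>c<n. g c + (if c \<in> S then M else 0))" by (simp add: sum.distrib)
      also have "\<dots> \<le> (\<Sum>c<n. b c)" by (rule sum_mono) (auto simp: g_def S_def)
      finally show ?thesis .
    qed
    ultimately show ?thesis by linarith
  qed (use finS in auto)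
  moreover have "card {t. t < n \<and> piece_root par S t = r} \<le> M" for r
  proof -
    define R where "R = {(par c, c) | c. 0 < c \<and> c < n \<and> c \<notin> S \<and> par c \<notin> S}"
    define A where "A = (\<lambda>i. {t. t < n \<and> (i, t) \<in> R\<^sup>*})"
    have finA: "finite (A i)" for i unfolding A_def by simp
    have A_sub: "A i \<subseteq> insert i (\<Union>c\<in>{c \<in> ch i. c \<notin> S \<and> i \<notin> S}. A c)" for i
    proof
      fix t assume "t \<in> A i"
      then have t: "t < n" "(i, t) \<in> R\<^sup>*" by (auto simp: A_def)
      from t(2) show "t \<in> insert i (\<Union>c\<in>{c \<in> ch i. c \<notin> S \<and> i \<notin> S}. A c)"
      proof (cases rule: converse_rtranclE)
        case (step y)
        then have "y \<in> ch i" "y \<notin> S" "i \<notin> S" using par by (auto simp: R_def ch_def)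
        then show ?thesis using step t by (auto simp: A_def)
      qed simp
    qed
    have cardA: "card (A i) \<le> b i" for i
    proof (induction "n - i" arbitrary: i rule: less_induct)
      case less
      have "card (A i) \<le> card (insert i (\<Union>c\<in>{c \<in> ch i. c \<notin> S \<and> i \<notin> S}. A c))"
        by (rule card_mono) (use finA A_sub in \<open>auto simp: ch_def\<close>)
      also have "\<dots> \<le> 1 + card (\<Union>c\<in>{c \<in> ch i. c \<notin> S \<and> i \<notin> S}. A c)"
        by (rule card_insert_le_m1) auto
      also have "card (\<Union>c\<in>{c \<in> ch i. c \<notin> S \<and> i \<notin> S}. A c) \<le> (\<Sum>c\<in>{c \<in> ch i. c \<notin> S \<and> i \<notin> S}. card (A c))"
        by (rule card_UN_le) (auto simp: ch_def)
      also have "\<dots> \<le> (\<Sum>c\<in>{c \<in> ch i. c \<notin> S \<and> i \<notin> S}. g c)"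
      proof (rule sum_mono)
        fix c assume c: "c \<in> {c \<in> ch i. c \<notin> S \<and> i \<notin> S}"
        then have "card (A c) \<le> b c" by (intro less) (auto simp: ch_def)
        then show "card (A c) \<le> g c" using c by (auto simp: g_def S_def ch_def)
      qed
      also have "\<dots> \<le> (\<Sum>c\<in>ch i. g c)" by (rule sum_mono2) (auto simp: ch_def)
      finally show ?case using b[of i] by simp
    qed
    have reach: "(piece_root par S t, t) \<in> R\<^sup>*" if "t < n" for t
      using that
    proof (induction t rule: less_induct)
      case (less t)
      show ?case
      proof (cases "t = 0 \<or> t \<in> S \<or> par t \<in> S \<or> t \<le> par t")
        case True then show ?thesis by (subst piece_root.simps) auto
      next
        case False
        then have "(piece_root par S (par t), par t) \<in> R\<^sup>*" using less by auto
        moreover have "(par t, t) \<in> R" using False less.prems by (auto simp: R_def)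
        ultimately show ?thesis using False by (subst piece_root.simps) auto
      qed
    qed
    have "{t. t < n \<and> piece_root par S t = r} \<subseteq> A r" using reach by (auto simp: A_def)
    then have "card {t. t < n \<and> piece_root par S t = r} \<le> card (A r)" by (intro card_mono finA)
    also have "\<dots> \<le> M"
    proof (cases "r \<in> S \<or> n \<le> r")
      case True
      then have "A r \<subseteq> {r}" using A_sub[of r] by (auto simp: ch_def)
      then have "card (A r) \<le> 1" using card_mono[of "{r}"] by fastforce
      then show ?thesis using assms(2) by linarith
    next
      case False then show ?thesis using cardA[of r] by (auto simp: S_def)
    qed
    finally show ?thesis .
  qed
  ultimately show ?thesis using finS by blast
qed

lemma rank_by_key:
  fixes key :: "nat \<Rightarrow> nat"
  assumes "inj_on key {..<n}"
  shows "\<exists>r. bij_betw r {..<n} {..<n} \<and> (\<forall>v<n. \<forall>w<n. key v < key w \<longleftrightarrow> r v < r w)"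
proof -
  define r where "r = (\<lambda>v. card {w. w < n \<and> key w < key v})"
  have lt: "r v < r w" if "v < n" "w < n" "key v < key w" for v w
    unfolding r_def by (rule psubset_card_mono) (use that in auto)
  have inj: "inj_on r {..<n}"
  proof (rule inj_onI)
    fix v w assume vw: "v \<in> {..<n}" "w \<in> {..<n}" "r v = r w"
    then have "\<not> key v < key w" "\<not> key w < key v" using lt by fastforce+
    then show "v = w" using assms vw by (auto simp: inj_on_def)
  qed
  have "r v < n" if "v < n" for v
  proof -
    have "r v < card {..<n}" unfolding r_def by (rule psubset_card_mono) (use that in auto)
    then show ?thesis by simp
  qed
  then have "r ` {..<n} = {..<n}" using inj by (intro card_subset_eq) (auto simp: card_image)
  then have "bij_betw r {..<n} {..<n}" using inj by (simp add: bij_betw_def)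
  moreover have "key v < key w \<longleftrightarrow> r v < r w" if "v < n" "w < n" for v w
    using lt that assms by (metis inj_on_eq_iff lessThan_iff less_asym' linorder_neqE_nat)
  ultimately show ?thesis by blast
qed

section \<open>Enumeration of a tree by pieces\<close>

function level :: "(nat \<Rightarrow> nat) \<Rightarrow> nat \<Rightarrow> nat" where
  "level par t = (if t = 0 \<or> t \<le> par t then 0 else Suc (level par (par t)))"
  by auto
termination
  by (relation "measure (\<lambda>(par, t). t)") auto

declare level.simps [simp del]

text \<open>
  The vertices are sorted by the first vertex of their piece and then by their old position. This
  keeps parents before children, since the piece of the parent never starts later, and makes pieces
  contiguous, so that a child in the same piece follows its parent by at most \<open>M\<close>. The jumps are the
  root, the cut vertices and their children.
\<close>

lemma tree_layout:
  assumes T: "tree_graph V E" "card V = n" and \<Delta>: "max_vertex_degree V E \<le> \<Delta>" and M: "M \<ge> 1"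
  shows "\<exists>v par piece col jump. bij_betw v {..<n} V \<and> E = (\<lambda>t. {v t, v (par t)}) ` {0<..<n} \<and>
     (\<forall>t. 0 < t \<longrightarrow> t < n \<longrightarrow> par t < t) \<and> jump 0 \<and>
     (\<forall>t<n. \<not> jump t \<longrightarrow> piece t = piece (par t) \<and> col t = (\<not> col (par t)) \<and> t \<le> par t + M) \<and>
     (\<forall>r::nat. card {t. t < n \<and> piece t = r} \<le> M) \<and>
     card {t. t < n \<and> jump t} * M \<le> M + n * (1 + \<Delta>) \<and>
     (\<forall>s<n. card {t. 0 < t \<and> t < n \<and> par t = s} \<le> \<Delta>)"
proof -
  obtain v par where v: "bij_betw v {..<n} V" "\<forall>t. 0 < t \<longrightarrow> t < n \<longrightarrow> par t < t" "E = (\<lambda>t. {v t, v (par t)}) ` {0<..<n}"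
    using tree_enumeration[OF T] by blast
  have fin: "finite V" using T(1) by (simp add: tree_graph_def fin_simple_graph_def)
  have par: "par t < t" if "0 < t" "t < n" for t using v(2) that by blast
  have ch: "card {t. 0 < t \<and> t < n \<and> par t = s} \<le> \<Delta>" if "s < n" for s
    using card_children_le_max_degree[OF _ v(3) fin _ v(2) that] v(1) \<Delta> unfolding bij_betw_def by fastforce
  obtain S where S: "S \<subseteq> {..<n}" "card S * M \<le> n" "\<And>r. card {t. t < n \<and> piece_root par S t = r} \<le> M"
    using cut_into_small_pieces[OF par M] by blast
  have finS: "finite S" using S(1) finite_subset by blast
  define pc where "pc = piece_root par S"
  (* Encodes the lexicographic order on pairs of piece and old position. *)
  define key where "key = (\<lambda>t. pc t * n + t)"
  have keydm: "key t div n = pc t" "key t mod n = t" if "t < n" for t using that by (auto simp: key_def)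
  have "inj_on key {..<n}" by (rule inj_onI) (metis keydm(2) lessThan_iff)
  then obtain r where r: "bij_betw r {..<n} {..<n}" "\<And>v w. v < n \<Longrightarrow> w < n \<Longrightarrow> key v < key w \<longleftrightarrow> r v < r w"
    using rank_by_key by meson
  define i where "i = inv_into {..<n} r"
  have i: "bij_betw i {..<n} {..<n}" unfolding i_def using r(1) by (rule bij_betw_inv_into)
  have i_lt: "i t < n" if "t < n" for t using i that by (auto simp: bij_betw_def)
  have r_lt: "r t < n" if "t < n" for t using r that by (auto simp: bij_betw_def)
  have ri: "r (i t) = t" if "t < n" for t unfolding i_def using r(1) that by (simp add: bij_betw_inv_into_right)
  have ir: "i (r t) = t" if "t < n" for t unfolding i_def using r(1) that by (simp add: bij_betw_inv_into_left)
  define v' where "v' = v \<circ> i"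
  define par' where "par' = r \<circ> par \<circ> i"
  define J where "J = (\<lambda>t. t = 0 \<or> t \<in> S \<or> par t \<in> S)"
  have i0: "i 0 = 0" if "0 < n"
  proof (rule ccontr)
    assume "i 0 \<noteq> 0"
    have "pc 0 = 0" unfolding pc_def using piece_root_le[of par S 0] by simp
    then have "key 0 < key (i 0)" using \<open>i 0 \<noteq> 0\<close> by (simp add: key_def)
    then have "r 0 < r (i 0)" using r(2) i_lt that by auto
    then show False using ri that by simp
  qed
  have pos: "i t \<noteq> 0 \<longleftrightarrow> t \<noteq> 0" if "t < n" for t
    using i0 ri[OF that] ri[of 0] that by (metis gr_zeroI not_less_zero)
  have keypar: "key (par t) < key t" if "0 < t" "t < n" for t
  proof -
    have pt: "par t < t" "par t < n" using par[OF that] that by auto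
    have "pc (par t) \<le> pc t"
    proof (cases "t \<in> S \<or> par t \<in> S")
      case True
      then have "pc t = t" unfolding pc_def by (subst piece_root.simps) auto
      then show ?thesis using piece_root_le[of par S "par t"] pt by (simp add: pc_def)
    next
      case False
      then show ?thesis unfolding pc_def using pt that by (subst (2) piece_root.simps) auto
    qed
    then have "pc (par t) * n \<le> pc t * n" by simp
    then show ?thesis unfolding key_def using pt by linarith
  qed
  have par': "par' t < t" if "0 < t" "t < n" for t
  proof -
    have "0 < i t" "i t < n" using pos i_lt that by auto
    then have "r (par (i t)) < r (i t)" using r(2) keypar par[of "i t"] by (meson less_trans)
    then show ?thesis using ri that by (simp add: par'_def)
  qed
  have A1: "bij_betw v' {..<n} V" unfolding v'_def using i v(1) by (rule bij_betw_trans)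
  have A2: "E = (\<lambda>t. {v' t, v' (par' t)}) ` {0<..<n}"
  proof -
    have im: "i ` {0<..<n} = {0<..<n}"
    proof
      show "i ` {0<..<n} \<subseteq> {0<..<n}" using pos i_lt by fastforce
      show "{0<..<n} \<subseteq> i ` {0<..<n}"
      proof
        fix t assume t: "t \<in> {0<..<n}"
        then have tr: "i (r t) = t" "r t < n" using ir r_lt by auto
        then have "r t \<noteq> 0" using pos[of "r t"] t by auto
        then have "i (r t) \<in> i ` {0<..<n}" using tr(2) by (intro imageI) auto
        then show "t \<in> i ` {0<..<n}" using tr(1) by simp
      qed
    qed
    have "E = (\<lambda>t. {v t, v (par t)}) ` i ` {0<..<n}" unfolding im by (rule v(3))
    also have "\<dots> = (\<lambda>t. {v (i t), v (par (i t))}) ` {0<..<n}" by (simp add: image_image)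
    also have "\<dots> = (\<lambda>t. {v' t, v' (par' t)}) ` {0<..<n}"
    proof (rule image_cong[OF refl])
      fix t assume t: "t \<in> {0<..<n}"
      then have "i t > 0" "i t < n" using pos i_lt by auto
      then have "par (i t) < n" using par by (meson less_trans)
      then show "{v (i t), v (par (i t))} = {v' t, v' (par' t)}" by (simp add: v'_def par'_def ir)
    qed
    finally show ?thesis .
  qed
  have "n \<noteq> 0" using T by (auto simp: tree_graph_def connected_graph_def fin_simple_graph_def)
  then have A3: "(J \<circ> i) 0" using i0 by (simp add: J_def)
  have A4: "(pc \<circ> i) t = (pc \<circ> i) (par' t) \<and> even (level par (i t)) = (\<not> even (level par (i (par' t)))) \<and> t \<le> par' t + M"
    if t: "t < n" "\<not> (J \<circ> i) t" for t
  proof -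
    have nt: "i t \<noteq> 0" "i t \<notin> S" "par (i t) \<notin> S" "i t < n" using t i_lt by (auto simp: J_def)
    have pt: "par (i t) < i t" "par (i t) < n" using par[of "i t"] nt by auto
    have ip: "i (par' t) = par (i t)" using ir pt by (simp add: par'_def)
    have same: "pc (i t) = pc (par (i t))" unfolding pc_def using nt pt by (subst piece_root.simps) auto
    have lev: "level par (i t) = Suc (level par (par (i t)))" using nt pt by (subst level.simps) auto
    have "{par' t..<t} \<subseteq> r ` {w. w < n \<and> pc w = pc (i t)}"
    proof
      fix s assume s: "s \<in> {par' t..<t}"
      have sn: "s < n" using s t by auto
      have "key (i s) < key (i t)" using r(2)[of "i s" "i t"] ri s t sn i_lt by simp
      then have "pc (i s) \<le> pc (i t)" using keydm i_lt[OF sn] i_lt[OF t(1)] div_le_mono[of "key (i s)" "key (i t)" n] by simp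
      moreover have "\<not> key (i s) < key (par (i t))" using r(2)[of "i s" "par (i t)"] ri s sn i_lt pt by (simp add: par'_def)
      then have "key (par (i t)) \<le> key (i s)" by simp
      then have "pc (par (i t)) \<le> pc (i s)" using keydm i_lt[OF sn] pt div_le_mono[of "key (par (i t))" "key (i s)" n] by simp
      ultimately have "i s \<in> {w. w < n \<and> pc w = pc (i t)}" using same i_lt sn by auto
      then show "s \<in> r ` {w. w < n \<and> pc w = pc (i t)}" using ri[OF sn] by (metis imageI)
    qed
    then have "card {par' t..<t} \<le> card (r ` {w. w < n \<and> pc w = pc (i t)})" by (intro card_mono) auto
    also have "\<dots> \<le> card {w. w < n \<and> pc w = pc (i t)}" by (rule card_image_le) auto
    also have "\<dots> \<le> M" unfolding pc_def by (rule S(3))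
    finally have "t \<le> par' t + M" by simp
    then show ?thesis using same lev ip by simp
  qed
  have A5: "card {t. t < n \<and> (pc \<circ> i) t = p} \<le> M" for p
  proof -
    have "{t. t < n \<and> (pc \<circ> i) t = p} \<subseteq> r ` {t. t < n \<and> pc t = p}"
    proof
      fix t assume t: "t \<in> {t. t < n \<and> (pc \<circ> i) t = p}"
      then have rt: "r (i t) = t" "i t \<in> {t. t < n \<and> pc t = p}" using ri i_lt by auto
      show "t \<in> r ` {t. t < n \<and> pc t = p}" by (rule image_eqI[where f=r, OF rt(1)[symmetric] rt(2)])
    qed
    then have "card {t. t < n \<and> (pc \<circ> i) t = p} \<le> card (r ` {t. t < n \<and> pc t = p})" by (intro card_mono) auto
    also have "\<dots> \<le> card {t. t < n \<and> pc t = p}" by (rule card_image_le) auto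
    also have "\<dots> \<le> M" unfolding pc_def by (rule S(3))
    finally show ?thesis .
  qed
  have A6: "card {t. t < n \<and> (J \<circ> i) t} * M \<le> M + n * (1 + \<Delta>)"
  proof -
    define C where "C = (\<lambda>s. {t. 0 < t \<and> t < n \<and> par t = s})"
    have "finite (C s)" for s unfolding C_def by (rule finite_subset[of _ "{..<n}"]) auto
    then have finU0: "finite ({0} \<union> S \<union> (\<Union>s\<in>S. C s))" using finS by simp
    then have finU: "finite (r ` ({0} \<union> S \<union> (\<Union>s\<in>S. C s)))" by (rule finite_imageI)
    have "{t. t < n \<and> (J \<circ> i) t} \<subseteq> r ` ({0} \<union> S \<union> (\<Union>s\<in>S. C s))"
    proof
      fix t assume t: "t \<in> {t. t < n \<and> (J \<circ> i) t}"
      then have rt: "r (i t) = t" "i t \<in> {0} \<union> S \<union> (\<Union>s\<in>S. C s)" using ri[of t] i_lt[of t] by (auto simp: J_def C_def)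
      show "t \<in> r ` ({0} \<union> S \<union> (\<Union>s\<in>S. C s))" by (rule image_eqI[where f=r, OF rt(1)[symmetric] rt(2)])
    qed
    then have "card {t. t < n \<and> (J \<circ> i) t} \<le> card (r ` ({0} \<union> S \<union> (\<Union>s\<in>S. C s)))" using finU by (rule card_mono[rotated])
    also have "\<dots> \<le> card ({0} \<union> S \<union> (\<Union>s\<in>S. C s))" by (rule card_image_le[OF finU0])
    also have "\<dots> \<le> card ({0} \<union> S) + card (\<Union>s\<in>S. C s)" by (rule card_Un_le)
    also have "card ({0} \<union> S) \<le> 1 + card S" using card_Un_le[of "{0}" S] by simp
    also have "card (\<Union>s\<in>S. C s) \<le> (\<Sum>s\<in>S. card (C s))" by (rule card_UN_le[OF finS])
    also have "\<dots> \<le> (\<Sum>s\<in>S. \<Delta>)" using ch S(1) unfolding C_def by (intro sum_mono) auto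
    finally have "card {t. t < n \<and> (J \<circ> i) t} \<le> 1 + card S * (1 + \<Delta>)" by simp
    then have "card {t. t < n \<and> (J \<circ> i) t} * M \<le> (1 + card S * (1 + \<Delta>)) * M" by (rule mult_le_mono1)
    also have "\<dots> = M + (card S * M) * (1 + \<Delta>)" by (simp add: algebra_simps)
    also have "\<dots> \<le> M + n * (1 + \<Delta>)" using S(2) by (intro add_left_mono mult_le_mono1)
    finally show ?thesis .
  qed
  have A7: "card {t. 0 < t \<and> t < n \<and> par' t = s} \<le> \<Delta>" if s: "s < n" for s
  proof -
    have finC: "finite {t. 0 < t \<and> t < n \<and> par t = i s}" by (rule finite_subset[of _ "{..<n}"]) auto
    have "{t. 0 < t \<and> t < n \<and> par' t = s} \<subseteq> r ` {t. 0 < t \<and> t < n \<and> par t = i s}"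
    proof
      fix t assume t: "t \<in> {t. 0 < t \<and> t < n \<and> par' t = s}"
      have t': "0 < t" "t < n" "r (par (i t)) = s" using t unfolding par'_def o_apply by blast+
      have it: "0 < i t" "i t < n" using pos[OF t'(2)] i_lt[OF t'(2)] t'(1) by simp_all
      then have "par (i t) < n" using par by (meson less_trans)
      then have "par (i t) = i s" using t'(3) ir by metis
      then have "i t \<in> {t. 0 < t \<and> t < n \<and> par t = i s}" using it by simp
      then have "r (i t) \<in> r ` {t. 0 < t \<and> t < n \<and> par t = i s}" by (rule imageI)
      then show "t \<in> r ` {t. 0 < t \<and> t < n \<and> par t = i s}" using ri[OF t'(2)] by simp
    qed
    moreover have "finite (r ` {t. 0 < t \<and> t < n \<and> par t = i s})" using finC by (rule finite_imageI)
    ultimately have "card {t. 0 < t \<and> t < n \<and> par' t = s} \<le> card (r ` {t. 0 < t \<and> t < n \<and> par t = i s})" by (rule card_mono[rotated])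
    also have "\<dots> \<le> card {t. 0 < t \<and> t < n \<and> par t = i s}" by (rule card_image_le[OF finC])
    also have "\<dots> \<le> \<Delta>" by (rule ch[OF i_lt[OF s]])
    finally show ?thesis .
  qed
  show ?thesis
    by (rule exI[of _ v'], rule exI[of _ par'], rule exI[of _ "pc \<circ> i"], rule exI[of _ "\<lambda>t. even (level par (i t))"],
        rule exI[of _ "J \<circ> i"], intro conjI A1 A2 A3 A6 allI impI)
      (use A4 A5 A7 par' in \<open>simp_all del: o_apply\<close>)
qed

section \<open>Moves and statistics\<close>

type_synonym resource = "int + int"

text \<open>
  The left summand holds labels, the right one differences.
\<close>

definition move :: "int \<Rightarrow> int \<Rightarrow> resource set" where
  "move p y = {Inl y, Inr \<bar>y - p\<bar>}"

lemma finite_move [simp]: "finite (move p y)" by (simp add: move_def)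

lemma card_move [simp]: "card (move p y) = 2" by (simp add: move_def)

lemma card_moves_through: "card {y \<in> A. \<omega> \<in> move p y} \<le> 2"
proof (cases \<omega>)
  case (Inl a)
  have "card {y \<in> A. \<omega> \<in> move p y} \<le> card {a}"
    by (rule card_mono) (auto simp: move_def Inl)
  then show ?thesis by simp
next
  case (Inr d)
  have "card {y \<in> A. \<omega> \<in> move p y} \<le> card {p + d, p - d}"
    by (rule card_mono) (auto simp: move_def Inr)
  also have "\<dots> \<le> 2" by (simp add: card_insert_if)
  finally show ?thesis .
qed

text \<open>
  A label \<open>y\<close> and a difference \<open>d\<close> form a move only for the two values \<open>p = y \<plusminus> d\<close>; the
  truth value in the injection tells these apart.
\<close>

lemma sum_card_moves_inside:
  assumes "finite f" "finite P"
  shows "(\<Sum>p\<in>P. card {y \<in> P. move p y \<subseteq> f}) \<le> 2 * card f ^ 2"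
proof -
  let ?A = "Sigma P (\<lambda>p. {y \<in> P. move p y \<subseteq> f})"
  let ?g = "\<lambda>(p, y). (Inl y :: resource, Inr \<bar>y - p\<bar> :: resource, p \<le> y)"
  have "(\<Sum>p\<in>P. card {y \<in> P. move p y \<subseteq> f}) = card ?A"
    using assms(2) by (simp add: card_SigmaI)
  also have "\<dots> \<le> card (f \<times> f \<times> (UNIV :: bool set))"
  proof (rule card_inj_on_le)
    show "inj_on ?g ?A" by (auto simp: inj_on_def abs_if split: if_splits)
    show "?g ` ?A \<subseteq> f \<times> f \<times> UNIV" by (auto simp: move_def)
  qed (use assms in auto)
  also have "\<dots> = 2 * card f ^ 2" by (simp add: card_cartesian_product power2_eq_square)
  finally show ?thesis .
qed

type_synonym functional = "(resource set \<Rightarrow> real) \<Rightarrow> real"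

text \<open>
  A weighted family of resource sets is represented by the functional that sums a function over it.
  Positivity is required only with respect to subsets of \<open>\<Omega>\<close> with at most \<open>N\<close> elements, which expresses that the family
  consists of such sets.
\<close>

definition positive_on :: "resource set \<Rightarrow> nat \<Rightarrow> functional \<Rightarrow> bool" where
  "positive_on \<Omega> N F \<longleftrightarrow>
     (\<forall>g h. F (\<lambda>f. g f + h f) = F g + F h) \<and> (\<forall>c h. F (\<lambda>f. c * h f) = c * F h) \<and>
     (\<forall>g h. (\<forall>f. finite f \<and> card f \<le> N \<and> f \<subseteq> \<Omega> \<longrightarrow> g f \<le> h f) \<longrightarrow> F g \<le> F h)"

lemma positive_onD:
  assumes "positive_on \<Omega> N F"
  shows positive_on_add: "F (\<lambda>f. g f + h f) = F g + F h"
    and positive_on_scale: "F (\<lambda>f. c * h f) = c * F h"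
    and positive_on_mono: "(\<And>f. finite f \<Longrightarrow> card f \<le> N \<Longrightarrow> f \<subseteq> \<Omega> \<Longrightarrow> g f \<le> h f) \<Longrightarrow> F g \<le> F h"
  using assms by (auto simp: positive_on_def)

lemma positive_on_0: "positive_on \<Omega> N F \<Longrightarrow> F (\<lambda>f. 0) = 0"
  using positive_on_scale[of \<Omega> N F 0 "\<lambda>_. 0"] by simp

lemma positive_on_diff: "positive_on \<Omega> N F \<Longrightarrow> F (\<lambda>f. g f - h f) = F g - F h"
  using positive_on_add[of \<Omega> N F g "\<lambda>f. -1 * h f"] positive_on_scale[of \<Omega> N F "-1" h] by simp

lemma positive_on_sum:
  assumes "positive_on \<Omega> N F"
  shows "F (\<lambda>f. \<Sum>a\<in>A. h a f) = (\<Sum>a\<in>A. F (h a))"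
  by (induction A rule: infinite_finite_induct)
    (use positive_on_0[OF assms] positive_on_add[OF assms] in auto)

lemma positive_on_nonneg:
  assumes "positive_on \<Omega> N F" "\<And>f. finite f \<Longrightarrow> card f \<le> N \<Longrightarrow> f \<subseteq> \<Omega> \<Longrightarrow> 0 \<le> h f"
  shows "0 \<le> F h"
  using positive_on_mono[OF assms(1), of "\<lambda>_. 0" h] positive_on_0[OF assms(1)] assms(2) by simp

lemma positive_on_abs_le:
  assumes "positive_on \<Omega> N F" "\<And>f. finite f \<Longrightarrow> card f \<le> N \<Longrightarrow> f \<subseteq> \<Omega> \<Longrightarrow> \<bar>h f\<bar> \<le> g f"
  shows "\<bar>F h\<bar> \<le> F g"
proof -
  have "F h \<le> F g" by (rule positive_on_mono[OF assms(1)]) (use assms(2) in fastforce)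
  moreover have "F (\<lambda>f. -1 * h f) \<le> F g" by (rule positive_on_mono[OF assms(1)]) (use assms(2) in fastforce)
  ultimately show ?thesis using positive_on_scale[OF assms(1), of "-1" h] by simp
qed

text \<open>
  Bounds, divided by \<open>L\<close>, for the total weight of a statistic of level \<open>k\<close>. The factor \<open>k + 2\<close>
  is the number of resources in a set to which a move can be joined; it is the origin of the factor
  in \<open>closed_hierarchy\<close>.
\<close>

primrec weight_bound :: "real \<Rightarrow> nat \<Rightarrow> real" where
  "weight_bound \<kappa> 0 = 2"
| "weight_bound \<kappa> (Suc k) = 2 * real (k + 2) / \<kappa> * weight_bound \<kappa> k"

text \<open>
  Bounds for the total weight of the sets of a statistic of level \<open>k\<close> that contain a given resource.
\<close>

primrec degree_bound :: "real \<Rightarrow> nat \<Rightarrow> real" where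
  "degree_bound \<kappa> 0 = 4"
| "degree_bound \<kappa> (Suc k) = (2 * real (k + 2) + 4) / \<kappa> * degree_bound \<kappa> k"

lemma weight_bound_pos: "\<kappa> > 0 \<Longrightarrow> weight_bound \<kappa> k > 0" by (induction k) auto
lemma degree_bound_pos: "\<kappa> > 0 \<Longrightarrow> degree_bound \<kappa> k > 0" 
  by (induction k) (auto intro!: mult_pos_pos divide_pos_pos)

text \<open>
  Vertices are \<open>0, \<dots>, n - 1\<close>, in the order in which they are labelled. The root is treated as a
  child of a vertex labelled \<open>p0\<close>. Jumps are the vertices whose window is unrelated to that of their
  parent. \<open>P\<close> contains all labels that can be the label of a parent.
\<close>

locale layout =
  fixes n L :: nat and par :: "nat \<Rightarrow> nat" and jump :: "nat \<Rightarrow> bool" and J :: "nat \<Rightarrow> int set"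
    and p0 :: int and P :: "int set"
  assumes par_less: "\<And>t. 0 < t \<Longrightarrow> t < n \<Longrightarrow> par t < t"
    and jump_0: "jump 0" and L_pos: "L > 0" and finite_P: "finite P" and p0_P: "p0 \<in> P"
    and J_sub: "\<And>t. t < n \<Longrightarrow> J t \<subseteq> P" and card_J: "\<And>t. t < n \<Longrightarrow> card (J t) = L"
begin

lemma finite_J: "t < n \<Longrightarrow> finite (J t)" using J_sub finite_P finite_subset by blast

definition \<Omega> :: "resource set" where "\<Omega> = (\<Union>p\<in>P. \<Union>y\<in>P. move p y)"

lemma finite_\<Omega>: "finite \<Omega>" unfolding \<Omega>_def using finite_P by auto

lemma move_sub_\<Omega>: "p \<in> P \<Longrightarrow> y \<in> P \<Longrightarrow> move p y \<subseteq> \<Omega>" unfolding \<Omega>_def by blast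

definition hits :: "int \<Rightarrow> nat \<Rightarrow> resource \<Rightarrow> real" where
  "hits z c \<omega> = real (card {y \<in> J c. \<omega> \<in> move z y})"

text \<open>
  The probability that step \<open>c\<close> uses \<open>\<omega>\<close> if the parent's label \<open>z\<close> is uniform in its window and the
  choice is uniform in \<open>J c\<close>. Jumps are left out of the plan and are treated as errors.
\<close>

definition planned :: "nat \<Rightarrow> resource \<Rightarrow> real" where
  "planned c \<omega> = (if jump c then 0 else (\<Sum>z\<in>J (par c). hits z c \<omega>) / real L ^ 2)"

text \<open>
  The planned fraction of unused resources near \<open>\<omega>\<close>, before step \<open>t\<close>.
\<close>

definition \<alpha> :: "nat \<Rightarrow> resource \<Rightarrow> real" where
  "\<alpha> t \<omega> = 1 - (\<Sum>s<t. planned s \<omega>)"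

lemma hits_bounds: "0 \<le> hits z c \<omega>" "hits z c \<omega> \<le> 2"
  unfolding hits_def using card_moves_through[of "J c" \<omega> z] by auto

lemma nonjump_pos: "\<not> jump c \<Longrightarrow> 0 < c" using jump_0 by (cases c) auto

lemma planned_bounds: assumes "c < n" shows "0 \<le> planned c \<omega>" "planned c \<omega> \<le> 2 / L"
proof -
  show "0 \<le> planned c \<omega>" unfolding planned_def by (auto intro!: divide_nonneg_nonneg sum_nonneg hits_bounds)
  show "planned c \<omega> \<le> 2 / L"
  proof (cases "jump c")
    case False
    then have "par c < n" using par_less[of c] nonjump_pos assms by fastforce
    then have "(\<Sum>z\<in>J (par c). hits z c \<omega>) \<le> real L * 2"
      using sum_bounded_above[of "J (par c)" "\<lambda>z. hits z c \<omega>" 2] hits_bounds card_J by simp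
    then have "(\<Sum>z\<in>J (par c). hits z c \<omega>) / real L ^ 2 \<le> real L * 2 / real L ^ 2"
      by (rule divide_right_mono) auto
    also have "\<dots> = 2 / L" by (simp add: power2_eq_square)
    finally show ?thesis using False by (simp add: planned_def)
  qed (simp add: planned_def)
qed

definition base :: "int \<Rightarrow> nat \<Rightarrow> (int \<Rightarrow> real) \<Rightarrow> functional" where
  "base p a wt h = (\<Sum>z\<in>J a. wt z * h (move p z))"

text \<open>
  All ways of joining a move of step \<open>s\<close> with parent label \<open>p\<close> to a set \<open>f\<close> of \<open>F\<close> that meets it in a
  single resource. The flag tells whether the move is added to the set or only counted; both
  versions have the same total weight. Division by \<open>\<alpha>\<close> reflects that an available resource is used
  with planned probability proportional to \<open>1 / \<alpha>\<close>.
\<close>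

definition ext :: "bool \<Rightarrow> nat \<Rightarrow> int \<Rightarrow> functional \<Rightarrow> functional" where
  "ext b s p F h = F (\<lambda>f. \<Sum>y | y \<in> J s \<and> card (f \<inter> move p y) = 1.
      h (if b then f \<union> move p y else f) / \<alpha> s (the_elem (f \<inter> move p y)))"

text \<open>
  At level 0 the weights \<open>1\<close> give the total availability of a window, on which the process
  depends, and the weights \<open>hits z c \<omega>\<close> compare the actual law of a parent's label with the uniform
  law, as seen by a resource of its child.
\<close>

primrec Stats :: "nat \<Rightarrow> functional set" where
  "Stats 0 = (\<lambda>(p, a). base p a (\<lambda>_. 1)) ` (P \<times> {..<n}) \<union>
           (\<lambda>(p, a, c, \<omega>). base p a (\<lambda>z. hits z c \<omega>)) ` (P \<times> {..<n} \<times> {..<n} \<times> \<Omega>)"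
| "Stats (Suc k) = (\<lambda>(b, s, p, F). ext b s p F) ` (UNIV \<times> {..<n} \<times> P \<times> Stats k)"

lemma finite_Stats: "finite (Stats k)" by (induction k) (auto simp: finite_P finite_\<Omega>)

text \<open>
  The time \<open>s\<close> and the parent label \<open>p\<close> are parameters of the statistics, so that no step depends on
  a statistic that was not controlled from the beginning. This costs only a polynomial factor per
  level.
\<close>

lemma card_Stats:
  assumes "real n \<le> Q" "real (card P) \<le> Q" "1 \<le> Q"
  shows "real (card (Stats k)) \<le> 4 * (2 * Q ^ 2) ^ (k + 3)"
proof (induction k)
  case 0
  have "card \<Omega> \<le> (\<Sum>p\<in>P. \<Sum>y\<in>P. 2)"
    unfolding \<Omega>_def
    by (intro order.trans[OF card_UN_le[OF finite_P]] sum_mono order.trans[OF card_UN_le[OF finite_P]]) auto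
  then have "real (card \<Omega>) \<le> 2 * (real (card P) * real (card P))" by (simp flip: of_nat_mult)
  also have "\<dots> \<le> 2 * (Q * Q)" using assms by (intro mult_left_mono mult_mono) auto
  finally have O: "real (card \<Omega>) \<le> 2 * Q ^ 2" by (simp add: power2_eq_square)
  have "card (Stats 0) \<le> card (P \<times> {..<n}) + card (P \<times> {..<n} \<times> {..<n} \<times> \<Omega>)"
    unfolding Stats.simps by (intro order.trans[OF card_Un_le] add_mono card_image_le) (auto simp: finite_P finite_\<Omega>)
  then have "real (card (Stats 0)) \<le> real (card P) * real n + real (card P) * (real n * (real n * real (card \<Omega>)))"
    by (simp add: card_cartesian_product flip: of_nat_mult of_nat_add)
  also have "\<dots> \<le> Q * Q + Q * (Q * (Q * (2 * Q ^ 2)))"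
    using assms O by (intro add_mono mult_mono mult_nonneg_nonneg) auto
  also have "\<dots> = Q ^ 2 + 2 * Q ^ 5" by (simp add: eval_nat_numeral)
  also have "\<dots> \<le> Q ^ 6 + 2 * Q ^ 6"
    using assms(3) by (intro add_mono mult_left_mono power_increasing) auto
  also have "\<dots> \<le> 4 * (2 * Q ^ 2) ^ (0 + 3)" using assms by (simp add: power_mult_distrib flip: power_mult)
  finally show ?case .
next
  case (Suc k)
  have "card (Stats (Suc k)) \<le> card ((UNIV :: bool set) \<times> {..<n} \<times> P \<times> Stats k)"
    unfolding Stats.simps by (rule card_image_le) (auto simp: finite_P finite_Stats)
  then have "real (card (Stats (Suc k))) \<le> 2 * (real n * (real (card P) * real (card (Stats k))))"
    by (simp add: card_cartesian_product flip: of_nat_mult)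
  also have "\<dots> \<le> 2 * (Q * (Q * (4 * (2 * Q ^ 2) ^ (k + 3))))"
    using assms Suc by (intro mult_mono mult_nonneg_nonneg) auto
  also have "\<dots> = 4 * ((2 * Q ^ 2) * (2 * Q ^ 2) ^ (k + 3))" by (simp only: power2_eq_square mult_ac)
  also have "\<dots> = 4 * (2 * Q ^ 2) ^ (Suc k + 3)" by (simp only: add_Suc power_Suc)
  finally show ?case .
qed

lemma base_positive:
  assumes "p \<in> P" "a < n" "\<And>z. 0 \<le> wt z"
  shows "positive_on \<Omega> 2 (base p a wt)"
  unfolding positive_on_def base_def
proof (intro conjI allI impI)
  fix g h :: "resource set \<Rightarrow> real"
  assume "\<forall>f. finite f \<and> card f \<le> 2 \<and> f \<subseteq> \<Omega> \<longrightarrow> g f \<le> h f"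
  then show "(\<Sum>z\<in>J a. wt z * g (move p z)) \<le> (\<Sum>z\<in>J a. wt z * h (move p z))"
    using assms move_sub_\<Omega> J_sub[OF assms(2)] by (intro sum_mono mult_left_mono) auto
qed (simp_all add: sum.distrib sum_distrib_left algebra_simps)

end

text \<open>
  At no time is any resource planned to be used up to more than the fraction \<open>1 - \<kappa>\<close>.
\<close>

locale greedy = layout +
  fixes \<kappa> :: real
  assumes \<kappa>_pos: "\<kappa> > 0" and \<kappa>_le_1: "\<kappa> \<le> 1" and load: "\<And>t \<omega>. t \<le> n \<Longrightarrow> \<kappa> \<le> \<alpha> t \<omega>"
begin

lemma \<alpha>_pos: "t \<le> n \<Longrightarrow> \<alpha> t \<omega> > 0" using load \<kappa>_pos by (meson less_le_trans)

lemma inv_\<alpha>: "t \<le> n \<Longrightarrow> 1 / \<alpha> t \<omega> \<le> 1 / \<kappa>"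
  using load[of t \<omega>] \<kappa>_pos by (intro divide_left_mono mult_pos_pos) (auto intro: less_le_trans)

lemma ext_positive:
  assumes "positive_on \<Omega> N F" "s < n" "p \<in> P"
  shows "positive_on \<Omega> (Suc N) (ext b s p F)"
  unfolding positive_on_def ext_def
proof (intro conjI allI impI)
  note F = assms(1)
  fix g h :: "resource set \<Rightarrow> real" and c :: real
  show "F (\<lambda>f. \<Sum>y | y \<in> J s \<and> card (f \<inter> move p y) = 1. (g (if b then f \<union> move p y else f) + h (if b then f \<union> move p y else f)) / \<alpha> s (the_elem (f \<inter> move p y)))
    = F (\<lambda>f. \<Sum>y | y \<in> J s \<and> card (f \<inter> move p y) = 1. g (if b then f \<union> move p y else f) / \<alpha> s (the_elem (f \<inter> move p y)))
    + F (\<lambda>f. \<Sum>y | y \<in> J s \<and> card (f \<inter> move p y) = 1. h (if b then f \<union> move p y else f) / \<alpha> s (the_elem (f \<inter> move p y)))"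
    unfolding positive_on_add[OF F, symmetric] by (simp add: sum.distrib add_divide_distrib)
  show "F (\<lambda>f. \<Sum>y | y \<in> J s \<and> card (f \<inter> move p y) = 1. c * h (if b then f \<union> move p y else f) / \<alpha> s (the_elem (f \<inter> move p y)))
    = c * F (\<lambda>f. \<Sum>y | y \<in> J s \<and> card (f \<inter> move p y) = 1. h (if b then f \<union> move p y else f) / \<alpha> s (the_elem (f \<inter> move p y)))"
    unfolding positive_on_scale[OF F, symmetric] by (simp add: sum_distrib_left)
  assume le: "\<forall>f. finite f \<and> card f \<le> Suc N \<and> f \<subseteq> \<Omega> \<longrightarrow> g f \<le> h f"
  show "F (\<lambda>f. \<Sum>y | y \<in> J s \<and> card (f \<inter> move p y) = 1. g (if b then f \<union> move p y else f) / \<alpha> s (the_elem (f \<inter> move p y)))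
    \<le> F (\<lambda>f. \<Sum>y | y \<in> J s \<and> card (f \<inter> move p y) = 1. h (if b then f \<union> move p y else f) / \<alpha> s (the_elem (f \<inter> move p y)))"
  proof (intro positive_on_mono[OF F] sum_mono divide_right_mono)
    fix f y assume f: "finite f" "card f \<le> N" "f \<subseteq> \<Omega>" and y: "y \<in> {y. y \<in> J s \<and> card (f \<inter> move p y) = 1}"
    have "card (f \<union> move p y) + card (f \<inter> move p y) = card f + card (move p y)"
      using card_Un_Int[OF f(1) finite_move] by simp
    then have "card (f \<union> move p y) \<le> Suc N" using y f by simp
    moreover have "f \<union> move p y \<subseteq> \<Omega>" using f y J_sub[OF assms(2)] move_sub_\<Omega> assms(3) by blast
    ultimately show "g (if b then f \<union> move p y else f) \<le> h (if b then f \<union> move p y else f)"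
      using le f by auto
    show "0 \<le> \<alpha> s (the_elem (f \<inter> move p y))" using \<alpha>_pos[of s] assms(2) by (simp add: less_imp_le)
  qed
qed

lemma card_hitting_moves:
  assumes "finite f" "finite A"
  shows "real (card {y \<in> A. f \<inter> move p y \<noteq> {}}) \<le> 2 * card f"
proof -
  have "{y \<in> A. f \<inter> move p y \<noteq> {}} \<subseteq> (\<Union>\<omega>\<in>f. {y \<in> A. \<omega> \<in> move p y})" by auto
  then have "card {y \<in> A. f \<inter> move p y \<noteq> {}} \<le> card (\<Union>\<omega>\<in>f. {y \<in> A. \<omega> \<in> move p y})"
    using assms by (intro card_mono) auto
  also have "\<dots> \<le> (\<Sum>\<omega>\<in>f. card {y \<in> A. \<omega> \<in> move p y})" by (rule card_UN_le[OF assms(1)])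
  also have "\<dots> \<le> (\<Sum>\<omega>\<in>f. 2)" by (intro sum_mono card_moves_through)
  finally show ?thesis by (simp add: mult.commute flip: of_nat_mult)
qed

text \<open>
  Each resource lies in at most two moves with a given parent label, so a set with \<open>k + 2\<close> resources
  is met by at most \<open>2 (k + 2)\<close> moves.
\<close>

lemma Stats_regular:
  "F \<in> Stats k \<Longrightarrow> positive_on \<Omega> (k + 2) F \<and> F (\<lambda>_. 1) \<le> weight_bound \<kappa> k * L \<and>
     (\<forall>\<omega>. F (\<lambda>f. of_bool (\<omega> \<in> f)) \<le> degree_bound \<kappa> k)"
proof (induction k arbitrary: F)
  case 0
  have *: "positive_on \<Omega> 2 (base p a wt) \<and> base p a wt (\<lambda>_. 1) \<le> 2 * L \<and> (\<forall>\<omega>. base p a wt (\<lambda>f. of_bool (\<omega> \<in> f)) \<le> 4)"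
    if "p \<in> P" "a < n" and wt: "\<And>z. 0 \<le> wt z" "\<And>z. wt z \<le> 2" for p a wt
  proof (intro conjI allI base_positive that)
    show "base p a wt (\<lambda>_. 1) \<le> 2 * L"
      unfolding base_def using sum_bounded_above[of "J a" wt 2] wt card_J[OF that(2)] by simp
    fix \<omega>
    have "base p a wt (\<lambda>f. of_bool (\<omega> \<in> f)) \<le> (\<Sum>z\<in>J a. 2 * of_bool (\<omega> \<in> move p z))"
      unfolding base_def using wt by (intro sum_mono mult_right_mono) auto
    also have "\<dots> = 2 * real (card {z \<in> J a. \<omega> \<in> move p z})"
      using finite_J[OF that(2)] by (simp flip: sum_distrib_left add: Int_def)
    also have "\<dots> \<le> 4" using card_moves_through[of "J a" \<omega> p] by simp
    finally show "base p a wt (\<lambda>f. of_bool (\<omega> \<in> f)) \<le> 4" .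
  qed
  obtain p a wt where "F = base p a wt" "p \<in> P" "a < n" "\<And>z. 0 \<le> wt z" "\<And>z. wt z \<le> 2"
  proof -
    from 0 consider p a where "F = base p a (\<lambda>_. 1)" "p \<in> P" "a < n"
      | p a c \<omega> where "F = base p a (\<lambda>z. hits z c \<omega>)" "p \<in> P" "a < n" by auto
    then show thesis
    proof cases
      case (1 p a) then show thesis by (intro that[of p a "\<lambda>_. 1"]) auto
    next
      case (2 p a c \<omega>) then show thesis using hits_bounds by (intro that[of p a "\<lambda>z. hits z c \<omega>"]) auto
    qed
  qed
  then show ?case using *[of p a wt] by (simp only: add_0 weight_bound.simps(1) degree_bound.simps(1)) simp
next
  case (Suc k)
  then obtain b s p F0 where F: "F = ext b s p F0" "s < n" "p \<in> P" "F0 \<in> Stats k" by auto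
  have F0: "positive_on \<Omega> (k + 2) F0" "F0 (\<lambda>_. 1) \<le> weight_bound \<kappa> k * L" "\<And>\<omega>. F0 (\<lambda>f. of_bool (\<omega> \<in> f)) \<le> degree_bound \<kappa> k"
    using Suc.IH[OF F(4)] by auto
  note finJ = finite_J[OF F(2)]
  let ?Y = "\<lambda>f. {y. y \<in> J s \<and> card (f \<inter> move p y) = 1}"
  have cardY: "real (card (?Y f)) \<le> 2 * real (k + 2)" if "finite f" "card f \<le> k + 2" for f
  proof -
    have "card (?Y f) \<le> card {y \<in> J s. f \<inter> move p y \<noteq> {}}" using finJ by (intro card_mono) auto
    then have "real (card (?Y f)) \<le> real (card {y \<in> J s. f \<inter> move p y \<noteq> {}})" by simp
    also have "\<dots> \<le> 2 * card f" by (rule card_hitting_moves[OF that(1) finJ])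
    also have "\<dots> \<le> 2 * real (k + 2)" using that by simp
    finally show ?thesis .
  qed
  have "F (\<lambda>_. 1) \<le> F0 (\<lambda>f. 2 * real (k + 2) / \<kappa> * 1)"
    unfolding F(1) ext_def
  proof (rule positive_on_mono[OF F0(1)])
    fix f :: "resource set" assume f: "finite f" "card f \<le> k + 2"
    have "(\<Sum>y\<in>?Y f. 1 / \<alpha> s (the_elem (f \<inter> move p y))) \<le> real (card (?Y f)) * (1 / \<kappa>)"
      by (rule sum_bounded_above) (use inv_\<alpha> F(2) in auto)
    also have "\<dots> \<le> 2 * real (k + 2) * (1 / \<kappa>)" using cardY[OF f] \<kappa>_pos by (intro mult_right_mono) auto
    finally show "(\<Sum>y\<in>?Y f. 1 / \<alpha> s (the_elem (f \<inter> move p y))) \<le> 2 * real (k + 2) / \<kappa> * 1" by simp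
  qed
  also have "\<dots> = 2 * real (k + 2) / \<kappa> * F0 (\<lambda>_. 1)" by (rule positive_on_scale[OF F0(1)])
  also have "\<dots> \<le> 2 * real (k + 2) / \<kappa> * (weight_bound \<kappa> k * L)" using F0(2) \<kappa>_pos by (intro mult_left_mono) auto
  finally have W: "F (\<lambda>_. 1) \<le> weight_bound \<kappa> (Suc k) * L" by simp
  have D: "F (\<lambda>f. of_bool (\<omega> \<in> f)) \<le> degree_bound \<kappa> (Suc k)" for \<omega>
  proof -
    let ?m = "{y \<in> J s. \<omega> \<in> move p y}"
    have "F (\<lambda>f. of_bool (\<omega> \<in> f)) \<le> F0 (\<lambda>f. 1 / \<kappa> * (2 * real (k + 2) * of_bool (\<omega> \<in> f) + (\<Sum>y\<in>?m. \<Sum>\<omega>'\<in>move p y. of_bool (\<omega>' \<in> f))))"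
      unfolding F(1) ext_def
    proof (rule positive_on_mono[OF F0(1)])
      fix f :: "resource set" assume f: "finite f" "card f \<le> k + 2"
      have "(\<Sum>y\<in>?Y f. of_bool (\<omega> \<in> (if b then f \<union> move p y else f)) / \<alpha> s (the_elem (f \<inter> move p y)))
        \<le> (\<Sum>y\<in>?Y f. (of_bool (\<omega> \<in> f) + of_bool (\<omega> \<in> move p y)) * (1 / \<kappa>))"
      proof (rule sum_mono)
        fix y
        have "of_bool (\<omega> \<in> (if b then f \<union> move p y else f)) / \<alpha> s (the_elem (f \<inter> move p y))
          = of_bool (\<omega> \<in> (if b then f \<union> move p y else f)) * (1 / \<alpha> s (the_elem (f \<inter> move p y)))" by simp
        also have "\<dots> \<le> (of_bool (\<omega> \<in> f) + of_bool (\<omega> \<in> move p y)) * (1 / \<kappa>)"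
          using inv_\<alpha>[of s] \<alpha>_pos[of s] F(2) by (intro mult_mono) (auto simp: less_imp_le)
        finally show "of_bool (\<omega> \<in> (if b then f \<union> move p y else f)) / \<alpha> s (the_elem (f \<inter> move p y))
          \<le> (of_bool (\<omega> \<in> f) + of_bool (\<omega> \<in> move p y)) * (1 / \<kappa>)" .
      qed
      also have "\<dots> = 1 / \<kappa> * (real (card (?Y f)) * of_bool (\<omega> \<in> f) + (\<Sum>y\<in>?Y f. of_bool (\<omega> \<in> move p y)))"
        by (simp add: sum.distrib flip: sum_divide_distrib)
      also have "\<dots> \<le> 1 / \<kappa> * (2 * real (k + 2) * of_bool (\<omega> \<in> f) + (\<Sum>y\<in>?m. \<Sum>\<omega>'\<in>move p y. of_bool (\<omega>' \<in> f)))"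
      proof (intro mult_left_mono add_mono mult_right_mono cardY f)
        have "(\<Sum>y\<in>?Y f. of_bool (\<omega> \<in> move p y)) = (\<Sum>y\<in>?Y f \<inter> ?m. (1::real))"
          using finJ by (simp add: Int_def of_bool_def sum.If_cases) (rule arg_cong[where f=card], auto)
        also have "\<dots> \<le> (\<Sum>y\<in>?Y f \<inter> ?m. \<Sum>\<omega>'\<in>move p y. of_bool (\<omega>' \<in> f))"
        proof (rule sum_mono)
          fix y assume "y \<in> ?Y f \<inter> ?m"
          then have "card (f \<inter> move p y) = 1" by auto
          then show "(1::real) \<le> (\<Sum>\<omega>'\<in>move p y. of_bool (\<omega>' \<in> f))" by (simp add: Int_def conj_commute)
        qed
        also have "\<dots> \<le> (\<Sum>y\<in>?m. \<Sum>\<omega>'\<in>move p y. of_bool (\<omega>' \<in> f))"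
          using finJ by (intro sum_mono2) (auto intro: sum_nonneg)
        finally show "(\<Sum>y\<in>?Y f. of_bool (\<omega> \<in> move p y)) \<le> (\<Sum>y\<in>?m. \<Sum>\<omega>'\<in>move p y. (of_bool (\<omega>' \<in> f) :: real))" .
      qed (use \<kappa>_pos in auto)
      finally show "(\<Sum>y\<in>?Y f. of_bool (\<omega> \<in> (if b then f \<union> move p y else f)) / \<alpha> s (the_elem (f \<inter> move p y)))
        \<le> 1 / \<kappa> * (2 * real (k + 2) * of_bool (\<omega> \<in> f) + (\<Sum>y\<in>?m. \<Sum>\<omega>'\<in>move p y. of_bool (\<omega>' \<in> f)))" .
    qed
    also have "\<dots> = 1 / \<kappa> * (2 * real (k + 2) * F0 (\<lambda>f. of_bool (\<omega> \<in> f)) + (\<Sum>y\<in>?m. \<Sum>\<omega>'\<in>move p y. F0 (\<lambda>f. of_bool (\<omega>' \<in> f))))"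
      by (simp only: positive_on_scale[OF F0(1)] positive_on_add[OF F0(1)] positive_on_sum[OF F0(1)])
    also have "\<dots> \<le> 1 / \<kappa> * (2 * real (k + 2) * degree_bound \<kappa> k + (\<Sum>y\<in>?m. \<Sum>\<omega>'\<in>move p y. degree_bound \<kappa> k))"
      using F0(3) \<kappa>_pos by (intro mult_left_mono add_mono sum_mono) auto
    also have "\<dots> \<le> 1 / \<kappa> * (2 * real (k + 2) * degree_bound \<kappa> k + 2 * (2 * degree_bound \<kappa> k))"
    proof (intro mult_left_mono add_left_mono)
      have "(\<Sum>y\<in>?m. \<Sum>\<omega>'\<in>move p y. degree_bound \<kappa> k) = real (card ?m) * (2 * degree_bound \<kappa> k)" by simp
      also have "\<dots> \<le> 2 * (2 * degree_bound \<kappa> k)"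
        using card_moves_through[of "J s" \<omega> p] degree_bound_pos[OF \<kappa>_pos, of k] by (intro mult_right_mono) auto
      finally show "(\<Sum>y\<in>?m. \<Sum>\<omega>'\<in>move p y. degree_bound \<kappa> k) \<le> 2 * (2 * degree_bound \<kappa> k)" .
    qed (use \<kappa>_pos in auto)
    also have "\<dots> = degree_bound \<kappa> (Suc k)" by (simp add: algebra_simps add_divide_distrib)
    finally show ?thesis .
  qed
  have "positive_on \<Omega> (Suc k + 2) F" using ext_positive[OF F0(1) F(2,3)] F(1) by simp
  then show ?case using W D by blast
qed

end

section \<open>One step of the greedy process\<close>

lemma prod_one_plus_bounds:
  fixes w :: "'a \<Rightarrow> real"
  assumes "finite f" "\<And>a. a \<in> f \<Longrightarrow> 0 \<le> w a" "sum w f \<le> 1"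
  shows "1 + sum w f \<le> (\<Prod>a\<in>f. 1 + w a)" "(\<Prod>a\<in>f. 1 + w a) \<le> 1 + sum w f + (sum w f)\<^sup>2"
proof -
  show "1 + sum w f \<le> (\<Prod>a\<in>f. 1 + w a)"
    using assms(1,2)
  proof (induction f rule: finite_induct)
    case (insert a f)
    then have "0 \<le> w a" "0 \<le> sum w f" by (auto intro: sum_nonneg)
    then have "1 + w a + sum w f \<le> (1 + w a) * (1 + sum w f)" by (simp add: algebra_simps)
    also have "\<dots> \<le> (1 + w a) * (\<Prod>a\<in>f. 1 + w a)" using insert by (intro mult_left_mono) auto
    finally show ?case using insert by simp
  qed simp
  have "(\<Prod>a\<in>f. 1 + w a) \<le> (\<Prod>a\<in>f. exp (w a))"
    using assms(2) by (intro prod_mono) (auto simp: exp_ge_add_one_self intro: add_nonneg_nonneg)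
  also have "\<dots> = exp (sum w f)" using assms(1) by (simp add: exp_sum)
  also have "\<dots> \<le> 1 + sum w f + (sum w f)\<^sup>2"
    using assms by (intro exp_bound sum_nonneg) auto
  finally show "(\<Prod>a\<in>f. 1 + w a) \<le> 1 + sum w f + (sum w f)\<^sup>2" .
qed

context greedy begin

definition parent_label :: "(nat \<Rightarrow> int) \<Rightarrow> nat \<Rightarrow> int" where
  "parent_label \<psi> t = (if t = 0 then p0 else \<psi> (par t))"

definition used :: "(nat \<Rightarrow> int) \<Rightarrow> nat \<Rightarrow> resource set" where
  "used \<psi> t = (\<Union>s<t. move (parent_label \<psi> s) (\<psi> s))"

text \<open>
  The normalised availability of \<open>f\<close> before step \<open>t\<close>, which has value 1 initially and would stay near 1
  on average if the resources were used independently and according to plan.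
\<close>

definition avail :: "(nat \<Rightarrow> int) \<Rightarrow> nat \<Rightarrow> resource set \<Rightarrow> real" where
  "avail \<psi> t f = (if f \<inter> used \<psi> t = {} then \<Prod>\<omega>\<in>f. 1 / \<alpha> t \<omega> else 0)"

text \<open>
  The normalising factor of the choice probabilities; the process can continue as long as it is positive,
  and it is kept near \<open>L\<close>.
\<close>

definition total :: "(nat \<Rightarrow> int) \<Rightarrow> nat \<Rightarrow> real" where
  "total \<psi> t = (\<Sum>y\<in>J t. avail \<psi> t (move (parent_label \<psi> t) y))"

definition prob :: "(nat \<Rightarrow> int) \<Rightarrow> nat \<Rightarrow> int \<Rightarrow> real" where
  "prob \<psi> t y = avail \<psi> t (move (parent_label \<psi> t) y) / total \<psi> t"

definition mean :: "(nat \<Rightarrow> int) \<Rightarrow> nat \<Rightarrow> (int \<Rightarrow> real) \<Rightarrow> real" where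
  "mean \<psi> t h = (\<Sum>y\<in>J t. prob \<psi> t y * h y)"

lemma parent_label_cong: "t < n \<Longrightarrow> (\<And>s. s < t \<Longrightarrow> \<psi> s = \<psi>' s) \<Longrightarrow> parent_label \<psi> t = parent_label \<psi>' t"
  using par_less[of t] by (auto simp: parent_label_def)

lemma used_cong: "t \<le> n \<Longrightarrow> (\<And>s. s < t \<Longrightarrow> \<psi> s = \<psi>' s) \<Longrightarrow> used \<psi> t = used \<psi>' t"
  unfolding used_def by (intro SUP_cong refl arg_cong2[where f=move] parent_label_cong) auto

lemma avail_cong: "t \<le> n \<Longrightarrow> (\<And>s. s < t \<Longrightarrow> \<psi> s = \<psi>' s) \<Longrightarrow> avail \<psi> t = avail \<psi>' t"
  unfolding avail_def using used_cong[of t \<psi> \<psi>'] by (intro ext) simp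

lemma total_cong: "t < n \<Longrightarrow> (\<And>s. s < t \<Longrightarrow> \<psi> s = \<psi>' s) \<Longrightarrow> total \<psi> t = total \<psi>' t"
  unfolding total_def using avail_cong[of t \<psi> \<psi>'] parent_label_cong[of t \<psi> \<psi>'] by simp

lemma mean_cong: "t < n \<Longrightarrow> (\<And>s. s < t \<Longrightarrow> \<psi> s = \<psi>' s) \<Longrightarrow> mean \<psi> t = mean \<psi>' t"
  unfolding mean_def prob_def using avail_cong[of t \<psi> \<psi>'] parent_label_cong[of t \<psi> \<psi>'] total_cong[of t \<psi> \<psi>'] by (intro ext) simp

lemma avail_nonneg: "t \<le> n \<Longrightarrow> 0 \<le> avail \<psi> t f"
  unfolding avail_def using \<alpha>_pos[of t] by (auto intro!: prod_nonneg simp: less_imp_le)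

lemma one_le_inv_\<kappa>: "1 \<le> 1 / \<kappa>" using \<kappa>_pos \<kappa>_le_1 by simp

lemma avail_le:
  assumes "t \<le> n" "finite f" "card f \<le> N"
  shows "avail \<psi> t f \<le> (1 / \<kappa>) ^ N"
proof -
  have "(\<Prod>\<omega>\<in>f. 1 / \<alpha> t \<omega>) \<le> (\<Prod>\<omega>\<in>f. 1 / \<kappa>)"
    using inv_\<alpha>[OF assms(1)] \<alpha>_pos[OF assms(1)] by (intro prod_mono) (auto simp: less_imp_le)
  also have "\<dots> = (1 / \<kappa>) ^ card f" by simp
  also have "\<dots> \<le> (1 / \<kappa>) ^ N" using assms(3) one_le_inv_\<kappa> by (rule power_increasing)
  finally show ?thesis unfolding avail_def using \<kappa>_pos by auto
qed

text \<open>
  The shared resource is counted twice on the left-hand side.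
\<close>

lemma avail_union:
  assumes "t \<le> n" "finite f" "finite e" "card (f \<inter> e) = 1"
  shows "avail \<psi> t f * avail \<psi> t e = avail \<psi> t (f \<union> e) / \<alpha> t (the_elem (f \<inter> e))"
proof -
  obtain \<omega> where \<omega>: "f \<inter> e = {\<omega>}" using assms(4) card_1_singletonE by blast
  have "(\<Prod>\<omega>\<in>f. 1 / \<alpha> t \<omega>) * (\<Prod>\<omega>\<in>e. 1 / \<alpha> t \<omega>) = (\<Prod>\<omega>\<in>f \<union> e. 1 / \<alpha> t \<omega>) * (\<Prod>\<omega>\<in>f \<inter> e. 1 / \<alpha> t \<omega>)"
    by (rule prod.union_inter[OF assms(2,3), symmetric])
  then show ?thesis unfolding avail_def \<omega> by (auto simp: Int_Un_distrib2)
qed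

lemma \<alpha>_Suc: "\<alpha> t \<omega> = \<alpha> (Suc t) \<omega> + planned t \<omega>" by (simp add: \<alpha>_def)

lemma used_upd: "t < n \<Longrightarrow> used (\<psi>(t := y)) (Suc t) = used \<psi> t \<union> move (parent_label \<psi> t) y"
proof -
  assume t: "t < n"
  have "used (\<psi>(t := y)) t = used \<psi> t" using t by (intro used_cong) auto
  moreover have "parent_label (\<psi>(t := y)) t = parent_label \<psi> t" using t by (intro parent_label_cong) auto
  ultimately show ?thesis unfolding used_def by (simp add: lessThan_Suc Un_commute)
qed

lemma avail_step:
  assumes "t < n"
  shows "avail (\<psi>(t := y)) (Suc t) f = (if f \<inter> move (parent_label \<psi> t) y = {} then avail \<psi> t f * (\<Prod>\<omega>\<in>f. \<alpha> t \<omega> / \<alpha> (Suc t) \<omega>) else 0)"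
proof -
  have "(\<Prod>\<omega>\<in>f. 1 / \<alpha> (Suc t) \<omega>) = (\<Prod>\<omega>\<in>f. 1 / \<alpha> t \<omega>) * (\<Prod>\<omega>\<in>f. \<alpha> t \<omega> / \<alpha> (Suc t) \<omega>)"
    unfolding prod.distrib[symmetric] using \<alpha>_pos[of t] assms by (intro prod.cong) (auto simp: less_imp_neq[THEN not_sym])
  then show ?thesis unfolding avail_def used_upd[OF assms] by (auto simp: Int_Un_distrib)
qed

text \<open>
  The renormalisation from time \<open>t\<close> to \<open>t + 1\<close> agrees with its first-order term up to
  \<open>O(1 / L\<^sup>2)\<close>, because one step plans to use each resource with probability \<open>O(1 / L)\<close>.
\<close>

lemma ratio_bounds:
  assumes "t < n" "finite f" "card f \<le> N" "4 * real N \<le> \<kappa> * L"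
  defines "r \<equiv> (\<Prod>\<omega>\<in>f. \<alpha> t \<omega> / \<alpha> (Suc t) \<omega>)" and "v \<equiv> (\<Sum>\<omega>\<in>f. planned t \<omega> / \<alpha> t \<omega>)"
  shows "0 \<le> v" "v \<le> r - 1" "r - 1 - v \<le> 8 * real N ^ 2 / (\<kappa> * L)\<^sup>2" "r - 1 \<le> 4 * real N / (\<kappa> * L)"
proof -
  define w where "w = (\<lambda>\<omega>. planned t \<omega> / \<alpha> (Suc t) \<omega>)"
  have pos: "\<alpha> t \<omega> > 0" "\<alpha> (Suc t) \<omega> > 0" for \<omega> using \<alpha>_pos assms(1) by auto
  have kL: "\<kappa> * L > 0" using \<kappa>_pos L_pos by simp
  have w0: "0 \<le> w \<omega>" for \<omega> unfolding w_def using planned_bounds[OF assms(1)] pos by (simp add: less_imp_le)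
  have uw: "planned t \<omega> / \<alpha> t \<omega> \<le> w \<omega>" for \<omega>
    unfolding w_def using planned_bounds[OF assms(1), of \<omega>] pos[of \<omega>] \<alpha>_Suc[of t \<omega>] by (intro divide_left_mono) auto
  have ule: "planned t \<omega> / \<alpha> s \<omega> \<le> 2 / (\<kappa> * L)" if "s \<le> n" for \<omega> s
  proof -
    have "planned t \<omega> * (1 / \<alpha> s \<omega>) \<le> 2 / L * (1 / \<kappa>)"
      using planned_bounds[OF assms(1)] inv_\<alpha>[OF that] \<alpha>_pos[OF that] by (intro mult_mono) (auto simp: less_imp_le)
    then show ?thesis by (simp add: field_simps)
  qed
  have wle: "w \<omega> \<le> 2 / (\<kappa> * L)" for \<omega> unfolding w_def using ule[of "Suc t"] assms(1) by auto
  have sw: "sum w f \<le> 2 * real N / (\<kappa> * L)"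
  proof -
    have "sum w f \<le> real (card f) * (2 / (\<kappa> * L))" by (rule sum_bounded_above) (rule wle)
    also have "\<dots> \<le> real N * (2 / (\<kappa> * L))" using assms(3) kL by (intro mult_right_mono) auto
    finally show ?thesis by (simp add: mult.commute)
  qed
  have half: "2 * real N / (\<kappa> * L) \<le> 1 / 2" using assms(4) kL by (simp add: field_simps)
  have sw0: "0 \<le> sum w f" by (rule sum_nonneg) (rule w0)
  have r: "r = (\<Prod>\<omega>\<in>f. 1 + w \<omega>)" unfolding r_def w_def
    using pos \<alpha>_Suc[of t] by (intro prod.cong refl) (simp add: field_simps less_imp_neq[THEN not_sym])
  have rb: "1 + sum w f \<le> r" "r \<le> 1 + sum w f + (sum w f)\<^sup>2"
    unfolding r using prod_one_plus_bounds[OF assms(2), of w] w0 sw half by auto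
  have v_le: "v \<le> sum w f" unfolding v_def by (rule sum_mono) (rule uw)
  show "0 \<le> v" unfolding v_def using planned_bounds[OF assms(1)] pos by (intro sum_nonneg) (simp add: less_imp_le)
  show "v \<le> r - 1" using v_le rb by linarith
  have sq: "(sum w f)\<^sup>2 \<le> (2 * real N / (\<kappa> * L))\<^sup>2" using sw sw0 by (rule power_mono)
  have "sum w f - v \<le> real N * (2 / (\<kappa> * L))\<^sup>2"
  proof -
    have "w \<omega> - planned t \<omega> / \<alpha> t \<omega> \<le> (2 / (\<kappa> * L))\<^sup>2" for \<omega>
    proof -
      have "w \<omega> - planned t \<omega> / \<alpha> t \<omega> = w \<omega> * (planned t \<omega> / \<alpha> t \<omega>)"
        unfolding w_def using pos[of \<omega>] \<alpha>_Suc[of t \<omega>] by (simp add: field_simps)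
      also have "\<dots> \<le> (2 / (\<kappa> * L)) * (2 / (\<kappa> * L))"
        using wle ule[of t \<omega>] w0 planned_bounds[OF assms(1)] pos kL assms(1) by (intro mult_mono) (auto simp: less_imp_le)
      finally show ?thesis by (simp add: power2_eq_square)
    qed
    then have "(\<Sum>\<omega>\<in>f. w \<omega> - planned t \<omega> / \<alpha> t \<omega>) \<le> real (card f) * (2 / (\<kappa> * L))\<^sup>2" by (intro sum_bounded_above)
    also have "\<dots> \<le> real N * (2 / (\<kappa> * L))\<^sup>2" using assms(3) by (intro mult_right_mono) auto
    finally show ?thesis by (simp add: sum_subtractf v_def)
  qed
  also have "\<dots> \<le> real N ^ 2 * (2 / (\<kappa> * L))\<^sup>2"
    by (intro mult_right_mono) (simp_all add: power2_eq_square flip: of_nat_mult)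
  finally have "r - 1 - v \<le> real N ^ 2 * (2 / (\<kappa> * L))\<^sup>2 + (2 * real N / (\<kappa> * L))\<^sup>2" using rb sq by linarith
  also have "\<dots> = 8 * real N ^ 2 / (\<kappa> * L)\<^sup>2" by (simp add: power_divide power_mult_distrib)
  finally show "r - 1 - v \<le> 8 * real N ^ 2 / (\<kappa> * L)\<^sup>2" .
  have "(sum w f)\<^sup>2 \<le> sum w f" using sw0 sw half by (simp add: power2_eq_square mult_left_le)
  then have "r - 1 \<le> 2 * sum w f" using rb by linarith
  then show "r - 1 \<le> 4 * real N / (\<kappa> * L)" using sw by simp
qed

lemma prob_bounds:
  assumes "t < n" "total \<psi> t \<ge> L / 2"
  shows "0 \<le> prob \<psi> t y" "prob \<psi> t y \<le> 2 / (\<kappa>\<^sup>2 * L)" "(\<Sum>y\<in>J t. prob \<psi> t y) = 1"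
proof -
  have Sp: "total \<psi> t > 0" using assms(2) L_pos by (smt (verit) half_gt_zero of_nat_0_less_iff)
  show "0 \<le> prob \<psi> t y" unfolding prob_def using avail_nonneg assms Sp by (simp add: less_imp_le)
  have "avail \<psi> t (move (parent_label \<psi> t) y) / total \<psi> t \<le> (1 / \<kappa>) ^ 2 / (L / 2)"
    using avail_le[of t "move (parent_label \<psi> t) y" 2] assms L_pos avail_nonneg by (intro frac_le) auto
  also have "\<dots> = 2 / (\<kappa>\<^sup>2 * L)" by (simp add: power_divide)
  finally show "prob \<psi> t y \<le> 2 / (\<kappa>\<^sup>2 * L)" unfolding prob_def .
  show "(\<Sum>y\<in>J t. prob \<psi> t y) = 1" unfolding prob_def sum_divide_distrib[symmetric] total_def[symmetric] using Sp by simp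
qed

text \<open>
  The first-order effect on \<open>f\<close> of the discrepancy between the move of \<open>c\<close>, given that its parent has
  label \<open>z\<close>, and the planned average over \<open>z\<close>. It sums to zero over the window of the parent.
\<close>

definition grad :: "(nat \<Rightarrow> int) \<Rightarrow> nat \<Rightarrow> nat \<Rightarrow> int \<Rightarrow> resource set \<Rightarrow> real" where
  "grad \<psi> s c z f = avail \<psi> s f * (\<Sum>\<omega>\<in>f. (hits z c \<omega> / L - planned c \<omega>) / \<alpha> s \<omega>)"

text \<open>
  To first order, \<open>f\<close> gains the renormalisation \<open>\<Sum> planned / \<alpha>\<close> and loses the probability that the
  chosen move meets \<open>f\<close>. After replacing the planned use by the use under the actual parent label,
  which produces \<open>grad\<close>, both are sums over the moves meeting \<open>f\<close>. The moves that meet \<open>f\<close> in one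
  resource give \<open>A\<close>, and those contained in \<open>f\<close> go into the error.
\<close>

lemma pointwise_drift:
  assumes t: "t < n" and S: "total \<psi> t \<ge> L / 2" and f: "finite f" "card f \<le> N" and NL: "4 * real N \<le> \<kappa> * L"
  defines "m \<equiv> move (parent_label \<psi> t)"
  defines "A \<equiv> \<lambda>h. \<Sum>y | y \<in> J t \<and> card (f \<inter> m y) = 1. h y / \<alpha> t (the_elem (f \<inter> m y))"
  shows "\<bar>mean \<psi> t (\<lambda>y. avail (\<psi>(t := y)) (Suc t) f) - avail \<psi> t f
            - ((1 / L) * (A (\<lambda>_. avail \<psi> t f) - L / total \<psi> t * A (\<lambda>y. avail \<psi> t (f \<union> m y))) - grad \<psi> t t (parent_label \<psi> t) f)\<bar>
       \<le> 24 * real N ^ 2 * (1 / \<kappa>) ^ (N + 3) / (real L)\<^sup>2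
         + 4 * (1 / \<kappa>) ^ (N + 2) / L * real (card {y \<in> J t. m y \<subseteq> f})"
proof -
  define X where "X = avail \<psi> t f"
  define r where "r = (\<Prod>\<omega>\<in>f. \<alpha> t \<omega> / \<alpha> (Suc t) \<omega>)"
  define v where "v = (\<Sum>\<omega>\<in>f. planned t \<omega> / \<alpha> t \<omega>)"
  define Q where "Q = prob \<psi> t"
  define D where "D = {y. y \<in> J t \<and> card (f \<inter> m y) = 1}"
  define B where "B = {y \<in> J t. m y \<subseteq> f}"
  define Pf where "Pf = (\<Sum>y\<in>D \<union> B. Q y)"
  note rb = ratio_bounds[OF t f NL, folded r_def v_def]
  note fJ = finite_J[OF t]
  have kL: "\<kappa> * L > 0" and Lp: "real L > 0" using \<kappa>_pos L_pos by auto
  have Sp: "total \<psi> t > 0" using S Lp by linarith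
  have finm: "finite (m y)" "card (m y) = 2" for y by (auto simp: m_def)
  have c2: "card (f \<inter> m y) \<le> 2" for y using card_mono[of "m y" "f \<inter> m y"] finm[of y] by auto
  have hitD: "{y \<in> J t. f \<inter> m y \<noteq> {}} = D \<union> B"
  proof -
    have "card (f \<inter> m y) = 1 \<or> m y \<subseteq> f" if "f \<inter> m y \<noteq> {}" for y
    proof -
      have "card (f \<inter> m y) \<noteq> 0" using that f by simp
      moreover have "m y \<subseteq> f" if "card (f \<inter> m y) = 2"
        using card_subset_eq[OF finm(1), of "f \<inter> m y" y] that finm by auto
      ultimately show ?thesis using c2[of y] by linarith
    qed
    moreover have "m y \<noteq> {}" for y by (simp add: m_def move_def)
    ultimately show ?thesis unfolding D_def B_def by fastforce
  qed
  have disj: "D \<inter> B = {}"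
  proof -
    have "card (f \<inter> m y) = 2" if "m y \<subseteq> f" for y using that finm by (simp add: Int_absorb1)
    then show ?thesis unfolding D_def B_def by fastforce
  qed
  have finDB: "finite D" "finite B" unfolding D_def B_def using fJ by auto
  have Q: "0 \<le> Q y" "Q y \<le> 2 / (\<kappa>\<^sup>2 * L)" for y using prob_bounds[OF t S] by (auto simp: Q_def)
  have X: "0 \<le> X" "X \<le> (1 / \<kappa>) ^ N" unfolding X_def using avail_nonneg avail_le t f by auto
  have Pf0: "0 \<le> Pf" unfolding Pf_def using Q by (intro sum_nonneg) auto
  have Pf1: "Pf \<le> 4 * real N / (\<kappa>\<^sup>2 * L)"
  proof -
    have "Pf \<le> real (card (D \<union> B)) * (2 / (\<kappa>\<^sup>2 * L))" unfolding Pf_def by (rule sum_bounded_above) (rule Q)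
    also have "real (card (D \<union> B)) \<le> 2 * real N"
      using card_hitting_moves[OF f(1) fJ, of "parent_label \<psi> t"] f(2) unfolding m_def[symmetric] hitD by linarith
    then have "real (card (D \<union> B)) * (2 / (\<kappa>\<^sup>2 * L)) \<le> 2 * real N * (2 / (\<kappa>\<^sup>2 * L))"
      using \<kappa>_pos Lp by (intro mult_right_mono) auto
    finally show ?thesis by simp
  qed
  have lhs: "mean \<psi> t (\<lambda>y. avail (\<psi>(t := y)) (Suc t) f) = X * r * (1 - Pf)"
  proof -
    have "mean \<psi> t (\<lambda>y. avail (\<psi>(t := y)) (Suc t) f) = (\<Sum>y\<in>J t. if y \<in> D \<union> B then 0 else Q y * (X * r))"
      unfolding mean_def avail_step[OF t] Q_def X_def r_def m_def[symmetric]
      by (intro sum.cong refl) (use hitD in auto)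
    also have "\<dots> = (\<Sum>y\<in>J t - (D \<union> B). Q y) * (X * r)"
      unfolding sum_distrib_right by (intro sum.mono_neutral_cong_right) (use fJ in auto)
    also have "(\<Sum>y\<in>J t - (D \<union> B). Q y) = (\<Sum>y\<in>J t. Q y) - Pf"
      unfolding Pf_def using fJ by (intro sum_diff) (auto simp: D_def B_def)
    finally show ?thesis unfolding Q_def prob_bounds(3)[OF t S] by (simp only: mult_ac)
  qed
  have A1: "A (\<lambda>y. avail \<psi> t (f \<union> m y)) = total \<psi> t * (X * (\<Sum>y\<in>D. Q y))"
  proof -
    have "A (\<lambda>y. avail \<psi> t (f \<union> m y)) = (\<Sum>y\<in>D. total \<psi> t * (X * Q y))"
      unfolding A_def D_def
    proof (intro sum.cong refl)
      fix y assume "y \<in> {y. y \<in> J t \<and> card (f \<inter> m y) = 1}"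
      then have "avail \<psi> t (f \<union> m y) / \<alpha> t (the_elem (f \<inter> m y)) = X * avail \<psi> t (m y)"
        unfolding X_def using avail_union[of t f "m y"] t f finm by simp
      then show "avail \<psi> t (f \<union> m y) / \<alpha> t (the_elem (f \<inter> m y)) = total \<psi> t * (X * Q y)"
        unfolding Q_def prob_def m_def using Sp by simp
    qed
    then show ?thesis by (simp add: sum_distrib_left)
  qed
  define a where "a = (\<lambda>y. \<Sum>\<omega>\<in>f \<inter> m y. 1 / \<alpha> t \<omega>)"
  have A0: "A (\<lambda>_. X) = X * (\<Sum>y\<in>D. a y)"
    unfolding A_def D_def[symmetric] sum_distrib_left
  proof (intro sum.cong refl)
    fix y assume "y \<in> D"
    then obtain \<omega> where "f \<inter> m y = {\<omega>}" unfolding D_def using card_1_singletonE by blast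
    then show "X / \<alpha> t (the_elem (f \<inter> m y)) = X * a y" by (simp add: a_def)
  qed
  have G: "grad \<psi> t t (parent_label \<psi> t) f = X * ((1 / L) * ((\<Sum>y\<in>D. a y) + (\<Sum>y\<in>B. a y)) - v)"
  proof -
    have "(\<Sum>\<omega>\<in>f. hits (parent_label \<psi> t) t \<omega> / \<alpha> t \<omega>) = (\<Sum>\<omega>\<in>f. \<Sum>y\<in>J t. if \<omega> \<in> m y then 1 / \<alpha> t \<omega> else 0)"
      unfolding hits_def m_def using fJ by (intro sum.cong refl) (simp add: sum.If_cases Int_def)
    also have "\<dots> = (\<Sum>y\<in>J t. \<Sum>\<omega>\<in>f. if \<omega> \<in> m y then 1 / \<alpha> t \<omega> else 0)" by (rule sum.swap)
    also have "\<dots> = (\<Sum>y\<in>J t. a y)" unfolding a_def using f(1) by (simp only: sum.inter_restrict)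
    also have "\<dots> = (\<Sum>y\<in>D \<union> B. a y)"
    proof (rule sum.mono_neutral_right[OF fJ])
      show "D \<union> B \<subseteq> J t" unfolding D_def B_def by auto
      show "\<forall>i\<in>J t - (D \<union> B). a i = 0" unfolding hitD[symmetric] a_def by auto
    qed
    also have "\<dots> = (\<Sum>y\<in>D. a y) + (\<Sum>y\<in>B. a y)" using finDB disj by (rule sum.union_disjoint)
    finally have "(\<Sum>\<omega>\<in>f. hits (parent_label \<psi> t) t \<omega> / \<alpha> t \<omega>) = (\<Sum>y\<in>D. a y) + (\<Sum>y\<in>B. a y)" .
    moreover have "(\<Sum>\<omega>\<in>f. (hits (parent_label \<psi> t) t \<omega> / L - planned t \<omega>) / \<alpha> t \<omega>) = (1 / L) * (\<Sum>\<omega>\<in>f. hits (parent_label \<psi> t) t \<omega> / \<alpha> t \<omega>) - v"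
      unfolding v_def by (simp add: diff_divide_distrib sum_subtractf sum_distrib_left mult.commute)
    ultimately show ?thesis unfolding grad_def X_def by simp
  qed
  have aB: "0 \<le> (\<Sum>y\<in>B. a y)" "(\<Sum>y\<in>B. a y) \<le> card B * (2 / \<kappa>)"
  proof -
    show "0 \<le> (\<Sum>y\<in>B. a y)" unfolding a_def using \<alpha>_pos[of t] t by (intro sum_nonneg) (auto simp: less_imp_le)
    have "a y \<le> 2 / \<kappa>" for y
    proof -
      have "a y \<le> real (card (f \<inter> m y)) * (1 / \<kappa>)" unfolding a_def by (rule sum_bounded_above) (use inv_\<alpha> t in auto)
      also have "\<dots> \<le> 2 * (1 / \<kappa>)" using c2[of y] \<kappa>_pos by (intro mult_right_mono) auto
      finally show ?thesis by simp
    qed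
    then show "(\<Sum>y\<in>B. a y) \<le> card B * (2 / \<kappa>)" by (intro sum_bounded_above)
  qed
  have QB: "0 \<le> (\<Sum>y\<in>B. Q y)" "(\<Sum>y\<in>B. Q y) \<le> card B * (2 / (\<kappa>\<^sup>2 * L))"
    by (intro sum_nonneg Q(1)) (intro sum_bounded_above Q(2))
  have PfDB: "Pf = (\<Sum>y\<in>D. Q y) + (\<Sum>y\<in>B. Q y)" unfolding Pf_def using finDB disj by (rule sum.union_disjoint)
  define e where "e = r - 1 - v"
  have main_eq: "mean \<psi> t (\<lambda>y. avail (\<psi>(t := y)) (Suc t) f) - avail \<psi> t f
            - ((1 / L) * (A (\<lambda>_. avail \<psi> t f) - L / total \<psi> t * A (\<lambda>y. avail \<psi> t (f \<union> m y))) - grad \<psi> t t (parent_label \<psi> t) f)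
      = X * (e - (r - 1) * Pf) + X * ((1 / L) * (\<Sum>y\<in>B. a y) - (\<Sum>y\<in>B. Q y))"
  proof -
    have "(1 / L) * (A (\<lambda>_. X) - L / total \<psi> t * A (\<lambda>y. avail \<psi> t (f \<union> m y))) = X * ((1 / L) * (\<Sum>y\<in>D. a y) - (\<Sum>y\<in>D. Q y))"
      unfolding A0 A1 using Sp Lp by (simp add: field_simps)
    then show ?thesis unfolding lhs G X_def[symmetric] e_def
      unfolding PfDB by (simp add: algebra_simps add_divide_distrib)
  qed
  have "\<bar>e - (r - 1) * Pf\<bar> \<le> 24 * real N ^ 2 * (1 / \<kappa>) ^ 3 / (real L)\<^sup>2"
  proof -
    have k3: "1 / (\<kappa> * L)\<^sup>2 \<le> (1/\<kappa>)^3 / (real L)\<^sup>2"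
    proof -
      have "(1/\<kappa>)^2 \<le> (1/\<kappa>)^3" using one_le_inv_\<kappa> by (intro power_increasing) auto
      then have "(1/\<kappa>)^2 / (real L)\<^sup>2 \<le> (1/\<kappa>)^3 / (real L)\<^sup>2" by (rule divide_right_mono) simp
      then show ?thesis by (simp add: power_divide power_mult_distrib)
    qed
    define b where "b = real N ^ 2 * ((1/\<kappa>)^3 / (real L)\<^sup>2)"
    have "b \<ge> 0" unfolding b_def using \<kappa>_pos by simp
    have "e \<le> 8 * real N ^ 2 * (1 / (\<kappa> * L)\<^sup>2)" using rb(3) by (simp add: e_def)
    also have "\<dots> \<le> 8 * real N ^ 2 * ((1/\<kappa>)^3 / (real L)\<^sup>2)" using k3 by (intro mult_left_mono) auto
    finally have e: "0 \<le> e" "e \<le> 8 * b" using rb(2) by (auto simp: e_def b_def)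
    have "(r - 1) * Pf \<le> 4 * real N / (\<kappa> * L) * (4 * real N / (\<kappa>\<^sup>2 * L))"
      using rb Pf0 Pf1 kL by (intro mult_mono) (auto simp: less_imp_le)
    also have "\<dots> = 16 * b" unfolding b_def by (simp add: power2_eq_square power3_eq_cube)
    finally have "(r - 1) * Pf \<le> 16 * b" .
    moreover have "0 \<le> (r - 1) * Pf" using rb Pf0 by (intro mult_nonneg_nonneg) auto
    ultimately have "\<bar>e - (r - 1) * Pf\<bar> \<le> 24 * b" using e \<open>b \<ge> 0\<close> by linarith
    then show ?thesis unfolding b_def by (simp add: mult_ac)
  qed
  then have p1: "\<bar>X * (e - (r - 1) * Pf)\<bar> \<le> (1 / \<kappa>) ^ N * (24 * real N ^ 2 * (1 / \<kappa>) ^ 3 / (real L)\<^sup>2)"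
    unfolding abs_mult using X by (intro mult_mono) auto
  have "\<bar>(1 / L) * (\<Sum>y\<in>B. a y) - (\<Sum>y\<in>B. Q y)\<bar> \<le> 4 * (1 / \<kappa>) ^ 2 / L * card B"
  proof -
    have "(1 / L) * (\<Sum>y\<in>B. a y) \<le> (1 / L) * (card B * (2 / \<kappa>))" using aB by (intro mult_left_mono) auto
    also have "\<dots> = (1 / L) * card B * 2 * (1 / \<kappa>)" by simp
    also have "\<dots> \<le> (1 / L) * card B * 2 * (1 / \<kappa>)^2"
      using power_increasing[OF _ one_le_inv_\<kappa>, of 1 2] by (intro mult_left_mono) auto
    finally have s1: "(1 / L) * (\<Sum>y\<in>B. a y) \<le> 2 * ((1 / \<kappa>) ^ 2 / L * card B)" by (simp add: mult_ac)
    have s2: "(\<Sum>y\<in>B. Q y) \<le> 2 * ((1 / \<kappa>) ^ 2 / L * card B)" using QB(2) by (simp add: power_divide mult_ac)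
    have s3: "0 \<le> (1 / L) * (\<Sum>y\<in>B. a y)" using aB(1) by simp
    have s4: "0 \<le> (1 / \<kappa>) ^ 2 / L * card B" using \<kappa>_pos by simp
    have "\<bar>(1 / L) * (\<Sum>y\<in>B. a y) - (\<Sum>y\<in>B. Q y)\<bar> \<le> 4 * ((1 / \<kappa>) ^ 2 / L * card B)"
      using s1 s2 s3 s4 QB(1) by linarith
    then show ?thesis by (simp add: mult_ac)
  qed
  then have p2: "\<bar>X * ((1 / L) * (\<Sum>y\<in>B. a y) - (\<Sum>y\<in>B. Q y))\<bar> \<le> (1 / \<kappa>) ^ N * (4 * (1 / \<kappa>) ^ 2 / L * card B)"
    unfolding abs_mult using X by (intro mult_mono) auto
  have "\<bar>X * (e - (r - 1) * Pf) + X * ((1 / L) * (\<Sum>y\<in>B. a y) - (\<Sum>y\<in>B. Q y))\<bar>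
     \<le> (1 / \<kappa>) ^ N * (24 * real N ^ 2 * (1 / \<kappa>) ^ 3 / (real L)\<^sup>2) + (1 / \<kappa>) ^ N * (4 * (1 / \<kappa>) ^ 2 / L * card B)"
    using p1 p2 abs_triangle_ineq[of "X * (e - (r - 1) * Pf)" "X * ((1 / L) * (\<Sum>y\<in>B. a y) - (\<Sum>y\<in>B. Q y))"] by linarith
  then show ?thesis unfolding main_eq B_def[symmetric] power_add by (simp add: mult_ac)
qed

end

section \<open>Change of a statistic in one step\<close>

text \<open>
  The constants below bound, for a statistic of level \<open>k\<close>: its change in one step; the values of
  \<open>grad\<close> under it; \<open>L\<close> times the change of these values in one step; and \<open>L\<close> times the second-order error of its expected change.
\<close>

definition step_const :: "real \<Rightarrow> nat \<Rightarrow> real" where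
  "step_const \<kappa> k = (1 / \<kappa>) ^ (k + 2) * (2 * degree_bound \<kappa> k + 4 * real (k + 2) * (1 / \<kappa>) * weight_bound \<kappa> k)"
definition grad_const :: "real \<Rightarrow> nat \<Rightarrow> real" where
  "grad_const \<kappa> k = 2 * real (k + 2) * (1 / \<kappa>) ^ (k + 3) * weight_bound \<kappa> k"
definition gap_const :: "real \<Rightarrow> nat \<Rightarrow> real" where
  "gap_const \<kappa> k = 2 * real (k + 2) * ((1 / \<kappa>) * step_const \<kappa> k + 2 * (1 / \<kappa>) ^ (k + 4) * weight_bound \<kappa> k)"
definition err_const :: "real \<Rightarrow> nat \<Rightarrow> real" where
  "err_const \<kappa> k = 24 * real (k + 2) ^ 2 * (1 / \<kappa>) ^ (k + 5) * weight_bound \<kappa> k"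

context greedy begin

abbreviation "wt \<equiv> weight_bound \<kappa>"
abbreviation "dg \<equiv> degree_bound \<kappa>"
abbreviation "\<kappa>i \<equiv> 1 / \<kappa>"

abbreviation "step_c \<equiv> step_const \<kappa>"
abbreviation "grad_c \<equiv> grad_const \<kappa>"
abbreviation "gap_c \<equiv> gap_const \<kappa>"
abbreviation "err_c \<equiv> err_const \<kappa>"

lemma Stats_pos: "F \<in> Stats k \<Longrightarrow> positive_on \<Omega> (k + 2) F"
  and Stats_wt: "F \<in> Stats k \<Longrightarrow> F (\<lambda>_. 1) \<le> wt k * L"
  and Stats_dg: "F \<in> Stats k \<Longrightarrow> F (\<lambda>f. of_bool (\<omega> \<in> f)) \<le> dg k"
  using Stats_regular by auto

lemma consts_nonneg: "0 \<le> step_c k" "0 \<le> grad_c k" "0 \<le> gap_c k"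
  using weight_bound_pos[OF \<kappa>_pos, of k] degree_bound_pos[OF \<kappa>_pos, of k] \<kappa>_pos
  by (auto simp: step_const_def grad_const_def gap_const_def intro!: mult_nonneg_nonneg add_nonneg_nonneg)

text \<open>
  Only sets containing one of the two used resources lose their availability, and their weight is
  bounded by the degree bound; all others change by a factor \<open>1 + O(1 / L)\<close>.
\<close>

lemma step_change_upd:
  assumes t: "t < n" and F: "F \<in> Stats k" and NL: "4 * real (k + 2) \<le> \<kappa> * L"
  shows "F (\<lambda>f. \<bar>avail (\<psi>(t := y)) (Suc t) f - avail \<psi> t f\<bar>) \<le> step_c k"
proof -
  let ?N = "k + 2"
  have "F (\<lambda>f. \<bar>avail (\<psi>(t := y)) (Suc t) f - avail \<psi> t f\<bar>)
     \<le> F (\<lambda>f. \<kappa>i ^ ?N * ((\<Sum>\<omega>\<in>move (parent_label \<psi> t) y. of_bool (\<omega> \<in> f)) + (4 * real ?N / (\<kappa> * L)) * 1))"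
  proof (rule positive_on_mono[OF Stats_pos[OF F]])
    fix f :: "resource set" assume f: "finite f" "card f \<le> k + 2"
    note rb = ratio_bounds[OF t f NL]
    have X: "0 \<le> avail \<psi> t f" "avail \<psi> t f \<le> \<kappa>i ^ ?N" using t f by (intro avail_nonneg avail_le; simp)+
    have kL: "0 \<le> 4 * real ?N / (\<kappa> * L)" using \<kappa>_pos by simp
    have s0: "0 \<le> (\<Sum>\<omega>\<in>move (parent_label \<psi> t) y. of_bool (\<omega> \<in> f) :: real)" by (intro sum_nonneg) auto
    show "\<bar>avail (\<psi>(t := y)) (Suc t) f - avail \<psi> t f\<bar> \<le> \<kappa>i ^ ?N * ((\<Sum>\<omega>\<in>move (parent_label \<psi> t) y. of_bool (\<omega> \<in> f)) + (4 * real ?N / (\<kappa> * L)) * 1)"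
    proof (cases "f \<inter> move (parent_label \<psi> t) y = {}")
      case True
      have "\<bar>avail (\<psi>(t := y)) (Suc t) f - avail \<psi> t f\<bar> = avail \<psi> t f * ((\<Prod>\<omega>\<in>f. \<alpha> t \<omega> / \<alpha> (Suc t) \<omega>) - 1)"
      proof -
        have "avail (\<psi>(t := y)) (Suc t) f - avail \<psi> t f = avail \<psi> t f * ((\<Prod>\<omega>\<in>f. \<alpha> t \<omega> / \<alpha> (Suc t) \<omega>) - 1)"
          unfolding avail_step[OF t] using True by (simp add: algebra_simps)
        moreover have "0 \<le> avail \<psi> t f * ((\<Prod>\<omega>\<in>f. \<alpha> t \<omega> / \<alpha> (Suc t) \<omega>) - 1)"
          using X rb(1,2) by (intro mult_nonneg_nonneg) auto
        ultimately show ?thesis by simp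
      qed
      also have "\<dots> \<le> \<kappa>i ^ ?N * (4 * real ?N / (\<kappa> * L))" using X rb by (intro mult_mono) auto
      also have "\<dots> \<le> \<kappa>i ^ ?N * ((\<Sum>\<omega>\<in>move (parent_label \<psi> t) y. of_bool (\<omega> \<in> f)) + (4 * real ?N / (\<kappa> * L)) * 1)"
        using s0 \<kappa>_pos by (intro mult_left_mono) auto
      finally show ?thesis .
    next
      case False
      then obtain \<omega> where \<omega>: "\<omega> \<in> f" "\<omega> \<in> move (parent_label \<psi> t) y" by blast
      have "(1::real) = of_bool (\<omega> \<in> f)" using \<omega> by simp
      also have "\<dots> \<le> (\<Sum>\<omega>\<in>move (parent_label \<psi> t) y. of_bool (\<omega> \<in> f))" using \<omega> by (intro member_le_sum) auto
      finally have s1: "1 \<le> (\<Sum>\<omega>\<in>move (parent_label \<psi> t) y. of_bool (\<omega> \<in> f) :: real)" .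
      have "\<kappa>i ^ ?N * 1 \<le> \<kappa>i ^ ?N * ((\<Sum>\<omega>\<in>move (parent_label \<psi> t) y. of_bool (\<omega> \<in> f)) + (4 * real ?N / (\<kappa> * L)) * 1)"
      proof (rule mult_left_mono)
        show "1 \<le> (\<Sum>\<omega>\<in>move (parent_label \<psi> t) y. of_bool (\<omega> \<in> f)) + (4 * real ?N / (\<kappa> * L)) * 1"
          using s1 kL by linarith
      qed (use \<kappa>_pos in simp)
      moreover have "avail (\<psi>(t := y)) (Suc t) f = 0" unfolding avail_step[OF t] using False by simp
      ultimately show ?thesis using X by simp
    qed
  qed
  also have "\<dots> = \<kappa>i ^ ?N * ((\<Sum>\<omega>\<in>move (parent_label \<psi> t) y. F (\<lambda>f. of_bool (\<omega> \<in> f))) + (4 * real ?N / (\<kappa> * L)) * F (\<lambda>_. 1))"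
    by (simp only: positive_onD[OF Stats_pos[OF F]] positive_on_sum[OF Stats_pos[OF F]])
  also have "\<dots> \<le> \<kappa>i ^ ?N * ((\<Sum>\<omega>\<in>move (parent_label \<psi> t) y. dg k) + (4 * real ?N / (\<kappa> * L)) * (wt k * L))"
    using Stats_dg[OF F] Stats_wt[OF F] \<kappa>_pos by (intro mult_left_mono add_mono sum_mono) auto
  also have "\<dots> = step_c k" unfolding step_const_def using L_pos by simp
  finally show ?thesis .
qed

lemma step_change:
  assumes "t < n" "F \<in> Stats k" "4 * real (k + 2) \<le> \<kappa> * L"
  shows "F (\<lambda>f. \<bar>avail \<psi> (Suc t) f - avail \<psi> t f\<bar>) \<le> step_c k"
  using step_change_upd[OF assms, of \<psi> "\<psi> t"] by (simp only: fun_upd_triv)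

lemma avail_lipschitz:
  assumes F: "F \<in> Stats k" "4 * real (k + 2) \<le> \<kappa> * L"
  shows "s \<le> t \<Longrightarrow> t \<le> n \<Longrightarrow> \<bar>F (avail \<psi> t) - F (avail \<psi> s)\<bar> \<le> step_c k * real (t - s)"
proof (induction t rule: dec_induct)
  case (step t)
  have "\<bar>F (avail \<psi> (Suc t)) - F (avail \<psi> t)\<bar> = \<bar>F (\<lambda>f. avail \<psi> (Suc t) f - avail \<psi> t f)\<bar>"
    by (simp add: positive_on_diff[OF Stats_pos[OF F(1)]])
  also have "\<dots> \<le> F (\<lambda>f. \<bar>avail \<psi> (Suc t) f - avail \<psi> t f\<bar>)" by (rule positive_on_abs_le[OF Stats_pos[OF F(1)]]) simp
  also have "\<dots> \<le> step_c k" using step_change F step by simp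
  finally have "\<bar>F (avail \<psi> (Suc t)) - F (avail \<psi> s)\<bar> \<le> step_c k + step_c k * real (t - s)" using step by simp
  also have "\<dots> = step_c k * real (Suc t - s)" using step by (simp add: Suc_diff_le algebra_simps)
  finally show ?case .
qed simp

lemma rate_diff: "c < n \<Longrightarrow> \<bar>hits z c \<omega> / L - planned c \<omega>\<bar> \<le> 2 / L"
proof -
  assume c: "c < n"
  have "0 \<le> hits z c \<omega> / L" "hits z c \<omega> / L \<le> 2 / L" using hits_bounds by (auto intro: divide_right_mono)
  then show ?thesis using planned_bounds[OF c, of \<omega>] by linarith
qed

lemma grad_bound:
  assumes "s \<le> n" "c < n" and F: "F \<in> Stats k"
  shows "\<bar>F (grad \<psi> s c z)\<bar> \<le> grad_c k"
proof -
  let ?N = "k + 2"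
  have "\<bar>F (grad \<psi> s c z)\<bar> \<le> F (\<lambda>f. \<kappa>i ^ ?N * (real ?N * (2 / L * \<kappa>i)) * 1)"
  proof (rule positive_on_abs_le[OF Stats_pos[OF F]])
    fix f :: "resource set" assume f: "finite f" "card f \<le> k + 2"
    have "\<bar>\<Sum>\<omega>\<in>f. (hits z c \<omega> / L - planned c \<omega>) / \<alpha> s \<omega>\<bar> \<le> (\<Sum>\<omega>\<in>f. \<bar>hits z c \<omega> / L - planned c \<omega>\<bar> * (1 / \<alpha> s \<omega>))"
      using \<alpha>_pos[OF assms(1)] by (intro order.trans[OF sum_abs] sum_mono) (simp add: abs_divide abs_of_pos)
    also have "\<dots> \<le> (\<Sum>\<omega>\<in>f. 2 / L * \<kappa>i)"
      using rate_diff[OF assms(2)] inv_\<alpha>[OF assms(1)] \<alpha>_pos[OF assms(1)] by (intro sum_mono mult_mono) (auto simp: less_imp_le)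
    also have "\<dots> = real (card f) * (2 / L * \<kappa>i)" by simp
    also have "\<dots> \<le> real ?N * (2 / L * \<kappa>i)" using f \<kappa>_pos by (intro mult_right_mono of_nat_mono) auto
    finally have "\<bar>\<Sum>\<omega>\<in>f. (hits z c \<omega> / L - planned c \<omega>) / \<alpha> s \<omega>\<bar> \<le> real ?N * (2 / L * \<kappa>i)" .
    then have "\<bar>grad \<psi> s c z f\<bar> \<le> \<kappa>i ^ ?N * (real ?N * (2 / L * \<kappa>i))"
      unfolding grad_def abs_mult using avail_nonneg[OF assms(1)] avail_le[OF assms(1) f] \<kappa>_pos by (intro mult_mono) auto
    then show "\<bar>grad \<psi> s c z f\<bar> \<le> \<kappa>i ^ ?N * (real ?N * (2 / L * \<kappa>i)) * 1" by simp
  qed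
  also have "\<dots> = \<kappa>i ^ ?N * (real ?N * (2 / L * \<kappa>i)) * F (\<lambda>_. 1)" by (rule positive_on_scale[OF Stats_pos[OF F]])
  also have "\<dots> \<le> \<kappa>i ^ ?N * (real ?N * (2 / L * \<kappa>i)) * (wt k * L)"
    using Stats_wt[OF F] \<kappa>_pos by (intro mult_left_mono) auto
  also have "\<dots> = grad_c k" unfolding grad_const_def using L_pos by (simp add: power_add eval_nat_numeral)
  finally show ?thesis .
qed

lemma grad_step:
  assumes s: "s < n" "c < n" and F: "F \<in> Stats k" and NL: "4 * real (k + 2) \<le> \<kappa> * L"
  shows "\<bar>F (grad \<psi> (Suc s) c z) - F (grad \<psi> s c z)\<bar> \<le> gap_c k / L"
proof -
  let ?N = "k + 2"
  note FP = Stats_pos[OF F]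
  have ap: "\<alpha> s \<omega> > 0" "\<alpha> (Suc s) \<omega> > 0" for \<omega> using \<alpha>_pos s by auto
  have "\<bar>F (grad \<psi> (Suc s) c z) - F (grad \<psi> s c z)\<bar> = \<bar>F (\<lambda>f. grad \<psi> (Suc s) c z f - grad \<psi> s c z f)\<bar>"
    by (simp add: positive_on_diff[OF FP])
  also have "\<dots> \<le> F (\<lambda>f. real ?N * (2 / L) * (\<kappa>i * \<bar>avail \<psi> (Suc s) f - avail \<psi> s f\<bar> + (\<kappa>i ^ ?N * (2 / L * (\<kappa>i * \<kappa>i))) * 1))"
  proof (rule positive_on_abs_le[OF FP])
    fix f :: "resource set" assume f: "finite f" "card f \<le> k + 2"
    let ?x = "avail \<psi> s f" and ?x' = "avail \<psi> (Suc s) f"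
    define b where "b = \<kappa>i * \<bar>?x' - ?x\<bar> + (\<kappa>i ^ ?N * (2 / L * (\<kappa>i * \<kappa>i))) * 1"
    have X: "0 \<le> ?x" "?x \<le> \<kappa>i ^ ?N" using s f by (intro avail_nonneg avail_le; simp)+
    have b0: "b \<ge> 0" unfolding b_def using \<kappa>_pos by (intro add_nonneg_nonneg mult_nonneg_nonneg) auto
    have d: "\<bar>?x' / \<alpha> (Suc s) \<omega> - ?x / \<alpha> s \<omega>\<bar> \<le> b" for \<omega>
    proof -
      have "?x' / \<alpha> (Suc s) \<omega> - ?x / \<alpha> s \<omega> = (1 / \<alpha> (Suc s) \<omega>) * (?x' - ?x) + ?x * (1 / \<alpha> (Suc s) \<omega> - 1 / \<alpha> s \<omega>)"
        by (simp add: algebra_simps diff_divide_distrib)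
      moreover have "1 / \<alpha> (Suc s) \<omega> - 1 / \<alpha> s \<omega> = planned s \<omega> * ((1 / \<alpha> (Suc s) \<omega>) * (1 / \<alpha> s \<omega>))"
        using ap[of \<omega>] \<alpha>_Suc[of s \<omega>] by (simp add: field_simps)
      moreover have "\<bar>(1 / \<alpha> (Suc s) \<omega>) * (?x' - ?x)\<bar> \<le> \<kappa>i * \<bar>?x' - ?x\<bar>"
        unfolding abs_mult using inv_\<alpha>[of "Suc s" \<omega>] ap[of \<omega>] s by (intro mult_right_mono) auto
      moreover have "\<bar>?x * (planned s \<omega> * ((1 / \<alpha> (Suc s) \<omega>) * (1 / \<alpha> s \<omega>)))\<bar> \<le> \<kappa>i ^ ?N * (2 / L * (\<kappa>i * \<kappa>i))"
        unfolding abs_mult using X planned_bounds[OF s(1), of \<omega>] inv_\<alpha>[of s \<omega>] inv_\<alpha>[of "Suc s" \<omega>] ap[of \<omega>] s \<kappa>_pos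
        by (intro mult_mono mult_nonneg_nonneg) auto
      ultimately show ?thesis unfolding b_def using abs_triangle_ineq[of "(1 / \<alpha> (Suc s) \<omega>) * (?x' - ?x)" "?x * (1 / \<alpha> (Suc s) \<omega> - 1 / \<alpha> s \<omega>)"]
        by (simp only: mult_1_right)
    qed
    have "\<bar>grad \<psi> (Suc s) c z f - grad \<psi> s c z f\<bar> = \<bar>\<Sum>\<omega>\<in>f. (hits z c \<omega> / L - planned c \<omega>) * (?x' / \<alpha> (Suc s) \<omega> - ?x / \<alpha> s \<omega>)\<bar>"
      unfolding grad_def sum_distrib_left sum_subtractf[symmetric] by (intro arg_cong[where f=abs] sum.cong refl) (simp add: algebra_simps)
    also have "\<dots> \<le> (\<Sum>\<omega>\<in>f. 2 / L * b)"
    proof (intro order.trans[OF sum_abs] sum_mono)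
      fix \<omega>
      show "\<bar>(hits z c \<omega> / L - planned c \<omega>) * (?x' / \<alpha> (Suc s) \<omega> - ?x / \<alpha> s \<omega>)\<bar> \<le> 2 / L * b"
        unfolding abs_mult by (intro mult_mono rate_diff[OF s(2)] d b0) auto
    qed
    also have "\<dots> = real (card f) * (2 / L * b)" by simp
    also have "\<dots> \<le> real ?N * (2 / L * b)" using f b0 by (intro mult_right_mono of_nat_mono) auto
    finally show "\<bar>grad \<psi> (Suc s) c z f - grad \<psi> s c z f\<bar> \<le> real ?N * (2 / L) * (\<kappa>i * \<bar>?x' - ?x\<bar> + (\<kappa>i ^ ?N * (2 / L * (\<kappa>i * \<kappa>i))) * 1)"
      unfolding b_def by (simp only: mult.assoc)
  qed
  also have "\<dots> = real ?N * (2 / L) * (\<kappa>i * F (\<lambda>f. \<bar>avail \<psi> (Suc s) f - avail \<psi> s f\<bar>) + (\<kappa>i ^ ?N * (2 / L * (\<kappa>i * \<kappa>i))) * F (\<lambda>_. 1))"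
    by (simp only: positive_onD[OF FP])
  also have "\<dots> \<le> real ?N * (2 / L) * (\<kappa>i * step_c k + (\<kappa>i ^ ?N * (2 / L * (\<kappa>i * \<kappa>i))) * (wt k * L))"
    using step_change[OF s(1) F NL] Stats_wt[OF F] \<kappa>_pos by (intro mult_left_mono add_mono) auto
  also have "\<dots> = gap_c k / L" unfolding gap_const_def using L_pos by (simp add: power_add eval_nat_numeral mult_ac)
  finally show ?thesis .
qed

lemma grad_lipschitz:
  assumes F: "F \<in> Stats k" "4 * real (k + 2) \<le> \<kappa> * L" "c < n"
  shows "s \<le> t \<Longrightarrow> t \<le> n \<Longrightarrow> \<bar>F (grad \<psi> t c z) - F (grad \<psi> s c z)\<bar> \<le> gap_c k / L * real (t - s)"
proof (induction t rule: dec_induct)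
  case (step t)
  then have "\<bar>F (grad \<psi> (Suc t) c z) - F (grad \<psi> t c z)\<bar> \<le> gap_c k / L" using grad_step F by simp
  then have "\<bar>F (grad \<psi> (Suc t) c z) - F (grad \<psi> s c z)\<bar> \<le> gap_c k / L + gap_c k / L * real (t - s)" using step by simp
  also have "\<dots> = gap_c k / L * real (Suc t - s)" using step by (simp add: Suc_diff_le distrib_left)
  finally show ?case .
qed simp

text \<open>
  The number of moves that lie inside \<open>f\<close>, which are exceptional in the first-order computation.
\<close>

definition double_hits :: "int \<Rightarrow> resource set \<Rightarrow> real" where
  "double_hits p f = real (card {y \<in> P. move p y \<subseteq> f})"

lemma mean_functional:
  assumes "positive_on \<Omega> N F"
  shows "mean \<psi> t (\<lambda>y. F (h y)) = F (\<lambda>f. mean \<psi> t (\<lambda>y. h y f))"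
  unfolding mean_def by (simp only: positive_on_sum[OF assms] positive_on_scale[OF assms])

text \<open>
  The statistic version of \<open>pointwise_drift\<close>: the two extensions of \<open>F\<close> by the current
  step appear with the same initial value, so their difference is small as long as both are near
  that value.
\<close>

lemma expected_change:
  assumes t: "t < n" and F: "F \<in> Stats k" and NL: "4 * real (k + 2) \<le> \<kappa> * L" and S: "total \<psi> t \<ge> L / 2"
  shows "\<bar>mean \<psi> t (\<lambda>y. F (avail (\<psi>(t := y)) (Suc t))) - F (avail \<psi> t)
     - ((1 / L) * (ext False t (parent_label \<psi> t) F (avail \<psi> t) - L / total \<psi> t * ext True t (parent_label \<psi> t) F (avail \<psi> t)) - F (grad \<psi> t t (parent_label \<psi> t)))\<bar>
    \<le> err_c k / L + 4 * \<kappa>i ^ (k + 4) / L * F (double_hits (parent_label \<psi> t))"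
proof -
  note FP = Stats_pos[OF F]
  let ?p = "parent_label \<psi> t"
  define A where "A = (\<lambda>(h :: int \<Rightarrow> real) f. \<Sum>y | y \<in> J t \<and> card (f \<inter> move ?p y) = 1. h y / \<alpha> t (the_elem (f \<inter> move ?p y)))"
  define R where "R = (\<lambda>f. mean \<psi> t (\<lambda>y. avail (\<psi>(t := y)) (Suc t) f) - avail \<psi> t f
            - ((1 / L) * (A (\<lambda>_. avail \<psi> t f) f - L / total \<psi> t * A (\<lambda>y. avail \<psi> t (f \<union> move ?p y)) f) - grad \<psi> t t ?p f))"
  have e: "ext False t ?p F (avail \<psi> t) = F (\<lambda>f. A (\<lambda>_. avail \<psi> t f) f)" "ext True t ?p F (avail \<psi> t) = F (\<lambda>f. A (\<lambda>y. avail \<psi> t (f \<union> move ?p y)) f)"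
    unfolding ext_def A_def by simp_all
  have "mean \<psi> t (\<lambda>y. F (avail (\<psi>(t := y)) (Suc t))) - F (avail \<psi> t)
     - ((1 / L) * (ext False t ?p F (avail \<psi> t) - L / total \<psi> t * ext True t ?p F (avail \<psi> t)) - F (grad \<psi> t t ?p)) = F R"
    unfolding R_def e mean_functional[OF FP] by (simp only: positive_on_diff[OF FP] positive_on_scale[OF FP])
  moreover have "\<bar>F R\<bar> \<le> F (\<lambda>f. 24 * real (k + 2) ^ 2 * \<kappa>i ^ (k + 5) / (real L)\<^sup>2 * 1 + 4 * \<kappa>i ^ (k + 4) / L * double_hits ?p f)"
  proof (rule positive_on_abs_le[OF FP])
    fix f :: "resource set" assume f: "finite f" "card f \<le> k + 2"
    have "card {y \<in> J t. move ?p y \<subseteq> f} \<le> card {y \<in> P. move ?p y \<subseteq> f}"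
      using J_sub[OF t] finite_P by (intro card_mono) auto
    then have "4 * \<kappa>i ^ (k + 4) / L * real (card {y \<in> J t. move ?p y \<subseteq> f}) \<le> 4 * \<kappa>i ^ (k + 4) / L * double_hits ?p f"
      unfolding double_hits_def using \<kappa>_pos by (intro mult_left_mono) auto
    moreover have e5: "k + 2 + 3 = k + 5" "k + 2 + 2 = k + 4" by simp_all
    have "\<bar>R f\<bar> \<le> 24 * real (k + 2) ^ 2 * \<kappa>i ^ (k + 5) / (real L)\<^sup>2 + 4 * \<kappa>i ^ (k + 4) / L * real (card {y \<in> J t. move ?p y \<subseteq> f})"
      using pointwise_drift[OF t S f NL] unfolding e5 R_def A_def .
    ultimately show "\<bar>R f\<bar> \<le> 24 * real (k + 2) ^ 2 * \<kappa>i ^ (k + 5) / (real L)\<^sup>2 * 1 + 4 * \<kappa>i ^ (k + 4) / L * double_hits ?p f"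
      unfolding mult_1_right
      by linarith
  qed
  moreover have "F (\<lambda>f. 24 * real (k + 2) ^ 2 * \<kappa>i ^ (k + 5) / (real L)\<^sup>2 * 1 + 4 * \<kappa>i ^ (k + 4) / L * double_hits ?p f)
    = 24 * real (k + 2) ^ 2 * \<kappa>i ^ (k + 5) / (real L)\<^sup>2 * F (\<lambda>_. 1) + 4 * \<kappa>i ^ (k + 4) / L * F (double_hits ?p)"
    by (simp only: positive_onD[OF FP])
  moreover have "24 * real (k + 2) ^ 2 * \<kappa>i ^ (k + 5) / (real L)\<^sup>2 * F (\<lambda>_. 1) \<le> 24 * real (k + 2) ^ 2 * \<kappa>i ^ (k + 5) / (real L)\<^sup>2 * (wt k * L)"
    using Stats_wt[OF F] \<kappa>_pos by (intro mult_left_mono) auto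
  moreover have "24 * real (k + 2) ^ 2 * \<kappa>i ^ (k + 5) / (real L)\<^sup>2 * (wt k * L) = err_c k / L"
    unfolding err_const_def using L_pos by (simp add: power2_eq_square)
  ultimately show ?thesis by linarith
qed

lemma sum_double_hits:
  assumes F: "F \<in> Stats k"
  shows "(\<Sum>p\<in>P. F (double_hits p)) \<le> 2 * real (k + 2) ^ 2 * wt k * L"
proof -
  note FP = Stats_pos[OF F]
  have "(\<Sum>p\<in>P. F (double_hits p)) = F (\<lambda>f. \<Sum>p\<in>P. double_hits p f)" by (simp only: positive_on_sum[OF FP])
  also have "\<dots> \<le> F (\<lambda>f. 2 * real (k + 2) ^ 2 * 1)"
  proof (rule positive_on_mono[OF FP])
    fix f :: "resource set" assume f: "finite f" "card f \<le> k + 2"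
    have "(\<Sum>p\<in>P. double_hits p f) = real (\<Sum>p\<in>P. card {y \<in> P. move p y \<subseteq> f})" by (simp add: double_hits_def)
    also have "\<dots> \<le> real (2 * card f ^ 2)" using sum_card_moves_inside[OF f(1) finite_P] by (simp only: of_nat_le_iff)
    also have "\<dots> \<le> real (2 * (k + 2) ^ 2)" using f by (intro of_nat_mono mult_left_mono power_mono) auto
    finally show "(\<Sum>p\<in>P. double_hits p f) \<le> 2 * real (k + 2) ^ 2 * 1" by simp
  qed
  also have "\<dots> = 2 * real (k + 2) ^ 2 * F (\<lambda>_. 1)" by (rule positive_on_scale[OF FP])
  also have "\<dots> \<le> 2 * real (k + 2) ^ 2 * (wt k * L)" using Stats_wt[OF F] by (intro mult_left_mono) auto
  finally show ?thesis by simp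
qed

text \<open>
  A single step can have a large error, if its parent label is special for \<open>F\<close>, but each parent
  label occurs at most \<open>m\<close> times.
\<close>

lemma sum_double_hits_steps:
  assumes F: "F \<in> Stats k" and pl: "\<And>s. s < t \<Longrightarrow> parent_label \<psi> s \<in> P" and m: "\<And>p. real (card {s. s < t \<and> parent_label \<psi> s = p}) \<le> m"
  shows "(\<Sum>s<t. F (double_hits (parent_label \<psi> s))) \<le> m * (2 * real (k + 2) ^ 2 * wt k * L)"
proof -
  have nn: "0 \<le> F (double_hits p)" for p by (rule positive_on_nonneg[OF Stats_pos[OF F]]) (simp add: double_hits_def)
  have "(\<Sum>s<t. F (double_hits (parent_label \<psi> s))) = (\<Sum>p\<in>P. \<Sum>s | s \<in> {..<t} \<and> parent_label \<psi> s = p. F (double_hits (parent_label \<psi> s)))"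
    by (rule sum.group[symmetric]) (use finite_P pl in auto)
  also have "\<dots> = (\<Sum>p\<in>P. real (card {s. s < t \<and> parent_label \<psi> s = p}) * F (double_hits p))" by simp
  also have "\<dots> \<le> (\<Sum>p\<in>P. m * F (double_hits p))" using m nn by (intro sum_mono mult_right_mono) auto
  also have "\<dots> = m * (\<Sum>p\<in>P. F (double_hits p))" by (simp add: sum_distrib_left)
  also have "\<dots> \<le> m * (2 * real (k + 2) ^ 2 * wt k * L)"
    using sum_double_hits[OF F] m[of 0] by (intro mult_left_mono) (auto intro: order_trans[OF of_nat_0_le_iff])
  finally show ?thesis .
qed

text \<open>
  Under the uniform law of \<open>z\<close> the mean of \<open>grad\<close> is zero. The actual law of \<open>z\<close> is proportional to the
  availability of the moves, and for each resource the difference between these two laws is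
  measured by a statistic of level 0.
\<close>

lemma mean_grad:
  assumes s: "s < n" and c: "c < n" "\<not> jump c" "par c = s" and S: "total \<psi> s \<ge> L / 2" and F: "F \<in> Stats k"
    and pl: "parent_label \<psi> s \<in> P"
    and dev: "\<And>F0 :: functional. F0 \<in> Stats 0 \<Longrightarrow> \<bar>F0 (avail \<psi> s) - F0 (\<lambda>_. 1)\<bar> \<le> \<delta> * real L"
  shows "\<bar>mean \<psi> s (\<lambda>z. F (grad \<psi> s c z))\<bar> \<le> 6 * real (k + 2) * \<kappa>i ^ (k + 3) * wt k * \<delta>"
proof -
  note FP = Stats_pos[OF F]
  let ?p = "parent_label \<psi> s"
  have Lp: "real L > 0" using L_pos by simp
  have Sp: "total \<psi> s > 0" using S Lp by linarith
  have S_base: "base ?p s (\<lambda>_. 1) (avail \<psi> s) = total \<psi> s" "base ?p s (\<lambda>_. 1) (\<lambda>_. 1) = L"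
    using card_J[OF s] by (simp_all add: base_def total_def)
  have "base ?p s (\<lambda>_. 1) \<in> Stats 0" using pl s by auto
  from dev[OF this] have dS: "\<bar>total \<psi> s - L\<bar> \<le> \<delta> * L" unfolding S_base .
  have \<delta>0: "0 \<le> \<delta>" using dS Lp by (smt (verit) mult_neg_pos)
  have bracket: "\<bar>(\<Sum>z\<in>J s. prob \<psi> s z * hits z c \<omega>) / L - planned c \<omega>\<bar> \<le> 6 * \<delta> / L" if "\<omega> \<in> \<Omega>" for \<omega>
  proof -
    define b where "b = base ?p s (\<lambda>z. hits z c \<omega>)"
    have bF: "b \<in> Stats 0" unfolding b_def Stats.simps
      by (rule UnI2, rule image_eqI[of _ _ "(?p, s, c, \<omega>)"]) (use pl s c that in auto)
    have d: "\<bar>b (avail \<psi> s) - b (\<lambda>_. 1)\<bar> \<le> \<delta> * L" by (rule dev[OF bF])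
    have b1: "0 \<le> b (\<lambda>_. 1)" "b (\<lambda>_. 1) \<le> 2 * L"
      using Stats_wt[OF bF] positive_on_nonneg[OF Stats_pos[OF bF], of "\<lambda>_. 1"] by auto
    have e1: "(\<Sum>z\<in>J s. prob \<psi> s z * hits z c \<omega>) = b (avail \<psi> s) / total \<psi> s"
      unfolding b_def base_def prob_def sum_divide_distrib by (intro sum.cong) auto
    have e2: "planned c \<omega> = b (\<lambda>_. 1) / real L ^ 2" unfolding planned_def b_def base_def using c by simp
    have "\<bar>b (avail \<psi> s) / total \<psi> s - b (\<lambda>_. 1) / L\<bar> \<le> 6 * \<delta>"
    proof -
      have eq: "b (avail \<psi> s) / total \<psi> s - b (\<lambda>_. 1) / L = (b (avail \<psi> s) - b (\<lambda>_. 1)) / total \<psi> s + b (\<lambda>_. 1) * (L - total \<psi> s) / (total \<psi> s * L)"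
        using Sp Lp by (simp add: field_simps)
      have t1: "\<bar>(b (avail \<psi> s) - b (\<lambda>_. 1)) / total \<psi> s\<bar> \<le> 2 * \<delta>"
      proof -
        have "\<bar>(b (avail \<psi> s) - b (\<lambda>_. 1)) / total \<psi> s\<bar> \<le> \<delta> * L / (L / 2)"
          unfolding abs_divide using d S Sp Lp by (intro frac_le) auto
        then show ?thesis using Lp by simp
      qed
      have t2: "\<bar>b (\<lambda>_. 1) * (L - total \<psi> s) / (total \<psi> s * L)\<bar> \<le> 4 * \<delta>"
      proof -
        have "\<bar>b (\<lambda>_. 1) * (L - total \<psi> s)\<bar> \<le> (2 * L) * (\<delta> * L)"
          unfolding abs_mult using b1 dS by (intro mult_mono) auto
        moreover have "L / 2 * L \<le> \<bar>total \<psi> s * L\<bar>" using S Sp Lp by (simp add: abs_mult)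
        ultimately have "\<bar>b (\<lambda>_. 1) * (L - total \<psi> s) / (total \<psi> s * L)\<bar> \<le> (2 * L) * (\<delta> * L) / (L / 2 * L)"
          unfolding abs_divide using Lp \<delta>0 by (intro frac_le) auto
        then show ?thesis using Lp by simp
      qed
      show ?thesis unfolding eq using order.trans[OF abs_triangle_ineq add_mono[OF t1 t2]] by simp
    qed
    then have "\<bar>b (avail \<psi> s) / total \<psi> s - b (\<lambda>_. 1) / L\<bar> / L \<le> 6 * \<delta> / L" by (rule divide_right_mono) simp
    moreover have "(\<Sum>z\<in>J s. prob \<psi> s z * hits z c \<omega>) / L - planned c \<omega> = (b (avail \<psi> s) / total \<psi> s - b (\<lambda>_. 1) / L) / L"
      unfolding e1 e2 by (simp add: power2_eq_square diff_divide_distrib)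
    ultimately show ?thesis using Lp by simp
  qed
  have Av_eq: "mean \<psi> s (\<lambda>z. grad \<psi> s c z f) = avail \<psi> s f * (\<Sum>\<omega>\<in>f. ((\<Sum>z\<in>J s. prob \<psi> s z * hits z c \<omega>) / L - planned c \<omega>) / \<alpha> s \<omega>)" for f
  proof -
    have "mean \<psi> s (\<lambda>z. grad \<psi> s c z f) = (\<Sum>z\<in>J s. \<Sum>\<omega>\<in>f. avail \<psi> s f * ((prob \<psi> s z * hits z c \<omega> / L - prob \<psi> s z * planned c \<omega>) / \<alpha> s \<omega>))"
      unfolding mean_def grad_def sum_distrib_left by (intro sum.cong refl) (simp add: algebra_simps diff_divide_distrib)
    also have "\<dots> = (\<Sum>\<omega>\<in>f. \<Sum>z\<in>J s. avail \<psi> s f * ((prob \<psi> s z * hits z c \<omega> / L - prob \<psi> s z * planned c \<omega>) / \<alpha> s \<omega>))" by (rule sum.swap)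
    also have "\<dots> = (\<Sum>\<omega>\<in>f. avail \<psi> s f * (((\<Sum>z\<in>J s. prob \<psi> s z * hits z c \<omega>) / L - (\<Sum>z\<in>J s. prob \<psi> s z) * planned c \<omega>) / \<alpha> s \<omega>))"
      by (simp only: sum_distrib_left[symmetric] sum_divide_distrib[symmetric] sum_subtractf sum_distrib_right[symmetric])
    finally show ?thesis unfolding prob_bounds(3)[OF s S] by (simp add: sum_distrib_left)
  qed
  have "\<bar>mean \<psi> s (\<lambda>z. F (grad \<psi> s c z))\<bar> \<le> F (\<lambda>f. \<kappa>i ^ (k + 2) * (real (k + 2) * (6 * \<delta> / L * \<kappa>i)) * 1)"
    unfolding mean_functional[OF FP]
  proof (rule positive_on_abs_le[OF FP])
    fix f :: "resource set" assume f: "finite f" "card f \<le> k + 2" "f \<subseteq> \<Omega>"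
    have "\<bar>\<Sum>\<omega>\<in>f. ((\<Sum>z\<in>J s. prob \<psi> s z * hits z c \<omega>) / L - planned c \<omega>) / \<alpha> s \<omega>\<bar> \<le> (\<Sum>\<omega>\<in>f. 6 * \<delta> / L * \<kappa>i)"
    proof (intro order.trans[OF sum_abs] sum_mono)
      fix \<omega> assume "\<omega> \<in> f"
      then have "\<bar>(\<Sum>z\<in>J s. prob \<psi> s z * hits z c \<omega>) / L - planned c \<omega>\<bar> * (1 / \<alpha> s \<omega>) \<le> 6 * \<delta> / L * \<kappa>i"
        using bracket f inv_\<alpha>[of s \<omega>] \<alpha>_pos[of s \<omega>] s \<delta>0 by (intro mult_mono) auto
      then show "\<bar>((\<Sum>z\<in>J s. prob \<psi> s z * hits z c \<omega>) / L - planned c \<omega>) / \<alpha> s \<omega>\<bar> \<le> 6 * \<delta> / L * \<kappa>i"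
        using \<alpha>_pos[of s \<omega>] s by (simp add: abs_divide)
    qed
    also have "\<dots> = real (card f) * (6 * \<delta> / L * \<kappa>i)" by simp
    also have "\<dots> \<le> real (k + 2) * (6 * \<delta> / L * \<kappa>i)" using f \<kappa>_pos \<delta>0 by (intro mult_right_mono of_nat_mono) auto
    finally have "\<bar>mean \<psi> s (\<lambda>z. grad \<psi> s c z f)\<bar> \<le> \<kappa>i ^ (k + 2) * (real (k + 2) * (6 * \<delta> / L * \<kappa>i))"
      unfolding Av_eq abs_mult
    proof (intro mult_mono)
      show "\<bar>avail \<psi> s f\<bar> \<le> \<kappa>i ^ (k + 2)" using avail_nonneg[of s \<psi> f] avail_le[of s f "k + 2" \<psi>] s f by simp
    qed (use \<kappa>_pos in auto)
    then show "\<bar>mean \<psi> s (\<lambda>z. grad \<psi> s c z f)\<bar> \<le> \<kappa>i ^ (k + 2) * (real (k + 2) * (6 * \<delta> / L * \<kappa>i)) * 1" by simp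
  qed
  also have "\<dots> = \<kappa>i ^ (k + 2) * (real (k + 2) * (6 * \<delta> / L * \<kappa>i)) * F (\<lambda>_. 1)" by (rule positive_on_scale[OF FP])
  also have "\<dots> \<le> \<kappa>i ^ (k + 2) * (real (k + 2) * (6 * \<delta> / L * \<kappa>i)) * (wt k * L)"
    using Stats_wt[OF F] \<kappa>_pos \<delta>0 by (intro mult_left_mono) auto
  also have "\<dots> = 6 * real (k + 2) * \<kappa>i ^ (k + 3) * wt k * \<delta>" using Lp by (simp add: power_add eval_nat_numeral)
  finally show ?thesis .
qed

end

section \<open>Growth of the deviations\<close>

text \<open>
  \<open>L\<close> times this constant bounds all values of a statistic of level \<open>k\<close>, so deviations divided by it
  are at most 1.
\<close>

definition dev_scale :: "real \<Rightarrow> nat \<Rightarrow> real" where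
  "dev_scale \<kappa> k = weight_bound \<kappa> k * (1 / \<kappa>) ^ (k + 2)"

definition rate_const :: "real \<Rightarrow> real" where
  "rate_const \<kappa> = (4 + 4 * dev_scale \<kappa> 0) / \<kappa>\<^sup>2 + 6 * dev_scale \<kappa> 0 * (1 / \<kappa>)"

definition total_const :: "real \<Rightarrow> real \<Rightarrow> nat \<Rightarrow> real" where
  "total_const \<kappa> H k = (2 + H * err_const \<kappa> k + 8 * (1 / \<kappa>) ^ (k + 4) * real (k + 2) ^ 2 * weight_bound \<kappa> k
      + H * gap_const \<kappa> k + 3 * grad_const \<kappa> k
      + 6 * real (k + 2) * (1 / \<kappa>) * dev_scale \<kappa> k * (H * step_const \<kappa> 0 + dev_scale \<kappa> 0)) / dev_scale \<kappa> k"

context greedy begin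

definition near_children :: "nat \<Rightarrow> nat set" where "near_children s = {c. c < n \<and> \<not> jump c \<and> par c = s}"

lemma finite_near_children [simp]: "finite (near_children s)" unfolding near_children_def by (rule finite_subset[of _ "{..<n}"]) auto

text \<open>
  The statistic after step \<open>s\<close>, minus the errors that the choice \<open>y\<close> will cause when the children of
  \<open>s\<close> in its piece are labelled.
\<close>

definition compensated :: "(nat \<Rightarrow> int) \<Rightarrow> nat \<Rightarrow> functional \<Rightarrow> int \<Rightarrow> real" where
  "compensated \<psi> s F y = F (avail (\<psi>(s := y)) (Suc s)) - (\<Sum>c\<in>near_children s. F (grad \<psi> s c y))"

definition martingale :: "(nat \<Rightarrow> int) \<Rightarrow> nat \<Rightarrow> functional \<Rightarrow> real" where
  "martingale \<psi> t F = (\<Sum>s<t. compensated \<psi> s F (\<psi> s) - mean \<psi> s (compensated \<psi> s F))"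

abbreviation "Wc \<equiv> dev_scale \<kappa>"

definition rel_dev :: "(nat \<Rightarrow> int) \<Rightarrow> nat \<Rightarrow> nat \<Rightarrow> functional \<Rightarrow> real" where
  "rel_dev \<psi> t j F = \<bar>F (avail \<psi> t) - F (\<lambda>_. 1)\<bar> / (Wc j * L)"

text \<open>
  The largest deviation, relative to the scale of its level, of a statistic of level at most \<open>k\<close>.
\<close>

definition sigma :: "(nat \<Rightarrow> int) \<Rightarrow> nat \<Rightarrow> nat \<Rightarrow> real" where
  "sigma \<psi> k t = Max ((\<lambda>(j, F). rel_dev \<psi> t j F) ` Sigma {..k} Stats)"

lemma Wc_pos: "Wc k > 0" unfolding dev_scale_def using weight_bound_pos[OF \<kappa>_pos] \<kappa>_pos by simp

lemma Wc_Suc: "Wc (Suc k) = 2 * real (k + 2) / \<kappa>\<^sup>2 * Wc k"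
  unfolding dev_scale_def by (simp add: power2_eq_square)

lemma avail_0: "avail \<psi> 0 f = 1" unfolding avail_def used_def \<alpha>_def by simp

lemma statistic_bounds:
  assumes "t \<le> n" "F \<in> Stats k"
  shows "0 \<le> F (avail \<psi> t)" "F (avail \<psi> t) \<le> Wc k * L" "\<bar>F (avail \<psi> t) - F (\<lambda>_. 1)\<bar> \<le> Wc k * L"
proof -
  note FP = Stats_pos[OF assms(2)]
  show 1: "0 \<le> F (avail \<psi> t)" by (rule positive_on_nonneg[OF FP]) (rule avail_nonneg[OF assms(1)])
  have "F (avail \<psi> t) \<le> F (\<lambda>f. \<kappa>i ^ (k + 2) * 1)"
    by (rule positive_on_mono[OF FP]) (use avail_le[OF assms(1)] in \<open>simp only: mult_1_right\<close>)
  also have "\<dots> = \<kappa>i ^ (k + 2) * F (\<lambda>_. 1)" by (rule positive_on_scale[OF FP])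
  also have "\<dots> \<le> \<kappa>i ^ (k + 2) * (wt k * L)" using Stats_wt[OF assms(2)] \<kappa>_pos by (intro mult_left_mono) auto
  finally show 2: "F (avail \<psi> t) \<le> Wc k * L" unfolding dev_scale_def by (simp only: mult_ac)
  have "0 \<le> F (\<lambda>_. 1)" by (rule positive_on_nonneg[OF FP]) simp
  moreover have "F (\<lambda>_. 1) \<le> Wc k * L"
  proof -
    have "1 * (wt k * L) \<le> \<kappa>i ^ (k + 2) * (wt k * L)"
      using one_le_inv_\<kappa> weight_bound_pos[OF \<kappa>_pos, of k] by (intro mult_right_mono one_le_power) auto
    then show ?thesis using Stats_wt[OF assms(2)] unfolding dev_scale_def by (simp add: mult_ac)
  qed
  ultimately show "\<bar>F (avail \<psi> t) - F (\<lambda>_. 1)\<bar> \<le> Wc k * L" using 1 2 by linarith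
qed

lemma WcL_pos: "Wc k * L > 0" using Wc_pos L_pos by simp

lemma rel_dev_le_1: "t \<le> n \<Longrightarrow> F \<in> Stats k \<Longrightarrow> rel_dev \<psi> t k F \<le> 1"
  unfolding rel_dev_def using statistic_bounds(3) WcL_pos[of k] by (subst pos_divide_le_eq) auto

lemma rel_dev_le_sigma: "j \<le> k \<Longrightarrow> F \<in> Stats j \<Longrightarrow> rel_dev \<psi> t j F \<le> sigma \<psi> k t"
  unfolding sigma_def by (rule Max_ge) (auto simp: finite_Stats)

lemma deviation_le_sigma: "j \<le> k \<Longrightarrow> F \<in> Stats j \<Longrightarrow> \<bar>F (avail \<psi> t) - F (\<lambda>_. 1)\<bar> \<le> sigma \<psi> k t * Wc j * L"
  using rel_dev_le_sigma[of j k F \<psi> t] WcL_pos[of j] unfolding rel_dev_def by (subst (asm) pos_divide_le_eq) (auto simp: mult_ac)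

lemma sigma_le:
  assumes "n > 0" "\<And>j F. j \<le> k \<Longrightarrow> F \<in> Stats j \<Longrightarrow> rel_dev \<psi> t j F \<le> b"
  shows "sigma \<psi> k t \<le> b"
  unfolding sigma_def
proof (rule Max.boundedI)
  have "base p0 0 (\<lambda>_. 1) \<in> Stats 0" using assms(1) p0_P by auto
  then show "(\<lambda>(j, F). rel_dev \<psi> t j F) ` Sigma {..k} Stats \<noteq> {}" by blast
qed (use assms(2) in \<open>auto simp: finite_Stats\<close>)

lemma sigma_le_1: "n > 0 \<Longrightarrow> t \<le> n \<Longrightarrow> sigma \<psi> k t \<le> 1"
  using sigma_le[of k \<psi> t 1] rel_dev_le_1 by blast

lemma sigma_nonneg: assumes "n > 0" shows "0 \<le> sigma \<psi> k t"
proof -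
  have F: "base p0 0 (\<lambda>_. 1) \<in> Stats 0" using assms(1) p0_P by auto
  have "0 \<le> rel_dev \<psi> t 0 (base p0 0 (\<lambda>_. 1))" unfolding rel_dev_def using WcL_pos[of 0] by simp
  also have "\<dots> \<le> sigma \<psi> k t" using rel_dev_le_sigma[OF _ F] by simp
  finally show ?thesis .
qed

lemma sigma_mono: "n > 0 \<Longrightarrow> k \<le> k' \<Longrightarrow> sigma \<psi> k t \<le> sigma \<psi> k' t"
  using sigma_le[of k \<psi> t "sigma \<psi> k' t"] rel_dev_le_sigma by (meson le_trans)

lemma sigma_at_0: "n > 0 \<Longrightarrow> sigma \<psi> k 0 \<le> 0"
  by (rule sigma_le) (simp_all add: rel_dev_def avail_0[abs_def])

lemma total_dev:
  assumes "s < n" "parent_label \<psi> s \<in> P"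
  shows "\<bar>total \<psi> s - L\<bar> \<le> sigma \<psi> 0 s * Wc 0 * L"
proof -
  have "base (parent_label \<psi> s) s (\<lambda>_. 1) \<in> Stats 0" using assms by auto
  from deviation_le_sigma[OF order_refl this, of \<psi> s] show ?thesis
    using card_J[OF assms(1)] by (simp add: base_def total_def)
qed

lemma mean_linear:
  "mean \<psi> t (\<lambda>y. g y - h y) = mean \<psi> t g - mean \<psi> t h"
  "mean \<psi> t (\<lambda>y. \<Sum>c\<in>C. k c y) = (\<Sum>c\<in>C. mean \<psi> t (k c))"
  unfolding mean_def sum_distrib_left
  by (simp add: sum_subtractf right_diff_distrib) (rule sum.swap)

abbreviation "rate_c \<equiv> rate_const \<kappa>"
abbreviation "total_c \<equiv> total_const \<kappa>"

text \<open>
  Replacing the normaliser \<open>total\<close> by \<open>L\<close> costs a multiple of the deviation at level 0, which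
  is covered by the deviation at level \<open>k + 1\<close>.
\<close>

lemma main_term:
  assumes s: "s < n" "parent_label \<psi> s \<in> P" "total \<psi> s \<ge> L / 2" and F: "F \<in> Stats k" and n: "n > 0"
  shows "\<bar>(1 / L) * (ext False s (parent_label \<psi> s) F (avail \<psi> s) - L / total \<psi> s * ext True s (parent_label \<psi> s) F (avail \<psi> s))\<bar>
     \<le> (2 + 2 * Wc 0) * Wc (Suc k) * sigma \<psi> (Suc k) s"
proof -
  let ?E0 = "ext False s (parent_label \<psi> s) F" and ?E1 = "ext True s (parent_label \<psi> s) F"
  define \<sigma> where "\<sigma> = sigma \<psi> (Suc k) s"
  define b where "b = Wc (Suc k) * L"
  have Lp: "real L > 0" using L_pos by simp
  have Sp: "total \<psi> s > 0" using s Lp by linarith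
  have E: "?E0 \<in> Stats (Suc k)" "?E1 \<in> Stats (Suc k)"
    by (simp_all, rule image_eqI[of _ _ "(False, s, parent_label \<psi> s, F)"], use s F in auto, rule image_eqI[of _ _ "(True, s, parent_label \<psi> s, F)"], use s F in auto)
  have w: "?E0 (\<lambda>_. 1) = ?E1 (\<lambda>_. 1)" by (simp add: ext_def)
  have d0: "\<bar>?E0 (avail \<psi> s) - ?E0 (\<lambda>_. 1)\<bar> \<le> \<sigma> * b" "\<bar>?E1 (avail \<psi> s) - ?E1 (\<lambda>_. 1)\<bar> \<le> \<sigma> * b"
    using deviation_le_sigma[OF order_refl E(1), of \<psi> s] deviation_le_sigma[OF order_refl E(2), of \<psi> s]
    by (simp_all add: \<sigma>_def b_def mult.assoc)
  have e1: "0 \<le> ?E1 (avail \<psi> s)" "?E1 (avail \<psi> s) \<le> b" using statistic_bounds[OF _ E(2), of s \<psi>] s by (auto simp: b_def)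
  have \<sigma>0: "0 \<le> \<sigma>" "sigma \<psi> 0 s \<le> \<sigma>" unfolding \<sigma>_def using sigma_nonneg sigma_mono n by auto
  have "\<bar>1 - L / total \<psi> s\<bar> \<le> 2 * Wc 0 * \<sigma>"
  proof -
    have "1 - L / total \<psi> s = (total \<psi> s - L) / total \<psi> s" using Sp by (simp add: field_simps)
    then have "\<bar>1 - L / total \<psi> s\<bar> = \<bar>total \<psi> s - L\<bar> / total \<psi> s" using Sp by simp
    also have "\<dots> \<le> (sigma \<psi> 0 s * Wc 0 * L) / (L / 2)"
      using total_dev[OF s(1,2)] s(3) Lp by (intro frac_le) auto
    also have "\<dots> = 2 * Wc 0 * sigma \<psi> 0 s" using Lp by simp
    also have "\<dots> \<le> 2 * Wc 0 * \<sigma>" using \<sigma>0 Wc_pos[of 0] by (intro mult_left_mono) auto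
    finally show ?thesis .
  qed
  then have "\<bar>(1 - L / total \<psi> s) * ?E1 (avail \<psi> s)\<bar> \<le> 2 * Wc 0 * \<sigma> * b"
    unfolding abs_mult using e1 \<sigma>0 Wc_pos[of 0] by (intro mult_mono) auto
  moreover have "?E0 (avail \<psi> s) - L / total \<psi> s * ?E1 (avail \<psi> s)
     = (?E0 (avail \<psi> s) - ?E0 (\<lambda>_. 1)) - (?E1 (avail \<psi> s) - ?E1 (\<lambda>_. 1)) + (1 - L / total \<psi> s) * ?E1 (avail \<psi> s)"
    unfolding w by (simp add: algebra_simps)
  ultimately have "\<bar>?E0 (avail \<psi> s) - L / total \<psi> s * ?E1 (avail \<psi> s)\<bar> \<le> \<sigma> * b + \<sigma> * b + 2 * Wc 0 * \<sigma> * b"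
    using d0 by linarith
  then have "(1 / L) * \<bar>?E0 (avail \<psi> s) - L / total \<psi> s * ?E1 (avail \<psi> s)\<bar> \<le> (1 / L) * (\<sigma> * b + \<sigma> * b + 2 * Wc 0 * \<sigma> * b)"
    by (intro mult_left_mono) auto
  also have "\<dots> = (2 + 2 * Wc 0) * Wc (Suc k) * \<sigma>" unfolding b_def using Lp by (simp add: algebra_simps)
  finally show ?thesis unfolding \<sigma>_def by (simp add: abs_mult)
qed

text \<open>
  The increments of \<open>F\<close> are split into martingale differences, the main terms, the second-order
  errors, and the values of \<open>grad\<close>. The latter occur twice: at the step of a child \<open>c\<close>, and, with
  opposite sign and evaluated earlier, at the step of its parent. They cancel up to the gap
  between the two times, except for children whose parent was labelled before \<open>T\<close>, for parents whose child comes
  after \<open>t\<close>, and for jumps; there are at most \<open>\<epsilon> L\<close> of each.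
\<close>

lemma deviation_growth:
  fixes \<epsilon> H :: real
  assumes n: "n > 0" and t: "T \<le> t" "t \<le> n" and F: "F \<in> Stats k"
    and pl: "\<And>s. s < t \<Longrightarrow> parent_label \<psi> s \<in> P" and S: "\<And>s. s < t \<Longrightarrow> total \<psi> s \<ge> L / 2"
    and gap: "\<And>c. c < n \<Longrightarrow> \<not> jump c \<Longrightarrow> c \<le> par c + M" and M: "real M \<le> \<epsilon> * L"
    and jumps: "real (card {c. c < n \<and> jump c}) \<le> \<epsilon> * L"
    and mult: "\<And>p. real (card {s. s < t \<and> parent_label \<psi> s = p}) \<le> \<epsilon> * L"
    and L: "1 \<le> \<epsilon> * L" "4 * real (k + 2) \<le> \<kappa> * L" and nH: "real n \<le> H * L"
    and martingale: "\<bar>martingale \<psi> t F\<bar> \<le> \<epsilon> * L" "\<bar>martingale \<psi> T F\<bar> \<le> \<epsilon> * L"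
  shows "\<bar>F (avail \<psi> t) - F (avail \<psi> T)\<bar> \<le> total_c H k * \<epsilon> * (Wc k * L) + rate_c * real (k + 2) * Wc k * (\<Sum>s\<in>{T..<t}. sigma \<psi> (Suc k) s)"
proof -
  note FP = Stats_pos[OF F]
  have Lp: "real L > 0" using L_pos by simp
  have "0 < \<epsilon> * L" "0 < H * L" using L(1) nH n by linarith+
  then have \<epsilon>: "\<epsilon> > 0" and H0: "H > 0" using Lp by (simp_all add: zero_less_mult_iff)
  have wt0: "wt k > 0" by (rule weight_bound_pos[OF \<kappa>_pos])
  define g where "g = (\<lambda>s c. F (grad \<psi> s c (\<psi> s)))"
  define g0 where "g0 = (\<lambda>s. F (grad \<psi> s s (parent_label \<psi> s)))"
  define av where "av = (\<lambda>s c. mean \<psi> s (\<lambda>z. F (grad \<psi> s c z)))"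
  define mn where "mn = (\<lambda>s. (1 / L) * (ext False s (parent_label \<psi> s) F (avail \<psi> s) - L / total \<psi> s * ext True s (parent_label \<psi> s) F (avail \<psi> s)))"
  define er where "er = (\<lambda>s. mean \<psi> s (\<lambda>y. F (avail (\<psi>(s := y)) (Suc s))) - F (avail \<psi> s) - (mn s - g0 s))"
  define A where "A = {T..<t}"
  define C where "C = Sigma A near_children"
  have finA: "finite A" and finC: "finite C" unfolding A_def C_def by auto
  have sn: "s < n" "s < t" if "s \<in> A" for s using that t by (auto simp: A_def)
  have decomp: "F (avail \<psi> t) - F (avail \<psi> T) = (martingale \<psi> t F - martingale \<psi> T F) + (\<Sum>s\<in>A. mn s) + (\<Sum>s\<in>A. er s)
      - (\<Sum>(s, c)\<in>C. av s c) + ((\<Sum>(s, c)\<in>C. g s c) - (\<Sum>s\<in>A. g0 s))"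
  proof -
    have "F (avail \<psi> t) - F (avail \<psi> T) = (\<Sum>s\<in>A. F (avail \<psi> (Suc s)) - F (avail \<psi> s))"
      unfolding A_def by (rule sum_Suc_diff'[OF t(1), of "\<lambda>s. F (avail \<psi> s)", symmetric])
    also have "\<dots> = (\<Sum>s\<in>A. (compensated \<psi> s F (\<psi> s) - mean \<psi> s (compensated \<psi> s F)) + mn s + er s - (\<Sum>c\<in>near_children s. av s c) + (\<Sum>c\<in>near_children s. g s c) - g0 s)"
    proof (rule sum.cong[OF refl])
      fix s
      have "compensated \<psi> s F (\<psi> s) = F (avail \<psi> (Suc s)) - (\<Sum>c\<in>near_children s. g s c)" unfolding compensated_def g_def by simp
      moreover have "mean \<psi> s (compensated \<psi> s F) = mean \<psi> s (\<lambda>y. F (avail (\<psi>(s := y)) (Suc s))) - (\<Sum>c\<in>near_children s. av s c)"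
        unfolding compensated_def[abs_def] mean_linear av_def ..
      ultimately show "F (avail \<psi> (Suc s)) - F (avail \<psi> s) = (compensated \<psi> s F (\<psi> s) - mean \<psi> s (compensated \<psi> s F)) + mn s + er s - (\<Sum>c\<in>near_children s. av s c) + (\<Sum>c\<in>near_children s. g s c) - g0 s"
        unfolding er_def by simp
    qed
    also have "\<dots> = (\<Sum>s\<in>A. compensated \<psi> s F (\<psi> s) - mean \<psi> s (compensated \<psi> s F)) + (\<Sum>s\<in>A. mn s) + (\<Sum>s\<in>A. er s)
      - (\<Sum>s\<in>A. \<Sum>c\<in>near_children s. av s c) + ((\<Sum>s\<in>A. \<Sum>c\<in>near_children s. g s c) - (\<Sum>s\<in>A. g0 s))"
      by (simp add: sum.distrib sum_subtractf)
    also have "(\<Sum>s\<in>A. compensated \<psi> s F (\<psi> s) - mean \<psi> s (compensated \<psi> s F)) = martingale \<psi> t F - martingale \<psi> T F"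
    proof -
      have "{..<t} = {..<T} \<union> A" "{..<T} \<inter> A = {}" unfolding A_def using t(1) by auto
      then show ?thesis unfolding martingale_def using finA by (simp add: sum.union_disjoint)
    qed
    also have "(\<Sum>s\<in>A. \<Sum>c\<in>near_children s. av s c) = (\<Sum>(s, c)\<in>C. av s c)" unfolding C_def using finA by (intro sum.Sigma) auto
    also have "(\<Sum>s\<in>A. \<Sum>c\<in>near_children s. g s c) = (\<Sum>(s, c)\<in>C. g s c)" unfolding C_def using finA by (intro sum.Sigma) auto
    finally show ?thesis .
  qed
  have b1: "\<bar>martingale \<psi> t F - martingale \<psi> T F\<bar> \<le> 2 * (\<epsilon> * L)" using martingale by linarith
  have b2: "\<bar>\<Sum>s\<in>A. mn s\<bar> \<le> (2 + 2 * Wc 0) * Wc (Suc k) * (\<Sum>s\<in>A. sigma \<psi> (Suc k) s)"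
    unfolding sum_distrib_left mn_def using main_term[OF _ _ _ F n] sn pl S
    by (intro order.trans[OF sum_abs] sum_mono) auto
  have b3: "\<bar>\<Sum>s\<in>A. er s\<bar> \<le> (H * err_c k + 8 * \<kappa>i ^ (k + 4) * real (k + 2) ^ 2 * wt k) * (\<epsilon> * L)"
  proof -
    have nn: "0 \<le> F (double_hits p)" for p by (rule positive_on_nonneg[OF FP]) (simp add: double_hits_def)
    have e0: "0 \<le> err_c k" unfolding err_const_def using wt0 \<kappa>_pos by simp
    have "\<bar>\<Sum>s\<in>A. er s\<bar> \<le> (\<Sum>s\<in>A. err_c k / L + 4 * \<kappa>i ^ (k + 4) / L * F (double_hits (parent_label \<psi> s)))"
      unfolding er_def mn_def g0_def using expected_change[OF _ F L(2)] S sn by (intro order.trans[OF sum_abs] sum_mono) auto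
    also have "\<dots> \<le> (\<Sum>s<t. err_c k / L + 4 * \<kappa>i ^ (k + 4) / L * F (double_hits (parent_label \<psi> s)))"
      using nn e0 \<kappa>_pos unfolding A_def by (intro sum_mono2) (auto intro!: add_nonneg_nonneg)
    also have "\<dots> = real t * (err_c k / L) + 4 * \<kappa>i ^ (k + 4) / L * (\<Sum>s<t. F (double_hits (parent_label \<psi> s)))"
      by (simp add: sum.distrib sum_distrib_left)
    also have "\<dots> \<le> H * L * (err_c k / L) + 4 * \<kappa>i ^ (k + 4) / L * ((\<epsilon> * L) * (2 * real (k + 2) ^ 2 * wt k * L))"
      using sum_double_hits_steps[OF F pl mult] \<kappa>_pos e0 nH t(2) by (intro add_mono mult_left_mono mult_right_mono) auto
    also have "\<dots> = H * err_c k * 1 + 8 * \<kappa>i ^ (k + 4) * real (k + 2) ^ 2 * wt k * (\<epsilon> * L)" using Lp by simp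
    also have "\<dots> \<le> H * err_c k * (\<epsilon> * L) + 8 * \<kappa>i ^ (k + 4) * real (k + 2) ^ 2 * wt k * (\<epsilon> * L)"
      using L(1) H0 e0 wt0 \<kappa>_pos \<epsilon> by (intro add_mono mult_left_mono) (auto simp: less_imp_le)
    finally show ?thesis by (simp only: distrib_right)
  qed
  have parc: "par c < c" if "c < n" "\<not> jump c" for c using par_less[of c] nonjump_pos that by auto
  define C1 where "C1 = {c \<in> A. \<not> jump c \<and> T \<le> par c}"
  (* C1: parent and child both labelled between T and t; D: only the parent. *)
  define D where "D = {c. c < n \<and> \<not> jump c \<and> T \<le> par c \<and> par c < t \<and> t \<le> c}"
  have finD: "finite D" "finite C1" unfolding D_def C1_def using finA by auto
  have cardD: "real (card D) \<le> \<epsilon> * L"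
  proof -
    have "D \<subseteq> {t..<t + M}" unfolding D_def using gap by fastforce
    then have "card D \<le> card {t..<t + M}" by (intro card_mono) auto
    then show ?thesis using M by simp
  qed
  have reindex: "(\<Sum>(s, c)\<in>C. h s c) = (\<Sum>c\<in>C1. h (par c) c) + (\<Sum>c\<in>D. h (par c) c)" for h :: "nat \<Rightarrow> nat \<Rightarrow> real"
  proof -
    have "(\<Sum>(s, c)\<in>C. h s c) = (\<Sum>c\<in>C1 \<union> D. h (par c) c)"
    proof (rule sum.reindex_bij_witness[of _ "\<lambda>c. (par c, c)" snd])
      fix c assume c: "c \<in> C1 \<union> D"
      then have "c < n" "\<not> jump c" using sn by (auto simp: C1_def D_def)
      then have "par c < c" by (rule parc)
      then show "(par c, c) \<in> C" using c \<open>c < n\<close> by (auto simp: C_def near_children_def C1_def D_def A_def)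
    next
      fix a assume a: "a \<in> C"
      then have "snd a < n" "\<not> jump (snd a)" "par (snd a) = fst a" "T \<le> fst a" "fst a < t"
        by (auto simp: C_def near_children_def A_def)
      then show "snd a \<in> C1 \<union> D" using parc[of "snd a"] by (auto simp: C1_def D_def A_def)
    qed (auto simp: C_def near_children_def)
    also have "\<dots> = (\<Sum>c\<in>C1. h (par c) c) + (\<Sum>c\<in>D. h (par c) c)"
      by (rule sum.union_disjoint) (use finD in \<open>auto simp: C1_def D_def A_def\<close>)
    finally show ?thesis .
  qed
  have C1D: "c < n \<and> \<not> jump c \<and> par c < t \<and> c \<le> par c + M" if "c \<in> C1 \<union> D" for c
    using that sn parc gap by (fastforce simp: C1_def D_def)
  define ac where "ac = 6 * real (k + 2) * \<kappa>i * Wc k"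
  have ac0: "ac \<ge> 0" unfolding ac_def using Wc_pos[of k] \<kappa>_pos by simp
  have avb: "\<bar>av (par c) c\<bar> \<le> ac * (Wc 0 * sigma \<psi> 0 (par c))" if c: "c \<in> C1 \<union> D" for c
  proof -
    have c': "c < n" "\<not> jump c" "par c < t" "par c < n" using C1D[OF c] parc t by auto
    have "\<bar>av (par c) c\<bar> \<le> 6 * real (k + 2) * \<kappa>i ^ (k + 3) * wt k * (sigma \<psi> 0 (par c) * Wc 0)"
      unfolding av_def
      by (rule mean_grad[OF c'(4) c'(1,2) refl S[OF c'(3)] F pl[OF c'(3)] deviation_le_sigma[OF order_refl]])
    also have "\<dots> = ac * (Wc 0 * sigma \<psi> 0 (par c))" unfolding ac_def dev_scale_def[of \<kappa> k] by (simp add: power_add eval_nat_numeral)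
    finally show ?thesis .
  qed
  have sig_lip: "Wc 0 * sigma \<psi> 0 (par c) \<le> Wc 0 * sigma \<psi> 0 c + step_c 0 * \<epsilon>" if c: "c \<in> C1" for c
  proof -
    have c': "c < n" "par c \<le> c" "c \<le> par c + M" using C1D[of c] parc c by (auto simp: less_imp_le)
    have "sigma \<psi> 0 (par c) \<le> sigma \<psi> 0 c + step_c 0 * \<epsilon> / Wc 0"
    proof (rule sigma_le[OF n])
      fix j F0 assume "j \<le> (0::nat)" "F0 \<in> Stats j"
      then have F0: "F0 \<in> Stats 0" "j = 0" by auto
      have "4 * real (0 + 2) \<le> \<kappa> * L" using L(2) by simp
      then have "\<bar>F0 (avail \<psi> c) - F0 (avail \<psi> (par c))\<bar> \<le> step_c 0 * real (c - par c)"
        using avail_lipschitz[OF F0(1)] c' by (simp add: less_imp_le)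
      also have "\<dots> \<le> step_c 0 * (\<epsilon> * L)"
      proof (rule mult_left_mono)
        have "real (c - par c) \<le> real M" using c' by simp
        then show "real (c - par c) \<le> \<epsilon> * L" using M by linarith
      qed (rule consts_nonneg)
      finally have "\<bar>F0 (avail \<psi> (par c)) - F0 (\<lambda>_. 1)\<bar> \<le> sigma \<psi> 0 c * Wc 0 * L + step_c 0 * (\<epsilon> * L)"
        using deviation_le_sigma[OF order_refl F0(1), of \<psi> c] by linarith
      also have "\<dots> = (sigma \<psi> 0 c + step_c 0 * \<epsilon> / Wc 0) * (Wc 0 * L)" using Wc_pos[of 0] by (simp add: field_simps)
      finally show "rel_dev \<psi> (par c) j F0 \<le> sigma \<psi> 0 c + step_c 0 * \<epsilon> / Wc 0"
        unfolding rel_dev_def F0(2) using WcL_pos[of 0] by (subst pos_divide_le_eq) auto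
    qed
    then have "Wc 0 * sigma \<psi> 0 (par c) \<le> Wc 0 * (sigma \<psi> 0 c + step_c 0 * \<epsilon> / Wc 0)"
      using Wc_pos[of 0] by (intro mult_left_mono) auto
    then show ?thesis using Wc_pos[of 0] by (simp add: distrib_left)
  qed
  have cardC1: "real (card C1) \<le> H * L"
  proof -
    have "card C1 \<le> card A" unfolding C1_def by (rule card_mono[OF finA]) auto
    then have "card C1 \<le> n" using t by (simp add: A_def)
    then show ?thesis using nH by linarith
  qed
  have b4: "\<bar>\<Sum>(s, c)\<in>C. av s c\<bar> \<le> ac * Wc 0 * (\<Sum>s\<in>A. sigma \<psi> (Suc k) s) + ac * (H * step_c 0 + Wc 0) * (\<epsilon> * L)"
  proof -
    have "\<bar>\<Sum>c\<in>C1. av (par c) c\<bar> \<le> (\<Sum>c\<in>C1. ac * (Wc 0 * sigma \<psi> 0 c) + ac * (step_c 0 * \<epsilon>))"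
    proof (intro order.trans[OF sum_abs] sum_mono)
      fix c assume c: "c \<in> C1"
      have "\<bar>av (par c) c\<bar> \<le> ac * (Wc 0 * sigma \<psi> 0 (par c))" using avb c by simp
      also have "\<dots> \<le> ac * (Wc 0 * sigma \<psi> 0 c + step_c 0 * \<epsilon>)" using sig_lip[OF c] ac0 by (rule mult_left_mono)
      finally show "\<bar>av (par c) c\<bar> \<le> ac * (Wc 0 * sigma \<psi> 0 c) + ac * (step_c 0 * \<epsilon>)" by (simp add: distrib_left)
    qed
    also have "\<dots> = ac * Wc 0 * (\<Sum>c\<in>C1. sigma \<psi> 0 c) + real (card C1) * (ac * (step_c 0 * \<epsilon>))"
      by (simp add: sum.distrib sum_distrib_left mult.assoc)
    also have "\<dots> \<le> ac * Wc 0 * (\<Sum>s\<in>A. sigma \<psi> (Suc k) s) + H * L * (ac * (step_c 0 * \<epsilon>))"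
    proof (intro add_mono mult_left_mono mult_right_mono cardC1)
      have "(\<Sum>c\<in>C1. sigma \<psi> 0 c) \<le> (\<Sum>c\<in>A. sigma \<psi> 0 c)"
        using finA sigma_nonneg[OF n] by (intro sum_mono2) (auto simp: C1_def)
      also have "\<dots> \<le> (\<Sum>s\<in>A. sigma \<psi> (Suc k) s)" using sigma_mono[OF n] by (intro sum_mono) auto
      finally show "(\<Sum>c\<in>C1. sigma \<psi> 0 c) \<le> (\<Sum>s\<in>A. sigma \<psi> (Suc k) s)" .
    qed (use ac0 Wc_pos[of 0] consts_nonneg(1)[of 0] \<epsilon> in auto)
    finally have c1: "\<bar>\<Sum>c\<in>C1. av (par c) c\<bar> \<le> ac * Wc 0 * (\<Sum>s\<in>A. sigma \<psi> (Suc k) s) + H * L * (ac * (step_c 0 * \<epsilon>))" .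
    have "\<bar>\<Sum>c\<in>D. av (par c) c\<bar> \<le> (\<Sum>c\<in>D. ac * Wc 0)"
    proof (intro order.trans[OF sum_abs] sum_mono)
      fix c assume c: "c \<in> D"
      have "sigma \<psi> 0 (par c) \<le> 1" using C1D[of c] c t by (intro sigma_le_1[OF n]) auto
      then have "ac * (Wc 0 * sigma \<psi> 0 (par c)) \<le> ac * (Wc 0 * 1)" using ac0 Wc_pos[of 0] by (intro mult_left_mono) auto
      then show "\<bar>av (par c) c\<bar> \<le> ac * Wc 0" using avb[of c] c by simp
    qed
    also have "\<dots> = real (card D) * (ac * Wc 0)" by simp
    also have "\<dots> \<le> \<epsilon> * L * (ac * Wc 0)" using cardD ac0 Wc_pos[of 0] by (intro mult_right_mono) auto
    finally have "\<bar>\<Sum>c\<in>D. av (par c) c\<bar> \<le> \<epsilon> * L * (ac * Wc 0)" .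
    then have "\<bar>\<Sum>(s, c)\<in>C. av s c\<bar> \<le> ac * Wc 0 * (\<Sum>s\<in>A. sigma \<psi> (Suc k) s) + (H * L * (ac * (step_c 0 * \<epsilon>)) + \<epsilon> * L * (ac * Wc 0))"
      unfolding reindex using c1 by linarith
    also have "H * L * (ac * (step_c 0 * \<epsilon>)) + \<epsilon> * L * (ac * Wc 0) = ac * (H * step_c 0 + Wc 0) * (\<epsilon> * L)" by (simp add: algebra_simps)
    finally show ?thesis .
  qed
  have b5: "\<bar>(\<Sum>(s, c)\<in>C. g s c) - (\<Sum>s\<in>A. g0 s)\<bar> \<le> (H * gap_c k + 3 * grad_c k) * (\<epsilon> * L)"
  proof -
    have "A = C1 \<union> (A - C1)" "C1 \<inter> (A - C1) = {}" unfolding C1_def by auto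
    then have "(\<Sum>s\<in>A. g0 s) = (\<Sum>s\<in>C1. g0 s) + (\<Sum>s\<in>A - C1. g0 s)"
      using finA by (metis finite_Un sum.union_disjoint)
    then have eq: "(\<Sum>(s, c)\<in>C. g s c) - (\<Sum>s\<in>A. g0 s) = (\<Sum>c\<in>C1. g (par c) c - g0 c) + (\<Sum>c\<in>D. g (par c) c) - (\<Sum>s\<in>A - C1. g0 s)"
      unfolding reindex by (simp add: sum_subtractf)
    have "\<bar>\<Sum>c\<in>C1. g (par c) c - g0 c\<bar> \<le> (\<Sum>c\<in>C1. gap_c k * \<epsilon>)"
    proof (intro order.trans[OF sum_abs] sum_mono)
      fix c assume c: "c \<in> C1"
      then have c': "c < n" "\<not> jump c" "par c < c" "c \<le> par c + M" using C1D[of c] parc by auto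
      have "parent_label \<psi> c = \<psi> (par c)" using c' by (simp add: parent_label_def)
      then have "\<bar>g (par c) c - g0 c\<bar> = \<bar>F (grad \<psi> c c (parent_label \<psi> c)) - F (grad \<psi> (par c) c (parent_label \<psi> c))\<bar>"
        unfolding g_def g0_def by (simp add: abs_minus_commute)
      also have "\<dots> \<le> gap_c k / L * real (c - par c)" using grad_lipschitz[OF F L(2) c'(1), of "par c" c] c' by simp
      also have "\<dots> \<le> gap_c k / L * (\<epsilon> * L)"
      proof (rule mult_left_mono)
        have "real (c - par c) \<le> real M" using c' by simp
        then show "real (c - par c) \<le> \<epsilon> * L" using M by linarith
      qed (use consts_nonneg in simp)
      finally show "\<bar>g (par c) c - g0 c\<bar> \<le> gap_c k * \<epsilon>" using Lp by simp
    qed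
    also have "\<dots> = real (card C1) * (gap_c k * \<epsilon>)" by simp
    also have "\<dots> \<le> H * L * (gap_c k * \<epsilon>)" using cardC1 consts_nonneg(3)[of k] \<epsilon> by (intro mult_right_mono) auto
    finally have d1: "\<bar>\<Sum>c\<in>C1. g (par c) c - g0 c\<bar> \<le> H * gap_c k * (\<epsilon> * L)" by (simp only: mult_ac)
    have "\<bar>\<Sum>c\<in>D. g (par c) c\<bar> \<le> (\<Sum>c\<in>D. grad_c k)"
      unfolding g_def using C1D t by (intro order.trans[OF sum_abs] sum_mono grad_bound[OF _ _ F]) force+
    also have "\<dots> = real (card D) * grad_c k" by simp
    also have "\<dots> \<le> \<epsilon> * L * grad_c k" using cardD consts_nonneg(2)[of k] by (intro mult_right_mono) auto
    finally have d2: "\<bar>\<Sum>c\<in>D. g (par c) c\<bar> \<le> \<epsilon> * L * grad_c k" .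
    have "\<bar>\<Sum>s\<in>A - C1. g0 s\<bar> \<le> (\<Sum>s\<in>A - C1. grad_c k)"
      unfolding g0_def using sn by (intro order.trans[OF sum_abs] sum_mono grad_bound[OF _ _ F]) (force simp: less_imp_le)+
    also have "\<dots> = real (card (A - C1)) * grad_c k" by simp
    also have "\<dots> \<le> 2 * (\<epsilon> * L) * grad_c k"
    proof (rule mult_right_mono)
      have "A - C1 \<subseteq> {c. c < n \<and> jump c} \<union> {T..<T + M}"
        using sn gap by (fastforce simp: C1_def A_def)
      then have "card (A - C1) \<le> card ({c. c < n \<and> jump c} \<union> {T..<T + M})" by (intro card_mono) auto
      also have "\<dots> \<le> card {c. c < n \<and> jump c} + card {T..<T + M}" by (rule card_Un_le)
      finally show "real (card (A - C1)) \<le> 2 * (\<epsilon> * L)" using jumps M by simp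
    qed (rule consts_nonneg)
    finally have d3: "\<bar>\<Sum>s\<in>A - C1. g0 s\<bar> \<le> 2 * (\<epsilon> * L) * grad_c k" .
    have "\<bar>(\<Sum>(s, c)\<in>C. g s c) - (\<Sum>s\<in>A. g0 s)\<bar> \<le> H * gap_c k * (\<epsilon> * L) + \<epsilon> * L * grad_c k + 2 * (\<epsilon> * L) * grad_c k"
      unfolding eq using d1 d2 d3 by linarith
    also have "\<dots> = (H * gap_c k + 3 * grad_c k) * (\<epsilon> * L)" by (simp add: algebra_simps)
    finally show ?thesis .
  qed
  define \<Sigma> where "\<Sigma> = (\<Sum>s\<in>A. sigma \<psi> (Suc k) s)"
  have rate: "(2 + 2 * Wc 0) * Wc (Suc k) + ac * Wc 0 = rate_c * real (k + 2) * Wc k"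
    unfolding rate_const_def ac_def Wc_Suc by (simp add: algebra_simps add_divide_distrib)
  have tot: "2 * (\<epsilon> * L) + (H * err_c k + 8 * \<kappa>i ^ (k + 4) * real (k + 2) ^ 2 * wt k) * (\<epsilon> * L)
      + ac * (H * step_c 0 + Wc 0) * (\<epsilon> * L) + (H * gap_c k + 3 * grad_c k) * (\<epsilon> * L) = total_c H k * \<epsilon> * (Wc k * L)"
  proof -
    have "total_c H k * Wc k = 2 + H * err_c k + 8 * \<kappa>i ^ (k + 4) * real (k + 2) ^ 2 * wt k + H * gap_c k + 3 * grad_c k + ac * (H * step_c 0 + Wc 0)"
      unfolding total_const_def ac_def using Wc_pos[of k] by simp
    then have "total_c H k * \<epsilon> * (Wc k * L) = (2 + H * err_c k + 8 * \<kappa>i ^ (k + 4) * real (k + 2) ^ 2 * wt k + H * gap_c k + 3 * grad_c k + ac * (H * step_c 0 + Wc 0)) * (\<epsilon> * L)"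
    proof -
      assume e: "total_c H k * Wc k = 2 + H * err_c k + 8 * \<kappa>i ^ (k + 4) * real (k + 2) ^ 2 * wt k + H * gap_c k + 3 * grad_c k + ac * (H * step_c 0 + Wc 0)"
      have "total_c H k * \<epsilon> * (Wc k * L) = (total_c H k * Wc k) * (\<epsilon> * L)" by (simp only: mult_ac)
      then show ?thesis unfolding e .
    qed
    then show ?thesis by (simp only: distrib_right add_ac)
  qed
  have "\<bar>F (avail \<psi> t) - F (avail \<psi> T)\<bar> \<le> 2 * (\<epsilon> * L) + (2 + 2 * Wc 0) * Wc (Suc k) * \<Sigma>
      + (H * err_c k + 8 * \<kappa>i ^ (k + 4) * real (k + 2) ^ 2 * wt k) * (\<epsilon> * L)
      + (ac * Wc 0 * \<Sigma> + ac * (H * step_c 0 + Wc 0) * (\<epsilon> * L)) + (H * gap_c k + 3 * grad_c k) * (\<epsilon> * L)"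
    unfolding decomp using b1 b2[folded \<Sigma>_def] b3 b4[folded \<Sigma>_def] b5 by linarith
  also have "\<dots> = total_c H k * \<epsilon> * (Wc k * L) + ((2 + 2 * Wc 0) * Wc (Suc k) + ac * Wc 0) * \<Sigma>"
    unfolding tot[symmetric] by (simp only: distrib_right add_ac)
  finally show ?thesis unfolding rate \<Sigma>_def A_def .
qed

end

section \<open>Derandomised choice\<close>

lemma exp_le_quadratic:
  fixes z :: real
  assumes "\<bar>z\<bar> \<le> 1"
  shows "exp z \<le> 1 + z + z\<^sup>2"
proof (cases "z \<ge> 0")
  case True
  then show ?thesis using exp_bound[of z] assms by simp
next
  case False
  define y where "y = - z"
  have y: "0 \<le> y" "y \<le> 1" using False assms by (auto simp: y_def)
  have "1 \<le> (1 - y + y\<^sup>2) * (1 + y + y\<^sup>2 / 2)"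
  proof -
    have "(1 - y + y\<^sup>2) * (1 + y + y\<^sup>2 / 2) = 1 + y\<^sup>2 / 2 * (1 + y + y\<^sup>2)"
      by (simp add: field_simps power2_eq_square)
    then show ?thesis using y by simp
  qed
  also have "\<dots> \<le> (1 - y + y\<^sup>2) * exp y"
    using exp_lower_Taylor_quadratic[OF y(1)] y by (intro mult_left_mono) auto
  finally have "1 / exp y \<le> 1 - y + y\<^sup>2" by (simp add: divide_le_eq)
  then show ?thesis by (simp add: y_def exp_minus inverse_eq_divide)
qed

lemma exp_moment_bound:
  fixes p z :: "'a \<Rightarrow> real"
  assumes "\<And>a. a \<in> A \<Longrightarrow> 0 \<le> p a" "(\<Sum>a\<in>A. p a) = 1" "(\<Sum>a\<in>A. p a * z a) = 0"
    "\<And>a. a \<in> A \<Longrightarrow> \<bar>z a\<bar> \<le> b" "b \<le> 1"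
  shows "(\<Sum>a\<in>A. p a * exp (z a)) \<le> 1 + b\<^sup>2"
proof -
  have "(\<Sum>a\<in>A. p a * exp (z a)) \<le> (\<Sum>a\<in>A. p a + p a * z a + p a * b\<^sup>2)"
  proof (rule sum_mono)
    fix a assume a: "a \<in> A"
    have "exp (z a) \<le> 1 + z a + (z a)\<^sup>2" using assms(4)[OF a] assms(5) by (intro exp_le_quadratic) linarith
    also have "(z a)\<^sup>2 \<le> b\<^sup>2" using power_mono[OF assms(4)[OF a], of 2] by simp
    finally have "p a * exp (z a) \<le> p a * (1 + z a + b\<^sup>2)" using assms(1)[OF a] by (intro mult_left_mono) auto
    then show "p a * exp (z a) \<le> p a + p a * z a + p a * b\<^sup>2" by (simp add: algebra_simps)
  qed
  also have "\<dots> = 1 + b\<^sup>2" by (simp add: sum.distrib assms sum_distrib_right[symmetric])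
  finally show ?thesis .
qed

lemma exists_at_most_average:
  fixes p v :: "'a \<Rightarrow> real"
  assumes "finite A" "\<And>a. a \<in> A \<Longrightarrow> 0 \<le> p a" "(\<Sum>a\<in>A. p a) = 1" "(\<Sum>a\<in>A. p a * v a) \<le> b"
  shows "\<exists>a\<in>A. 0 < p a \<and> v a \<le> b"
proof (rule ccontr)
  assume "\<not> ?thesis"
  then have gt: "\<And>a. a \<in> A \<Longrightarrow> 0 < p a \<Longrightarrow> b < v a" by force
  have "\<exists>a\<in>A. p a \<noteq> 0" using assms(3) by (metis sum.neutral zero_neq_one)
  then obtain a where a: "a \<in> A" "0 < p a" using assms(2) by (metis order_le_less)
  have "(\<Sum>a\<in>A. p a * b) < (\<Sum>a\<in>A. p a * v a)"
  proof (rule sum_strict_mono_ex1[OF assms(1)])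
    show "\<forall>a\<in>A. p a * b \<le> p a * v a"
      using gt assms(2) by (metis less_eq_real_def mult_left_mono mult_zero_left)
    show "\<exists>a\<in>A. p a * b < p a * v a" using a gt by (intro bexI[of _ a]) auto
  qed
  then show False using assms(3,4) by (simp add: sum_distrib_right[symmetric])
qed

definition inc_const :: "real \<Rightarrow> nat \<Rightarrow> real" where
  "inc_const \<kappa> K = 2 * (\<Sum>j\<le>K. step_const \<kappa> j + grad_const \<kappa> j)"

context greedy begin

lemma compensated_cong: "r < n \<Longrightarrow> (\<And>s. s < r \<Longrightarrow> \<psi> s = \<psi>' s) \<Longrightarrow> compensated \<psi> r F = compensated \<psi>' r F"
proof
  fix y assume r: "r < n" "\<And>s. s < r \<Longrightarrow> \<psi> s = \<psi>' s"
  have "avail (\<psi>(r := y)) (Suc r) = avail (\<psi>'(r := y)) (Suc r)" using r by (intro avail_cong) auto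
  moreover have "avail \<psi> r = avail \<psi>' r" using r by (intro avail_cong) auto
  then have "grad \<psi> r c z = grad \<psi>' r c z" for c z unfolding grad_def by (intro ext) simp
  ultimately show "compensated \<psi> r F y = compensated \<psi>' r F y" unfolding compensated_def by simp
qed

lemma martingale_cong: "t \<le> n \<Longrightarrow> (\<And>s. s < t \<Longrightarrow> \<psi> s = \<psi>' s) \<Longrightarrow> martingale \<psi> t F = martingale \<psi>' t F"
proof -
  assume a: "t \<le> n" "\<And>s. s < t \<Longrightarrow> \<psi> s = \<psi>' s"
  have "compensated \<psi> s F = compensated \<psi>' s F" "mean \<psi> s = mean \<psi>' s" "\<psi> s = \<psi>' s" if "s < t" for s
    using a that by (auto intro!: compensated_cong mean_cong)
  then show ?thesis unfolding martingale_def by (intro sum.cong) auto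
qed

definition Stats_upto :: "nat \<Rightarrow> functional set" where "Stats_upto K = (\<Union>j\<le>K. Stats j)"

lemma finite_Stats_upto: "finite (Stats_upto K)" unfolding Stats_upto_def by (auto simp: finite_Stats)

text \<open>
  The exponential moments used in the proof of a Chernoff bound, for all statistics and both signs.
\<close>

definition potential :: "nat \<Rightarrow> real \<Rightarrow> (nat \<Rightarrow> int) \<Rightarrow> nat \<Rightarrow> real" where
  "potential K \<theta> \<psi> t = (\<Sum>F\<in>Stats_upto K. exp (\<theta> * martingale \<psi> t F) + exp (- \<theta> * martingale \<psi> t F))"

abbreviation "inc_c \<equiv> inc_const \<kappa>"

lemma inc_c_nonneg: "0 \<le> inc_c K" unfolding inc_const_def using consts_nonneg by (auto intro!: sum_nonneg add_nonneg_nonneg)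

text \<open>
  The errors of all children of \<open>s\<close> are charged to the single step \<open>s\<close>, whence the dependence
  on their number.
\<close>

lemma increment_bound:
  assumes s: "s < n" and F: "F \<in> Stats_upto K" and NL: "4 * real (K + 2) \<le> \<kappa> * L" and S: "total \<psi> s \<ge> L / 2"
  shows "\<bar>compensated \<psi> s F y - mean \<psi> s (compensated \<psi> s F)\<bar> \<le> inc_c K * (1 + real (card (near_children s)))"
proof -
  obtain j where j: "j \<le> K" "F \<in> Stats j" using F by (auto simp: Stats_upto_def)
  have NL': "4 * real (j + 2) \<le> \<kappa> * L" using NL j by simp
  note FP = Stats_pos[OF j(2)]
  define b where "b = (step_c j + grad_c j) * (1 + real (card (near_children s)))"
  have Zb: "\<bar>compensated \<psi> s F y - F (avail \<psi> s)\<bar> \<le> b" for y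
  proof -
    have "\<bar>F (avail (\<psi>(s := y)) (Suc s)) - F (avail \<psi> s)\<bar> \<le> step_c j"
      using order.trans[OF positive_on_abs_le[OF FP] step_change_upd[OF s j(2) NL'], of "\<lambda>f. avail (\<psi>(s := y)) (Suc s) f - avail \<psi> s f" \<psi> y]
      by (simp add: positive_on_diff[OF FP])
    moreover have "\<bar>\<Sum>c\<in>near_children s. F (grad \<psi> s c y)\<bar> \<le> (\<Sum>c\<in>near_children s. grad_c j)"
      using grad_bound[OF _ _ j(2)] s by (intro order.trans[OF sum_abs] sum_mono) (auto simp: near_children_def)
    moreover have "step_c j + (\<Sum>c\<in>near_children s. grad_c j) \<le> b"
    proof -
      have "step_c j * 1 \<le> step_c j * (1 + real (card (near_children s)))" using consts_nonneg by (intro mult_left_mono) auto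
      moreover have "real (card (near_children s)) * grad_c j \<le> (1 + real (card (near_children s))) * grad_c j" using consts_nonneg by (intro mult_right_mono) auto
      ultimately show ?thesis unfolding b_def by (simp add: algebra_simps)
    qed
    ultimately show ?thesis unfolding compensated_def by linarith
  qed
  have "\<bar>mean \<psi> s (compensated \<psi> s F) - F (avail \<psi> s)\<bar> \<le> b"
  proof -
    have "mean \<psi> s (compensated \<psi> s F) - F (avail \<psi> s) = (\<Sum>y\<in>J s. prob \<psi> s y * (compensated \<psi> s F y - F (avail \<psi> s)))"
      unfolding mean_def using prob_bounds(3)[OF s S] by (simp add: right_diff_distrib sum_subtractf sum_distrib_right[symmetric])
    moreover have "\<bar>\<Sum>y\<in>J s. prob \<psi> s y * (compensated \<psi> s F y - F (avail \<psi> s))\<bar> \<le> (\<Sum>y\<in>J s. prob \<psi> s y * b)"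
    proof (intro order.trans[OF sum_abs] sum_mono)
      fix y
      show "\<bar>prob \<psi> s y * (compensated \<psi> s F y - F (avail \<psi> s))\<bar> \<le> prob \<psi> s y * b"
        unfolding abs_mult using Zb[of y] prob_bounds(1)[OF s S, of y] by (intro mult_mono) auto
    qed
    moreover have "(\<Sum>y\<in>J s. prob \<psi> s y * b) = b"
      using prob_bounds(3)[OF s S] by (metis mult_1 sum_distrib_right)
    ultimately show ?thesis by simp
  qed
  then have "\<bar>compensated \<psi> s F y - mean \<psi> s (compensated \<psi> s F)\<bar> \<le> 2 * b" using Zb[of y] by linarith
  also have "2 * b \<le> inc_c K * (1 + real (card (near_children s)))"
  proof -
    have "step_c j + grad_c j \<le> (\<Sum>j\<le>K. step_c j + grad_c j)"
      using j(1) consts_nonneg by (intro member_le_sum) auto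
    then have "(step_c j + grad_c j) * (1 + real (card (near_children s))) \<le> (\<Sum>j\<le>K. step_c j + grad_c j) * (1 + real (card (near_children s)))"
      by (intro mult_right_mono) auto
    then show ?thesis unfolding b_def inc_const_def by simp
  qed
  finally show ?thesis .
qed

lemma potential_step:
  assumes s: "s < n" and NL: "4 * real (K + 2) \<le> \<kappa> * L" and S: "total \<psi> s \<ge> L / 2"
    and \<theta>: "0 \<le> \<theta>" and b: "b = \<theta> * (inc_c K * (1 + real (card (near_children s))))" "b \<le> 1"
  shows "\<exists>y\<in>J s. 0 < prob \<psi> s y \<and> potential K \<theta> (\<psi>(s := y)) (Suc s) \<le> potential K \<theta> \<psi> s * (1 + b\<^sup>2)"
proof (rule exists_at_most_average[OF finite_J[OF s] _ prob_bounds(3)[OF s S]])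
  show "0 \<le> prob \<psi> s y" for y by (rule prob_bounds(1)[OF s S])
  define z where "z = (\<lambda>F y. compensated \<psi> s F y - mean \<psi> s (compensated \<psi> s F))"
  have zm: "(\<Sum>y\<in>J s. prob \<psi> s y * z F y) = 0" for F
    unfolding z_def using prob_bounds(3)[OF s S]
    by (simp add: right_diff_distrib sum_subtractf sum_distrib_right[symmetric] mean_def)
  have martingale_upd: "martingale (\<psi>(s := y)) (Suc s) F = martingale \<psi> s F + z F y" for F y
  proof -
    have "martingale (\<psi>(s := y)) s F = martingale \<psi> s F" using s by (intro martingale_cong) auto
    moreover have "compensated (\<psi>(s := y)) s F = compensated \<psi> s F" using s by (intro compensated_cong) auto
    moreover have "mean (\<psi>(s := y)) s = mean \<psi> s" using s by (intro mean_cong) auto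
    ultimately show ?thesis unfolding martingale_def z_def by simp
  qed
  have mom: "(\<Sum>y\<in>J s. prob \<psi> s y * exp (e * \<theta> * z F y)) \<le> 1 + b\<^sup>2" if F: "F \<in> Stats_upto K" and e: "e = 1 \<or> e = -1" for F and e :: real
  proof (rule exp_moment_bound)
    show "(\<Sum>y\<in>J s. prob \<psi> s y * (e * \<theta> * z F y)) = 0"
    proof -
      have "(\<Sum>y\<in>J s. prob \<psi> s y * (e * \<theta> * z F y)) = e * \<theta> * (\<Sum>y\<in>J s. prob \<psi> s y * z F y)"
        by (simp add: sum_distrib_left mult_ac)
      then show ?thesis using zm by simp
    qed
    fix y
    have "\<bar>e * \<theta> * z F y\<bar> = \<theta> * \<bar>z F y\<bar>" using e \<theta> by (auto simp: abs_mult)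
    also have "\<dots> \<le> b" unfolding b(1) z_def by (rule mult_left_mono[OF increment_bound[OF s F NL S] \<theta>])
    finally show "\<bar>e * \<theta> * z F y\<bar> \<le> b" .
  qed (use prob_bounds[OF s S] b in auto)
  have "(\<Sum>y\<in>J s. prob \<psi> s y * potential K \<theta> (\<psi>(s := y)) (Suc s))
     = (\<Sum>y\<in>J s. \<Sum>F\<in>Stats_upto K. exp (\<theta> * martingale \<psi> s F) * (prob \<psi> s y * exp (1 * \<theta> * z F y)) + exp (- \<theta> * martingale \<psi> s F) * (prob \<psi> s y * exp (-1 * \<theta> * z F y)))"
  proof -
    have ex: "exp (\<theta> * (a + c)) = exp (\<theta> * a) * exp (1 * \<theta> * c)"
      "exp (- \<theta> * (a + c)) = exp (- \<theta> * a) * exp (-1 * \<theta> * c)" for a c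
      by (simp_all add: exp_add[symmetric] algebra_simps)
    have alg: "a * (p1 * r1 + p2 * r2) = p1 * (a * r1) + p2 * (a * r2)" for a p1 p2 r1 r2 :: real
      by (simp add: algebra_simps)
    show ?thesis unfolding potential_def martingale_upd sum_distrib_left
      by (intro sum.cong refl) (unfold ex, rule alg)
  qed
  also have "\<dots> = (\<Sum>F\<in>Stats_upto K. \<Sum>y\<in>J s. exp (\<theta> * martingale \<psi> s F) * (prob \<psi> s y * exp (1 * \<theta> * z F y)) + exp (- \<theta> * martingale \<psi> s F) * (prob \<psi> s y * exp (-1 * \<theta> * z F y)))"
    by (rule sum.swap)
  also have "\<dots> = (\<Sum>F\<in>Stats_upto K. exp (\<theta> * martingale \<psi> s F) * (\<Sum>y\<in>J s. prob \<psi> s y * exp (1 * \<theta> * z F y)) + exp (- \<theta> * martingale \<psi> s F) * (\<Sum>y\<in>J s. prob \<psi> s y * exp (-1 * \<theta> * z F y)))"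
    by (simp only: sum.distrib sum_distrib_left)
  also have "\<dots> \<le> (\<Sum>F\<in>Stats_upto K. exp (\<theta> * martingale \<psi> s F) * (1 + b\<^sup>2) + exp (- \<theta> * martingale \<psi> s F) * (1 + b\<^sup>2))"
    by (intro sum_mono add_mono mult_left_mono mom exp_ge_zero) simp_all
  also have "\<dots> = potential K \<theta> \<psi> s * (1 + b\<^sup>2)" unfolding potential_def by (simp add: sum_distrib_right distrib_right)
  finally show "(\<Sum>y\<in>J s. prob \<psi> s y * potential K \<theta> (\<psi>(s := y)) (Suc s)) \<le> potential K \<theta> \<psi> s * (1 + b\<^sup>2)" .
qed

text \<open>
  Every step uses two fresh resources: up to time \<open>t\<close> all labels are distinct, and so are all
  differences.
\<close>

definition valid :: "(nat \<Rightarrow> int) \<Rightarrow> nat \<Rightarrow> bool" where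
  "valid \<psi> t \<longleftrightarrow> (\<forall>s<t. \<psi> s \<in> J s \<and> move (parent_label \<psi> s) (\<psi> s) \<inter> used \<psi> s = {})"

lemma valid_pl: assumes "valid \<psi> t" "t \<le> n" "s < n" "s \<le> t" shows "parent_label \<psi> s \<in> P"
proof (cases "s = 0")
  case False
  then have "par s < s" using par_less assms by auto
  then have "\<psi> (par s) \<in> J (par s)" "par s < n" using assms by (auto simp: valid_def)
  then show ?thesis using False J_sub by (auto simp: parent_label_def)
qed (simp add: parent_label_def p0_P)

lemma valid_inj: assumes "valid \<psi> t" shows "inj_on \<psi> {..<t}"
proof -
  have ne: "\<psi> r \<noteq> \<psi> s" if "r < s" "s < t" for r s
  proof
    assume e: "\<psi> r = \<psi> s"
    have "Inl (\<psi> r) \<in> used \<psi> s" unfolding used_def move_def using that by blast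
    moreover have "Inl (\<psi> s) \<in> move (parent_label \<psi> s) (\<psi> s)" by (simp add: move_def)
    ultimately show False using assms that e unfolding valid_def by (metis disjoint_iff)
  qed
  show ?thesis by (rule inj_onI) (metis ne lessThan_iff linorder_neqE_nat)
qed

lemma card_same_parent_label:
  assumes v: "valid \<psi> t" and t: "t \<le> n" and p0: "\<And>t. t < n \<Longrightarrow> p0 \<notin> J t"
    and \<Delta>: "\<And>s. s < n \<Longrightarrow> card {c. 0 < c \<and> c < n \<and> par c = s} \<le> \<Delta>"
  shows "card {s. s < t \<and> parent_label \<psi> s = p} \<le> 1 + \<Delta>"
proof (cases "\<exists>r<t. \<psi> r = p")
  case True
  then obtain r where r: "r < t" "\<psi> r = p" by blast
  have "p \<noteq> p0" using r v p0 t by (auto simp: valid_def)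
  have "{s. s < t \<and> parent_label \<psi> s = p} \<subseteq> {c. 0 < c \<and> c < n \<and> par c = r}"
  proof
    fix s assume s: "s \<in> {s. s < t \<and> parent_label \<psi> s = p}"
    have s0: "0 < s" using s \<open>p \<noteq> p0\<close> by (cases s) (auto simp: parent_label_def)
    then have "par s < t" "\<psi> (par s) = \<psi> r" using s r par_less[of s] t by (auto simp: parent_label_def)
    then have "par s = r" using valid_inj[OF v] r by (auto simp: inj_on_def)
    then show "s \<in> {c. 0 < c \<and> c < n \<and> par c = r}" using s s0 t by auto
  qed
  then have "card {s. s < t \<and> parent_label \<psi> s = p} \<le> card {c. 0 < c \<and> c < n \<and> par c = r}"
    by (intro card_mono) (auto intro: finite_subset[of _ "{..<n}"])
  then show ?thesis using \<Delta>[of r] r t by simp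
next
  case False
  have "{s. s < t \<and> parent_label \<psi> s = p} \<subseteq> {0}"
  proof
    fix s assume s: "s \<in> {s. s < t \<and> parent_label \<psi> s = p}"
    show "s \<in> {0}"
    proof (rule ccontr)
      assume "s \<notin> {0}"
      then have "par s < t" "\<psi> (par s) = p" using s par_less[of s] t by (auto simp: parent_label_def)
      then show False using False by blast
    qed
  qed
  then have "card {s. s < t \<and> parent_label \<psi> s = p} \<le> card {0::nat}" by (intro card_mono) auto
  then show ?thesis by simp
qed

text \<open>
  Induction on time. While the potential is bounded, all martingales are small at all earlier
  times. The deviations then obey the hierarchy up to the present, so the total availability of
  the next window is at least \<open>L / 2\<close>, and a further choice that respects the potential
  exists.
\<close>

lemma labelling_exists:
  fixes \<epsilon> H \<theta> \<nu> :: real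
  assumes n: "n > 0" and p0: "\<And>t. t < n \<Longrightarrow> p0 \<notin> J t"
    and \<Delta>: "\<And>s. s < n \<Longrightarrow> card {c. 0 < c \<and> c < n \<and> par c = s} \<le> \<Delta>"
    and hier: "\<And>N \<sigma>. real N \<le> H * L \<Longrightarrow> closed_hierarchy rate_c K \<nu> L N \<sigma> \<Longrightarrow> (\<forall>t\<le>N. \<sigma> 0 t \<le> 1 / (2 * Wc 0))"
    and gap: "\<And>c. c < n \<Longrightarrow> \<not> jump c \<Longrightarrow> c \<le> par c + M" and M: "real M \<le> \<epsilon> * L"
    and jumps: "real (card {c. c < n \<and> jump c}) \<le> \<epsilon> * L"
    and \<Delta>L: "1 + real \<Delta> \<le> \<epsilon> * L" and KL: "4 * real (K + 2) \<le> \<kappa> * L" and nH: "real n \<le> H * L"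
    and \<nu>: "\<And>j. j \<le> K \<Longrightarrow> total_c H j * \<epsilon> \<le> \<nu>"
    and \<theta>: "\<theta> > 0" "\<theta> * (inc_c K * (1 + real \<Delta>)) \<le> 1"
    and noise: "ln (2 * real (card (Stats_upto K))) + 2 * (\<theta> * inc_c K)\<^sup>2 * (1 + real \<Delta>) * real n \<le> \<theta> * (\<epsilon> * L)"
  shows "\<exists>\<psi>. valid \<psi> n"
proof -
  define b where "b = (\<lambda>s. \<theta> * (inc_c K * (1 + real (card (near_children s)))))"
  have near_children\<Delta>: "card (near_children s) \<le> \<Delta>" if "s < n" for s
  proof -
    have "near_children s \<subseteq> {c. 0 < c \<and> c < n \<and> par c = s}" unfolding near_children_def using nonjump_pos by auto
    then have "card (near_children s) \<le> card {c. 0 < c \<and> c < n \<and> par c = s}"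
      by (intro card_mono) (auto intro: finite_subset[of _ "{..<n}"])
    then show ?thesis using \<Delta>[OF that] by simp
  qed
  have b1: "b s \<le> 1" "0 \<le> b s" if "s < n" for s
  proof -
    have "b s \<le> \<theta> * (inc_c K * (1 + real \<Delta>))"
      unfolding b_def using near_children\<Delta>[OF that] \<theta> inc_c_nonneg by (intro mult_left_mono) auto
    then show "b s \<le> 1" using \<theta> by linarith
    show "0 \<le> b s" unfolding b_def using \<theta> inc_c_nonneg by simp
  qed
  define B0 where "B0 = 2 * real (card (Stats_upto K)) * exp (2 * (\<theta> * inc_c K)\<^sup>2 * (1 + real \<Delta>) * real n)"
  have prodB: "2 * real (card (Stats_upto K)) * (\<Prod>s<r. 1 + (b s)\<^sup>2) \<le> B0" if "r \<le> n" for r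
  proof -
    have "(\<Prod>s<r. 1 + (b s)\<^sup>2) \<le> (\<Prod>s<r. exp ((b s)\<^sup>2))" by (intro prod_mono) (auto simp: exp_ge_add_one_self intro: add_nonneg_nonneg)
    also have "\<dots> = exp (\<Sum>s<r. (b s)\<^sup>2)" by (simp add: exp_sum)
    also have "(\<Sum>s<r. (b s)\<^sup>2) \<le> (\<Sum>s<n. (b s)\<^sup>2)" using that by (intro sum_mono2) auto
    also have "\<dots> \<le> (\<Sum>s<n. (\<theta> * inc_c K)\<^sup>2 * ((1 + real \<Delta>) * (1 + real (card (near_children s)))))"
    proof (rule sum_mono)
      fix s assume "s \<in> {..<n}"
      then have "(1 + real (card (near_children s))) * (1 + real (card (near_children s))) \<le> (1 + real \<Delta>) * (1 + real (card (near_children s)))"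
        using near_children\<Delta> by (intro mult_right_mono) auto
      then have "(\<theta> * inc_c K)\<^sup>2 * ((1 + real (card (near_children s))) * (1 + real (card (near_children s)))) \<le> (\<theta> * inc_c K)\<^sup>2 * ((1 + real \<Delta>) * (1 + real (card (near_children s))))"
        by (intro mult_left_mono) auto
      then show "(b s)\<^sup>2 \<le> (\<theta> * inc_c K)\<^sup>2 * ((1 + real \<Delta>) * (1 + real (card (near_children s))))"
        unfolding b_def by (simp add: power2_eq_square mult_ac)
    qed
    also have "\<dots> = (\<theta> * inc_c K)\<^sup>2 * (1 + real \<Delta>) * (real n + real (\<Sum>s<n. card (near_children s)))"
      by (simp add: sum_distrib_left[symmetric] sum.distrib mult.assoc)
    also have "(\<Sum>s<n. card (near_children s)) = card (\<Union>s<n. near_children s)"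
      by (rule card_UN_disjoint[symmetric]) (auto simp: near_children_def)
    also have "card (\<Union>s<n. near_children s) \<le> card {..<n}" by (rule card_mono) (auto simp: near_children_def)
    then have "(\<theta> * inc_c K)\<^sup>2 * (1 + real \<Delta>) * (real n + real (card (\<Union>s<n. near_children s))) \<le> (\<theta> * inc_c K)\<^sup>2 * (1 + real \<Delta>) * (real n + real n)"
      by (intro mult_left_mono) auto
    finally have "(\<Prod>s<r. 1 + (b s)\<^sup>2) \<le> exp (2 * (\<theta> * inc_c K)\<^sup>2 * (1 + real \<Delta>) * real n)" by (simp add: mult_ac)
    then show ?thesis unfolding B0_def by (intro mult_left_mono) auto
  qed
  define Inv where "Inv = (\<lambda>\<psi> t. valid \<psi> t \<and> (\<forall>s<t. total \<psi> s \<ge> L / 2) \<and>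
     (\<forall>r\<le>t. potential K \<theta> \<psi> r \<le> 2 * real (card (Stats_upto K)) * (\<Prod>s<r. 1 + (b s)\<^sup>2)))"
  have base0: "base p0 0 (\<lambda>_. 1) \<in> Stats_upto K"
  proof -
    have "base p0 0 (\<lambda>_. 1) \<in> Stats 0" using n p0_P by auto
    then show ?thesis unfolding Stats_upto_def by blast
  qed
  have cardF: "real (card (Stats_upto K)) \<ge> 1"
  proof -
    have "card (Stats_upto K) \<noteq> 0" using base0 finite_Stats_upto by auto
    then show ?thesis by simp
  qed
  have martingale: "\<bar>martingale \<psi> r F\<bar> \<le> \<epsilon> * L" if I: "Inv \<psi> t" and r: "r \<le> t" "t \<le> n" and F: "F \<in> Stats_upto K" for \<psi> t r F
  proof -
    have "exp (\<theta> * martingale \<psi> r F) + exp (- \<theta> * martingale \<psi> r F) \<le> potential K \<theta> \<psi> r"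
      unfolding potential_def using F finite_Stats_upto by (intro member_le_sum[of F]) (auto intro: add_nonneg_nonneg)
    also have "\<dots> \<le> B0" using I r prodB[of r] unfolding Inv_def by (meson order_trans)
    finally have le: "exp (\<theta> * martingale \<psi> r F) + exp (- \<theta> * martingale \<psi> r F) \<le> B0" .
    have le: "exp (\<theta> * \<bar>martingale \<psi> r F\<bar>) \<le> B0"
    proof (cases "martingale \<psi> r F \<ge> 0")
      case True
      then have "\<bar>martingale \<psi> r F\<bar> = martingale \<psi> r F" by simp
      then show ?thesis using le exp_gt_zero[of "- \<theta> * martingale \<psi> r F"] by linarith
    next
      case False
      then have "exp (\<theta> * \<bar>martingale \<psi> r F\<bar>) = exp (- \<theta> * martingale \<psi> r F)" by simp
      then show ?thesis using le exp_gt_zero[of "\<theta> * martingale \<psi> r F"] by linarith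
    qed
    have "\<theta> * \<bar>martingale \<psi> r F\<bar> = ln (exp (\<theta> * \<bar>martingale \<psi> r F\<bar>))" by simp
    also have "\<dots> \<le> ln B0" using le by (intro ln_mono) auto
    also have "\<dots> = ln (2 * real (card (Stats_upto K))) + 2 * (\<theta> * inc_c K)\<^sup>2 * (1 + real \<Delta>) * real n"
      unfolding B0_def using cardF by (subst ln_mult) auto
    also have "\<dots> \<le> \<theta> * (\<epsilon> * L)" by (rule noise)
    finally show ?thesis using \<theta>(1) by simp
  qed
  have Sbig: "total \<psi> t \<ge> L / 2" if I: "Inv \<psi> t" and t: "t < n" for \<psi> t
  proof -
    have v: "valid \<psi> t" and S: "\<And>s. s < t \<Longrightarrow> total \<psi> s \<ge> L / 2" using I by (auto simp: Inv_def)
    have "closed_hierarchy rate_c K \<nu> L t (sigma \<psi>)"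
      unfolding closed_hierarchy_def
    proof (intro conjI allI impI)
      show "sigma \<psi> k r \<le> 1" if "r \<le> t" for k r using sigma_le_1[OF n] that t by simp
      show "sigma \<psi> k 0 \<le> 0" for k by (rule sigma_at_0[OF n])
      fix k T r assume a: "k \<le> K \<and> T \<le> r \<and> r \<le> t"
      let ?\<Sigma> = "\<Sum>s\<in>{T..<r}. sigma \<psi> (k + 1) s"
      have rc: "0 \<le> rate_c" unfolding rate_const_def using Wc_pos[of 0] \<kappa>_pos by simp
      show "sigma \<psi> k r \<le> sigma \<psi> k T + \<nu> + rate_c * real (k + 2) / L * ?\<Sigma>"
      proof (rule sigma_le[OF n])
        fix j F assume j: "j \<le> k" "F \<in> Stats j"
        have jK: "j \<le> K" using j a by simp
        have FK: "F \<in> Stats_upto K" using j jK unfolding Stats_upto_def by blast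
        have "\<bar>F (avail \<psi> r) - F (avail \<psi> T)\<bar> \<le> total_c H j * \<epsilon> * (Wc j * L) + rate_c * real (j + 2) * Wc j * (\<Sum>s\<in>{T..<r}. sigma \<psi> (Suc j) s)"
        proof (rule deviation_growth[OF n _ _ j(2) _ _ gap M jumps _ _ _ nH])
          show "T \<le> r" "r \<le> n" using a t by auto
          show "parent_label \<psi> s \<in> P" if "s < r" for s using valid_pl[OF v, of s] that a t by auto
          show "real L / 2 \<le> total \<psi> s" if "s < r" for s using S that a by auto
          show "real (card {s. s < r \<and> parent_label \<psi> s = p}) \<le> \<epsilon> * real L" for p
          proof -
            have "valid \<psi> r" using v a by (auto simp: valid_def)
            then have "card {s. s < r \<and> parent_label \<psi> s = p} \<le> 1 + \<Delta>" using a t by (intro card_same_parent_label p0 \<Delta>) auto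
            then show ?thesis using \<Delta>L by linarith
          qed
          show "1 \<le> \<epsilon> * real L" using \<Delta>L by linarith
          show "4 * real (j + 2) \<le> \<kappa> * real L" using KL jK by simp
          show "\<bar>martingale \<psi> r F\<bar> \<le> \<epsilon> * real L" "\<bar>martingale \<psi> T F\<bar> \<le> \<epsilon> * real L" using martingale[OF I _ _ FK] a t by auto
        qed
        also have "\<dots> \<le> \<nu> * (Wc j * L) + rate_c * real (k + 2) * Wc j * ?\<Sigma>"
        proof (intro add_mono mult_right_mono \<nu> jK)
          have "(\<Sum>s\<in>{T..<r}. sigma \<psi> (Suc j) s) \<le> ?\<Sigma>" using sigma_mono[OF n] j by (intro sum_mono) auto
          then show "rate_c * real (j + 2) * Wc j * (\<Sum>s\<in>{T..<r}. sigma \<psi> (Suc j) s) \<le> rate_c * real (k + 2) * Wc j * ?\<Sigma>"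
            using rc Wc_pos[of j] j(1) sigma_nonneg[OF n] by (intro mult_mono mult_nonneg_nonneg sum_nonneg) (auto simp: less_imp_le)
        qed (use Wc_pos[of j] in \<open>auto simp: less_imp_le\<close>)
        finally have "\<bar>F (avail \<psi> r) - F (\<lambda>_. 1)\<bar> \<le> sigma \<psi> k T * Wc j * L + (\<nu> * (Wc j * L) + rate_c * real (k + 2) * Wc j * ?\<Sigma>)"
          using deviation_le_sigma[OF j, of \<psi> T] by linarith
        also have "\<dots> = (sigma \<psi> k T + \<nu> + rate_c * real (k + 2) / L * ?\<Sigma>) * (Wc j * L)"
          using L_pos by (simp add: field_simps)
        finally show "rel_dev \<psi> r j F \<le> sigma \<psi> k T + \<nu> + rate_c * real (k + 2) / L * ?\<Sigma>"
          unfolding rel_dev_def using WcL_pos[of j] by (subst pos_divide_le_eq) auto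
      qed
    qed
    then have "sigma \<psi> 0 t \<le> 1 / (2 * Wc 0)" using hier[of t "sigma \<psi>"] nH t by simp
    then have "sigma \<psi> 0 t * (Wc 0 * L) \<le> 1 / (2 * Wc 0) * (Wc 0 * L)" using WcL_pos[of 0] by (intro mult_right_mono) auto
    also have "\<dots> = L / 2" using Wc_pos[of 0] by simp
    finally have "\<bar>total \<psi> t - L\<bar> \<le> L / 2" using total_dev[OF t valid_pl[OF v]] t by (simp add: mult.assoc)
    then show ?thesis by linarith
  qed
  have "\<exists>\<psi>. Inv \<psi> t" if "t \<le> n" for t
    using that
  proof (induction t)
    case 0
    have "Inv (\<lambda>_. 0) 0" unfolding Inv_def valid_def potential_def martingale_def by simp
    then show ?case by blast
  next
    case (Suc t)
    then obtain \<psi> where I: "Inv \<psi> t" by auto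
    have t: "t < n" using Suc.prems by simp
    obtain y where y: "y \<in> J t" "0 < prob \<psi> t y" "potential K \<theta> (\<psi>(t := y)) (Suc t) \<le> potential K \<theta> \<psi> t * (1 + (b t)\<^sup>2)"
      using potential_step[OF t KL Sbig[OF I t], of \<theta> "b t"] \<theta> b1[OF t] b_def by auto
    have x0: "avail \<psi> t (move (parent_label \<psi> t) y) \<noteq> 0" using y(2) unfolding prob_def by auto
    have eq: "used (\<psi>(t := y)) s = used \<psi> s" "parent_label (\<psi>(t := y)) s = parent_label \<psi> s" "total (\<psi>(t := y)) s = total \<psi> s" if "s \<le> t" for s
      using that t by (auto intro!: used_cong parent_label_cong total_cong)
    have eqm: "martingale (\<psi>(t := y)) r F = martingale \<psi> r F" if "r \<le> t" for r F using that t by (intro martingale_cong) auto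
    have "Inv (\<psi>(t := y)) (Suc t)"
      unfolding Inv_def
    proof (intro conjI allI impI)
      show "valid (\<psi>(t := y)) (Suc t)"
        unfolding valid_def
      proof (intro allI impI)
        fix s assume "s < Suc t"
        then consider "s < t" | "s = t" by linarith
        then show "(\<psi>(t := y)) s \<in> J s \<and> move (parent_label (\<psi>(t := y)) s) ((\<psi>(t := y)) s) \<inter> used (\<psi>(t := y)) s = {}"
        proof cases
          case 1 then show ?thesis using I eq[of s] by (auto simp: Inv_def valid_def)
        next
          case 2 then show ?thesis using y(1) x0 eq[of s] by (auto simp: avail_def split: if_splits)
        qed
      qed
      show "real L / 2 \<le> total (\<psi>(t := y)) s" if "s < Suc t" for s
      proof (cases "s = t")
        case True then show ?thesis using Sbig[OF I t] eq(3)[of t] by simp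
      next
        case False then show ?thesis using that I eq(3)[of s] by (auto simp: Inv_def)
      qed
      fix r assume "r \<le> Suc t"
      then consider "r \<le> t" | "r = Suc t" by linarith
      then show "potential K \<theta> (\<psi>(t := y)) r \<le> 2 * real (card (Stats_upto K)) * (\<Prod>s<r. 1 + (b s)\<^sup>2)"
      proof cases
        case 1
        then have "potential K \<theta> (\<psi>(t := y)) r = potential K \<theta> \<psi> r" unfolding potential_def using eqm by simp
        then show ?thesis using I 1 by (auto simp: Inv_def)
      next
        case 2
        have "potential K \<theta> \<psi> t \<le> 2 * real (card (Stats_upto K)) * (\<Prod>s<t. 1 + (b s)\<^sup>2)" using I by (auto simp: Inv_def)
        then have "potential K \<theta> \<psi> t * (1 + (b t)\<^sup>2) \<le> 2 * real (card (Stats_upto K)) * (\<Prod>s<t. 1 + (b s)\<^sup>2) * (1 + (b t)\<^sup>2)"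
          by (intro mult_right_mono) auto
        then show ?thesis using y(3) 2 by (simp add: mult.assoc)
      qed
    qed
    then show ?case by blast
  qed
  then obtain \<psi> where "Inv \<psi> n" by blast
  then show ?thesis unfolding Inv_def by blast
qed

end

section \<open>Choice of the constants of the process\<close>

lemma consts_pos:
  assumes "\<kappa> > 0"
  shows "dev_scale \<kappa> k > 0" "rate_const \<kappa> > 0" "step_const \<kappa> k \<ge> 0" "grad_const \<kappa> k \<ge> 0" "inc_const \<kappa> K \<ge> 0"
proof -
  note w = weight_bound_pos[OF assms] degree_bound_pos[OF assms]
  show d: "dev_scale \<kappa> k > 0" for k using w(1)[of k] assms by (simp add: dev_scale_def)
  show "rate_const \<kappa> > 0" using d[of 0] assms by (simp add: rate_const_def add_pos_pos)
  show s: "step_const \<kappa> k \<ge> 0" for k using w[of k] assms by (simp add: step_const_def)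
  show g: "grad_const \<kappa> k \<ge> 0" for k using w[of k] assms by (simp add: grad_const_def)
  show "inc_const \<kappa> K \<ge> 0" unfolding inc_const_def using s g by (simp add: sum_nonneg)
qed

lemma (in greedy) card_Stats_upto:
  assumes "real n \<le> Q" "real (card P) \<le> Q" "1 \<le> Q"
  shows "real (card (Stats_upto K)) \<le> 4 * real (K + 1) * (2 * Q ^ 2) ^ (K + 3)"
proof -
  have "card (Stats_upto K) \<le> (\<Sum>j\<le>K. card (Stats j))" unfolding Stats_upto_def by (rule card_UN_le) simp
  then have "real (card (Stats_upto K)) \<le> (\<Sum>j\<le>K. real (card (Stats j)))" by (simp flip: of_nat_sum)
  also have "\<dots> \<le> (\<Sum>j\<le>K. 4 * (2 * Q ^ 2) ^ (K + 3))"
  proof (rule sum_mono)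
    fix j assume j: "j \<in> {..K}"
    have "1 * 1 \<le> 2 * Q ^ 2" using assms(3) by (intro mult_mono) auto
    then have "(2 * Q ^ 2) ^ (j + 3) \<le> (2 * Q ^ 2) ^ (K + 3)" using j by (intro power_increasing) auto
    then show "real (card (Stats j)) \<le> 4 * (2 * Q ^ 2) ^ (K + 3)" using card_Stats[OF assms, of j] by linarith
  qed
  also have "\<dots> = real (K + 1) * (4 * (2 * Q ^ 2) ^ (K + 3))" by simp
  finally show ?thesis by (simp only: mult_ac)
qed

text \<open>
  The constants are chosen in the order \<open>K\<close> and \<open>\<nu>\<close> from the hierarchy, \<open>\<epsilon>\<close> from \<open>\<nu>\<close>, \<open>\<tau>\<close> from \<open>\<epsilon>\<close>, and \<open>\<delta>\<close> last.
  The exponent \<open>\<theta>\<close> is \<open>\<tau> / (B D)\<close> with \<open>D = 1 + \<Delta>\<close>: it makes the variance term a small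
  multiple of \<open>L\<close>, and the logarithm of the number of statistics is absorbed because \<open>D ln L\<close> is
  at most \<open>\<delta> L\<close>.
\<close>

lemma greedy_process_succeeds:
  fixes \<kappa> H :: real
  assumes \<kappa>: "0 < \<kappa>" "\<kappa> \<le> 1" and H: "H > 0"
  shows "\<exists>\<delta> L0. \<delta> > 0 \<and> (\<forall>n L par jump J p0 P M \<Delta>.
     greedy n L par jump J p0 P \<kappa> \<longrightarrow> n > 0 \<longrightarrow> (\<forall>t<n. p0 \<notin> J t) \<longrightarrow>
     (\<forall>s<n. card {c. 0 < c \<and> c < n \<and> par c = s} \<le> \<Delta>) \<longrightarrow>
     (\<forall>c<n. \<not> jump c \<longrightarrow> c \<le> par c + M) \<longrightarrow> real n \<le> H * real L \<longrightarrow> real (card P) \<le> H * real L \<longrightarrow>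
     L0 \<le> real L \<longrightarrow> real M \<le> \<delta> * real L \<longrightarrow> real (card {c. c < n \<and> jump c}) \<le> \<delta> * real L \<longrightarrow>
     (1 + real \<Delta>) * ln (real L) \<le> \<delta> * real L \<longrightarrow>
     (\<exists>\<psi>. greedy.valid par J p0 \<psi> n))"
proof -
  define C where "C = rate_const \<kappa>"
  note cp = consts_pos[OF \<kappa>(1)]
  have C: "C > 0" unfolding C_def by (rule cp)
  obtain K \<nu> where K: "\<nu> > 0" "\<And>L N \<sigma>. L \<ge> 8 * C \<Longrightarrow> real N \<le> H * L \<Longrightarrow> closed_hierarchy C K \<nu> L N \<sigma> \<Longrightarrow> (\<forall>t\<le>N. \<sigma> 0 t \<le> 1 / (2 * dev_scale \<kappa> 0))"
  proof -
    have "1 / (2 * dev_scale \<kappa> 0) > 0" using cp(1)[of 0] by simp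
    from hierarchy_bound[OF C H this] show thesis using that by blast
  qed
  define tot where "tot = 1 + (\<Sum>j\<le>K. \<bar>total_const \<kappa> H j\<bar>)"
  have tot: "tot \<ge> 1" unfolding tot_def by (simp add: sum_nonneg)
  define \<epsilon> where "\<epsilon> = \<nu> / tot"
  have \<epsilon>: "\<epsilon> > 0" unfolding \<epsilon>_def using K(1) tot by simp
  have tot_le: "total_const \<kappa> H j * \<epsilon> \<le> \<nu>" if "j \<le> K" for j
  proof -
    have "\<bar>total_const \<kappa> H j\<bar> \<le> (\<Sum>j\<le>K. \<bar>total_const \<kappa> H j\<bar>)" using that by (intro member_le_sum) auto
    then have "total_const \<kappa> H j \<le> tot" unfolding tot_def by linarith
    then have "total_const \<kappa> H j * \<epsilon> \<le> tot * \<epsilon>" using \<epsilon> by (intro mult_right_mono) auto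
    then show ?thesis unfolding \<epsilon>_def using tot by simp
  qed
  define B where "B = inc_const \<kappa> K + 1"
  have B: "B \<ge> 1" "inc_const \<kappa> K \<le> B" unfolding B_def using cp(5) by auto
  define \<tau> where "\<tau> = min 1 (\<epsilon> / (4 * B * H))"
  have \<tau>: "0 < \<tau>" "\<tau> \<le> 1" "\<tau> \<le> \<epsilon> / (4 * B * H)" unfolding \<tau>_def using \<epsilon> B H by auto
  define A where "A = 2 * real (K + 3) + 1"
  define c0 where "c0 = ln (8 * real (K + 1)) + real (K + 3) * (ln 2 + 2 * ln (H + 1))"
  define \<delta> where "\<delta> = min \<epsilon> (\<tau> * \<epsilon> / (2 * B * A))"
  have A: "A \<ge> 1" unfolding A_def by simp
  have \<delta>: "\<delta> > 0" "\<delta> \<le> \<epsilon>" "\<delta> \<le> \<tau> * \<epsilon> / (2 * B * A)" unfolding \<delta>_def using \<epsilon> \<tau> B A by auto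
  define L0 where "L0 = Max {8 * C, 4 * real (K + 2) / \<kappa>, exp 1, exp c0, 1}"
  have L0: "8 * C \<le> L0" "4 * real (K + 2) / \<kappa> \<le> L0" "exp 1 \<le> L0" "exp c0 \<le> L0" "1 \<le> L0" unfolding L0_def by auto
  show ?thesis
  proof (rule exI[of _ \<delta>], rule exI[of _ L0], intro conjI allI impI \<delta>(1))
    fix n L :: nat and par jump J p0 P M \<Delta>
    assume g: "greedy n L par jump J p0 P \<kappa>" and n: "n > 0" and p0: "\<forall>t<n. p0 \<notin> J t"
      and \<Delta>: "\<forall>s<n. card {c. 0 < c \<and> c < n \<and> par c = s} \<le> \<Delta>"
      and gap: "\<forall>c<n. \<not> jump c \<longrightarrow> c \<le> par c + M" and nH: "real n \<le> H * real L" and PH: "real (card P) \<le> H * real L"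
      and L: "L0 \<le> real L" and M: "real M \<le> \<delta> * real L" and jm: "real (card {c. c < n \<and> jump c}) \<le> \<delta> * real L"
      and lg: "(1 + real \<Delta>) * ln (real L) \<le> \<delta> * real L"
    interpret greedy n L par jump J p0 P \<kappa> by (rule g)
    have Lp: "real L \<ge> 1" using L L0 by linarith
    have lnL: "ln (real L) \<ge> 1" "ln (real L) \<ge> c0"
      using L L0(3,4) Lp by (smt (verit) exp_gt_zero ln_ge_iff)+
    define D where "D = 1 + real \<Delta>"
    have D: "D \<ge> 1" "D * ln (real L) \<le> \<delta> * real L" using lg by (auto simp: D_def)
    have le\<epsilon>: "\<delta> * real L \<le> \<epsilon> * real L" using \<delta> by (intro mult_right_mono) auto
    have D\<epsilon>: "D \<le> \<epsilon> * real L"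
    proof -
      have "D * 1 \<le> D * ln (real L)" using D lnL by (intro mult_left_mono) auto
      then show ?thesis using D le\<epsilon> by linarith
    qed
    define \<theta> where "\<theta> = \<tau> / (B * D)"
    have \<theta>: "\<theta> > 0" unfolding \<theta>_def using \<tau> B D by simp
    have \<theta>i: "\<theta> * inc_const \<kappa> K \<le> \<tau> / D" "0 \<le> \<theta> * inc_const \<kappa> K"
    proof -
      have "\<theta> * inc_const \<kappa> K \<le> \<theta> * B" using B \<theta> by (intro mult_left_mono) auto
      also have "\<dots> = \<tau> / D" unfolding \<theta>_def using B by simp
      finally show "\<theta> * inc_const \<kappa> K \<le> \<tau> / D" .
      show "0 \<le> \<theta> * inc_const \<kappa> K" using \<theta> cp(5) by simp
    qed
    have 1: "\<theta> * (inc_const \<kappa> K * (1 + real \<Delta>)) \<le> 1"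
    proof -
      have "\<theta> * inc_const \<kappa> K * D \<le> \<tau> / D * D" using \<theta>i D by (intro mult_right_mono) auto
      also have "\<dots> \<le> 1" using D \<tau> by simp
      finally show ?thesis by (simp add: D_def mult.assoc)
    qed
    have half: "\<theta> * (\<epsilon> * L) = \<tau> * \<epsilon> * L / (2 * B * D) + \<tau> * \<epsilon> * L / (2 * B * D)"
      unfolding \<theta>_def using B D by (simp add: field_simps)
    have 2: "2 * (\<theta> * inc_const \<kappa> K)\<^sup>2 * (1 + real \<Delta>) * real n \<le> \<tau> * \<epsilon> * L / (2 * B * D)"
    proof -
      have "(\<theta> * inc_const \<kappa> K)\<^sup>2 \<le> (\<tau> / D)\<^sup>2" using \<theta>i by (intro power_mono) auto
      then have "2 * (\<theta> * inc_const \<kappa> K)\<^sup>2 * D * real n \<le> 2 * (\<tau> / D)\<^sup>2 * D * (H * L)"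
        using D nH by (intro mult_mono) auto
      also have "\<dots> = \<tau> * (2 * H * L / D) * \<tau>" using D by (simp add: power2_eq_square)
      also have "\<dots> \<le> \<tau> * (2 * H * L / D) * (\<epsilon> / (4 * B * H))"
        using \<tau> H D by (intro mult_left_mono) auto
      also have "\<dots> = \<tau> * \<epsilon> * L / (2 * B * D)" using H B D by (simp add: mult_ac)
      finally show ?thesis by (simp add: D_def)
    qed
    have 3: "ln (2 * real (card (Stats_upto K))) \<le> \<tau> * \<epsilon> * L / (2 * B * D)"
    proof -
      (* Q bounds the number of vertices and of labels. *)
      define Q where "Q = (H + 1) * real L"
      have Q1: "1 \<le> Q" "real n \<le> Q" "real (card P) \<le> Q" unfolding Q_def using H Lp nH PH by (auto simp: algebra_simps)
      have cF: "real (card (Stats_upto K)) \<ge> 1"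
      proof -
        have "base p0 0 (\<lambda>_. 1) \<in> Stats 0" using n p0_P by auto
        then have "Stats_upto K \<noteq> {}" unfolding Stats_upto_def by blast
        then have "card (Stats_upto K) \<noteq> 0" using finite_Stats_upto by auto
        then show ?thesis by simp
      qed
      have "ln (2 * real (card (Stats_upto K))) \<le> ln (8 * real (K + 1) * (2 * Q ^ 2) ^ (K + 3))"
      proof (rule ln_mono)
        have "2 * real (card (Stats_upto K)) \<le> 2 * (4 * real (K + 1) * (2 * Q ^ 2) ^ (K + 3))"
          using card_Stats_upto[OF Q1(2,3,1), of K] by (rule mult_left_mono) simp
        then show "2 * real (card (Stats_upto K)) \<le> 8 * real (K + 1) * (2 * Q ^ 2) ^ (K + 3)" by (simp only: mult.assoc[symmetric])
      qed (use cF in simp)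
      also have "\<dots> = ln (8 * real (K + 1)) + real (K + 3) * (ln 2 + 2 * ln Q)"
      proof -
        have Qp: "Q > 0" using Q1 by linarith
        have "ln (8 * real (K + 1) * (2 * Q ^ 2) ^ (K + 3)) = ln (8 * real (K + 1)) + ln ((2 * Q ^ 2) ^ (K + 3))"
          using Qp by (intro ln_mult_pos) auto
        also have "ln ((2 * Q ^ 2) ^ (K + 3)) = real (K + 3) * ln (2 * Q ^ 2)" by (rule ln_realpow)
        also have "ln (2 * Q ^ 2) = ln 2 + ln (Q ^ 2)" using Qp by (intro ln_mult_pos) auto
        also have "ln (Q ^ 2) = 2 * ln Q" using Qp by (simp add: ln_realpow)
        finally show ?thesis .
      qed
      also have "ln Q = ln (H + 1) + ln (real L)" unfolding Q_def using H Lp by (intro ln_mult_pos) auto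
      also have "ln (8 * real (K + 1)) + real (K + 3) * (ln 2 + 2 * (ln (H + 1) + ln (real L))) = c0 + 2 * real (K + 3) * ln (real L)"
        unfolding c0_def by (simp add: algebra_simps)
      also have "\<dots> \<le> A * ln (real L)" unfolding A_def using lnL by (simp add: algebra_simps)
      finally have "ln (2 * real (card (Stats_upto K))) * D \<le> A * ln (real L) * D" using D by (intro mult_right_mono) auto
      also have "\<dots> = A * (D * ln (real L))" by simp
      also have "\<dots> \<le> A * (\<delta> * real L)" using A D by (intro mult_left_mono) auto
      also have "\<dots> \<le> A * (\<tau> * \<epsilon> / (2 * B * A) * real L)" using A \<delta> by (intro mult_left_mono mult_right_mono) auto
      also have "\<dots> = \<tau> * \<epsilon> * L / (2 * B)" using A by simp
      finally have "ln (2 * real (card (Stats_upto K))) \<le> \<tau> * \<epsilon> * L / (2 * B) / D" using D by (subst pos_le_divide_eq) auto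
      then show ?thesis by simp
    qed
    have noise: "ln (2 * real (card (Stats_upto K))) + 2 * (\<theta> * inc_const \<kappa> K)\<^sup>2 * (1 + real \<Delta>) * real n \<le> \<theta> * (\<epsilon> * L)"
      unfolding half using 2 3 by (rule add_mono[rotated])
    show "\<exists>\<psi>. greedy.valid par J p0 \<psi> n"
    proof (rule labelling_exists[OF n, where \<epsilon>=\<epsilon> and H=H and K=K and \<nu>=\<nu> and \<theta>=\<theta> and M=M and \<Delta>=\<Delta>])
      show "\<forall>t\<le>N. \<sigma> 0 t \<le> 1 / (2 * Wc 0)" if "real N \<le> H * real L" "closed_hierarchy rate_c K \<nu> (real L) N \<sigma>" for N \<sigma>
        using K(2)[of "real L" N \<sigma>] that L L0(1) by (simp add: C_def)
      show "4 * real (K + 2) \<le> \<kappa> * real L" 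
      proof -
        have "4 * real (K + 2) / \<kappa> \<le> real L" using L L0(2) by linarith
        then show ?thesis using \<kappa>(1) by (simp only: pos_divide_le_eq mult.commute)
      qed
      show "ln (2 * real (card (Stats_upto K))) + 2 * (\<theta> * inc_c K)\<^sup>2 * (1 + real \<Delta>) * real n \<le> \<theta> * (\<epsilon> * L)"
        by (rule noise)
    qed (use p0 \<Delta> gap M jm le\<epsilon> D\<epsilon> nH tot_le \<theta> 1 in \<open>auto simp: D_def\<close>)
  qed
qed

section \<open>Windows with balanced loads\<close>

definition block :: "nat \<Rightarrow> nat \<Rightarrow> int set" where
  "block L b = {int (b * L)..<int (Suc b * L)}"

lemma card_block [simp]: "card (block L b) = L" by (simp add: block_def algebra_simps)

lemma block_iff: "L > 0 \<Longrightarrow> y \<in> block L b \<longleftrightarrow> y div int L = int b"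
proof -
  assume L: "L > 0"
  show ?thesis
  proof
    assume y: "y \<in> block L b"
    show "y div int L = int b"
      by (rule int_div_pos_eq[of _ _ _ "y - int L * int b"]) (use y in \<open>auto simp: block_def algebra_simps\<close>)
  next
    assume "y div int L = int b"
    then have "y = int L * int b + y mod int L" by (metis mult_div_mod_eq)
    moreover have "0 \<le> y mod int L" "y mod int L < int L" using L by simp_all
    ultimately show "y \<in> block L b" unfolding block_def by (simp add: algebra_simps)
  qed
qed

text \<open>
  The two blocks of pair \<open>k\<close> lie at distance \<open>k\<close> and almost symmetrically, so that the sum of their
  indices is \<open>h - 1\<close> or \<open>h - 2\<close>. Both parities of \<open>k\<close> are needed to cover all differences.
\<close>

definition low_block :: "nat \<Rightarrow> nat \<Rightarrow> nat" where "low_block h k = (h - 1 - k) div 2"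
definition high_block :: "nat \<Rightarrow> nat \<Rightarrow> nat" where "high_block h k = low_block h k + k"

lemma high_block_less: "1 \<le> k \<Longrightarrow> k < h \<Longrightarrow> high_block h k < h"
  unfolding high_block_def low_block_def using div_le_dividend[of "h - 1 - k" 2] by linarith

text \<open>
  Blocks in the lower half occur only as low blocks, the others only as high blocks, and the index
  determines \<open>k\<close> up to parity.
\<close>

lemma few_types_per_block:
  "card {k \<in> {1..<h}. low_block h k = b \<or> high_block h k = b} \<le> 2"
proof -
  have "{k \<in> {1..<h}. low_block h k = b \<or> high_block h k = b} \<subseteq>
     (if 2 * b + 2 \<le> h then {h - 1 - 2 * b, h - 2 - 2 * b} else {2 * b + 1 - h, 2 * b + 2 - h})"
  proof
    fix k assume "k \<in> {k \<in> {1..<h}. low_block h k = b \<or> high_block h k = b}"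
    then have k: "1 \<le> k" "k < h" "(h - 1 - k) div 2 = b \<or> (h - 1 - k) div 2 + k = b"
      by (auto simp: high_block_def low_block_def)
    show "k \<in> (if 2 * b + 2 \<le> h then {h - 1 - 2 * b, h - 2 - 2 * b} else {2 * b + 1 - h, 2 * b + 2 - h})"
    proof (cases "2 * b + 2 \<le> h")
      case True
      then have "k = h - 1 - 2 * b \<or> k = h - 2 - 2 * b" using k by linarith
      then show ?thesis using True by simp
    next
      case False
      then have "k = 2 * b + 1 - h \<or> k = 2 * b + 2 - h" using k by linarith
      then show ?thesis using False by simp
    qed
  qed
  then have "card {k \<in> {1..<h}. low_block h k = b \<or> high_block h k = b} \<le> card (if 2 * b + 2 \<le> h then {h - 1 - 2 * b, h - 2 - 2 * b} else {2 * b + 1 - h, 2 * b + 2 - h})"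
    by (intro card_mono) auto
  also have "\<dots> \<le> 2" by (auto simp: card_insert_if)
  finally show ?thesis .
qed

definition shift_count :: "nat \<Rightarrow> nat \<Rightarrow> nat \<Rightarrow> int \<Rightarrow> nat" where
  "shift_count h L k d = card {z \<in> block L (low_block h k). z + d \<in> block L (high_block h k)}"

text \<open>
  After translating the low block to the origin, \<open>s + d\<close> lies in exactly one block of length \<open>L\<close>, so each
  \<open>s\<close> is counted for at most one \<open>k\<close>.
\<close>

lemma sum_shift_count: 
  assumes "L > 0"
  shows "(\<Sum>k\<in>{1..<h}. shift_count h L k d) \<le> L"
proof -
  let ?A = "\<lambda>k. {s \<in> {0..<int L}. (s + d) div int L = int k}"
  have eq: "shift_count h L k d = card (?A k)" for k
  proof -
    let ?g = "\<lambda>s. s + int (low_block h k * L)"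
    have "?g ` ?A k = {z \<in> block L (low_block h k). z + d \<in> block L (high_block h k)}"
    proof (intro set_eqI iffI)
      fix z assume "z \<in> ?g ` ?A k"
      then obtain s where s: "z = ?g s" "0 \<le> s" "s < int L" "(s + d) div int L = int k" by auto
      have "z \<in> block L (low_block h k)" using s by (auto simp: block_def algebra_simps)
      moreover have "(z + d) div int L = int (high_block h k)"
      proof -
        have "z + d = (s + d) + int (low_block h k) * int L" using s by simp
        then have "(z + d) div int L = (s + d) div int L + int (low_block h k)" using assms by (metis add.commute div_mult_self1 of_nat_0_less_iff less_irrefl)
        then show ?thesis using s by (simp add: high_block_def)
      qed
      ultimately show "z \<in> {z \<in> block L (low_block h k). z + d \<in> block L (high_block h k)}" using block_iff[OF assms] by simp
    next
      fix z assume z: "z \<in> {z \<in> block L (low_block h k). z + d \<in> block L (high_block h k)}"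
      define s where "s = z - int (low_block h k * L)"
      have "0 \<le> s" "s < int L" using z by (auto simp: s_def block_def algebra_simps)
      moreover have "(s + d) div int L = int k"
      proof -
        have "z + d = (s + d) + int (low_block h k) * int L" by (simp add: s_def)
        then have "(z + d) div int L = (s + d) div int L + int (low_block h k)" using assms by (metis add.commute div_mult_self1 of_nat_0_less_iff less_irrefl)
        moreover have "(z + d) div int L = int (high_block h k)" using z block_iff[OF assms] by simp
        ultimately show ?thesis by (simp add: high_block_def)
      qed
      ultimately have "s \<in> ?A k" by simp
      moreover have "z = ?g s" by (simp add: s_def)
      ultimately show "z \<in> ?g ` ?A k" by blast
    qed
    moreover have "inj_on ?g (?A k)" by (auto simp: inj_on_def)
    then have "card (?g ` ?A k) = card (?A k)" by (rule card_image)
    ultimately show ?thesis unfolding shift_count_def by simp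
  qed
  have "(\<Sum>k\<in>{1..<h}. card (?A k)) = card (\<Union>k\<in>{1..<h}. ?A k)"
    by (rule card_UN_disjoint[symmetric]) (auto intro: finite_subset[of _ "{0..<int L}"])
  also have "\<dots> \<le> card {0..<int L}" by (rule card_mono) auto
  finally show ?thesis unfolding eq by simp
qed

lemma sum_card_differences:
  fixes I J :: "int set"
  assumes "finite I" "finite J" "\<And>z y. z \<in> I \<Longrightarrow> y \<in> J \<Longrightarrow> z < y"
  shows "(\<Sum>z\<in>I. card {y \<in> J. \<bar>y - z\<bar> = d}) \<le> card {z \<in> I. z + d \<in> J}"
    "(\<Sum>y\<in>J. card {z \<in> I. \<bar>z - y\<bar> = d}) \<le> card {z \<in> I. z + d \<in> J}"
proof -
  have "(\<Sum>z\<in>I. card {y \<in> J. \<bar>y - z\<bar> = d}) = card (Sigma I (\<lambda>z. {y \<in> J. \<bar>y - z\<bar> = d}))"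
    using assms by simp
  also have "\<dots> \<le> card {z \<in> I. z + d \<in> J}"
  proof (rule card_inj_on_le[of fst])
    have e: "y = z + d" if "z \<in> I" "y \<in> J" "\<bar>y - z\<bar> = d" for z y using assms(3)[OF that(1,2)] that(3) by linarith
    have e': "fst p \<in> I \<and> snd p \<in> J \<and> snd p = fst p + d" if "p \<in> Sigma I (\<lambda>z. {y \<in> J. \<bar>y - z\<bar> = d})" for p
      using that e[of "fst p" "snd p"] by auto
    show "inj_on fst (Sigma I (\<lambda>z. {y \<in> J. \<bar>y - z\<bar> = d}))"
    proof (rule inj_onI)
      fix p p' assume a: "p \<in> Sigma I (\<lambda>z. {y \<in> J. \<bar>y - z\<bar> = d})" "p' \<in> Sigma I (\<lambda>z. {y \<in> J. \<bar>y - z\<bar> = d})" "fst p = fst p'"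
      show "p = p'" using e'[OF a(1)] e'[OF a(2)] a(3) by (simp add: prod_eq_iff)
    qed
    show "fst ` Sigma I (\<lambda>z. {y \<in> J. \<bar>y - z\<bar> = d}) \<subseteq> {z \<in> I. z + d \<in> J}"
    proof
      fix z assume "z \<in> fst ` Sigma I (\<lambda>z. {y \<in> J. \<bar>y - z\<bar> = d})"
      then obtain p where "p \<in> Sigma I (\<lambda>z. {y \<in> J. \<bar>y - z\<bar> = d})" "z = fst p" by blast
      then show "z \<in> {z \<in> I. z + d \<in> J}" using e'[of p] by auto
    qed
  qed (use assms in auto)
  finally show "(\<Sum>z\<in>I. card {y \<in> J. \<bar>y - z\<bar> = d}) \<le> card {z \<in> I. z + d \<in> J}" .
  have "(\<Sum>y\<in>J. card {z \<in> I. \<bar>z - y\<bar> = d}) = card (Sigma J (\<lambda>y. {z \<in> I. \<bar>z - y\<bar> = d}))"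
    using assms by simp
  also have "\<dots> \<le> card {z \<in> I. z + d \<in> J}"
  proof (rule card_inj_on_le[of snd])
    have e: "y = z + d" if "z \<in> I" "y \<in> J" "\<bar>z - y\<bar> = d" for z y using assms(3)[OF that(1,2)] that(3) by linarith
    have e': "fst p \<in> J \<and> snd p \<in> I \<and> fst p = snd p + d" if "p \<in> Sigma J (\<lambda>y. {z \<in> I. \<bar>z - y\<bar> = d})" for p
      using that e[of "snd p" "fst p"] by auto
    show "inj_on snd (Sigma J (\<lambda>y. {z \<in> I. \<bar>z - y\<bar> = d}))"
    proof (rule inj_onI)
      fix p p' assume a: "p \<in> Sigma J (\<lambda>y. {z \<in> I. \<bar>z - y\<bar> = d})" "p' \<in> Sigma J (\<lambda>y. {z \<in> I. \<bar>z - y\<bar> = d})" "snd p = snd p'"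
      show "p = p'" using e'[OF a(1)] e'[OF a(2)] a(3) by (simp add: prod_eq_iff)
    qed
    show "snd ` Sigma J (\<lambda>y. {z \<in> I. \<bar>z - y\<bar> = d}) \<subseteq> {z \<in> I. z + d \<in> J}"
    proof
      fix z assume "z \<in> snd ` Sigma J (\<lambda>y. {z \<in> I. \<bar>z - y\<bar> = d})"
      then obtain p where "p \<in> Sigma J (\<lambda>y. {z \<in> I. \<bar>z - y\<bar> = d})" "z = snd p" by blast
      then show "z \<in> {z \<in> I. z + d \<in> J}" using e'[of p] by auto
    qed
  qed (use assms in auto)
  finally show "(\<Sum>y\<in>J. card {z \<in> I. \<bar>z - y\<bar> = d}) \<le> card {z \<in> I. z + d \<in> J}" .
qed

text \<open>
  There are two bins for each pair \<open>k\<close>, one for each way of sending the two colour classes to the low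
  and the high block. Since both are equally loaded, each block of a pair receives the same number
  of vertices, whatever the sizes of the colour classes.
\<close>

lemma balanced_windows:
  fixes par piece :: "nat \<Rightarrow> nat" and col jump :: "nat \<Rightarrow> bool" and e T :: real
  assumes h: "h \<ge> 2" and L: "L > 0"
    and par: "\<And>t. 0 < t \<Longrightarrow> t < n \<Longrightarrow> par t < t" and j0: "jump 0"
    and pc: "\<And>t. t < n \<Longrightarrow> \<not> jump t \<Longrightarrow> piece t = piece (par t) \<and> col t = (\<not> col (par t))"
    and M: "\<And>r. card {t. t < n \<and> piece t = r} \<le> M"
    and e: "real M * real n \<le> e\<^sup>2" "e \<ge> 0"
    and T: "T = real n / real (h - 1) + 4 * e" "T \<le> (1 - \<kappa>) * real L" and \<kappa>: "\<kappa> > 0" "\<kappa> \<le> 1"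
  shows "\<exists>J. greedy n L par jump J (-1) {-1..<int (h * L)} \<kappa> \<and> (\<forall>t<n. J t \<subseteq> {0..<int (h * L)})"
proof -
  define B where "B = 2 * (h - 1)"
  have B: "B > 0" using h by (simp add: B_def)
  define R where "R = piece ` {..<n}"
  define a where "a = (\<lambda>(c :: bool) r. real (card {t. t < n \<and> piece t = r \<and> col t = c}))"
  have finR: "finite R" unfolding R_def by simp
  have asum: "a True r + a False r = real (card {t. t < n \<and> piece t = r})" for r
  proof -
    have "{t. t < n \<and> piece t = r} = {t. t < n \<and> piece t = r \<and> col t} \<union> {t. t < n \<and> piece t = r \<and> \<not> col t}" by auto
    moreover have "card ({t. t < n \<and> piece t = r \<and> col t} \<union> {t. t < n \<and> piece t = r \<and> \<not> col t})
      = card {t. t < n \<and> piece t = r \<and> col t} + card {t. t < n \<and> piece t = r \<and> \<not> col t}"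
      by (rule card_Un_disjoint) auto
    ultimately show ?thesis unfolding a_def by simp
  qed
  have group: "(\<Sum>r\<in>{r \<in> R. Q r}. a c r) = real (card {t. t < n \<and> Q (piece t) \<and> col t = c})" for Q c
  proof -
    have "(\<Sum>r\<in>{r \<in> R. Q r}. card {t. t < n \<and> piece t = r \<and> col t = c}) = card (\<Union>r\<in>{r \<in> R. Q r}. {t. t < n \<and> piece t = r \<and> col t = c})"
      using finR by (intro card_UN_disjoint[symmetric]) auto
    also have "(\<Union>r\<in>{r \<in> R. Q r}. {t. t < n \<and> piece t = r \<and> col t = c}) = {t. t < n \<and> Q (piece t) \<and> col t = c}"
      by (auto simp: R_def)
    finally show ?thesis unfolding a_def by (simp flip: of_nat_sum)
  qed
  have tot: "sum (a True) R + sum (a False) R = real n"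
  proof -
    have "sum (a True) R + sum (a False) R = real (card {t. t < n \<and> col t}) + real (card {t. t < n \<and> \<not> col t})"
      using group[where Q="\<lambda>_. True" and c=True] group[where Q="\<lambda>_. True" and c=False] by simp
    also have "\<dots> = real (card ({t. t < n \<and> col t} \<union> {t. t < n \<and> \<not> col t}))"
      by (subst card_Un_disjoint) auto
    also have "{t. t < n \<and> col t} \<union> {t. t < n \<and> \<not> col t} = {..<n}" by auto
    finally show ?thesis by simp
  qed
  obtain f where f: "f ` R \<subseteq> {..<B}"
    "\<And>i. i < B \<Longrightarrow> (\<Sum>r\<in>{r\<in>R. f r = i}. a True r) \<le> sum (a True) R / B + e"
    "\<And>i. i < B \<Longrightarrow> (\<Sum>r\<in>{r\<in>R. f r = i}. a False r) \<le> sum (a False) R / B + e"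
  proof -
    have "\<exists>f. f ` R \<subseteq> {..<B} \<and> (\<forall>i<B. (\<Sum>r\<in>{r\<in>R. f r = i}. a True r) \<le> sum (a True) R / B + e \<and>
         (\<Sum>r\<in>{r\<in>R. f r = i}. a False r) \<le> sum (a False) R / B + e)"
    proof (rule balanced_bins_small_pieces[OF finR B _ _ e])
      fix r show "0 \<le> a True r \<and> 0 \<le> a False r \<and> a True r + a False r \<le> real M"
        using M[of r] unfolding asum by (auto simp: a_def)
    qed (use tot in simp)
    then show thesis using that by blast
  qed
  define N where "N = (\<lambda>i c. real (card {t. t < n \<and> f (piece t) = i \<and> col t = c}))"
  define sA where "sA = (\<lambda>c. sum (a c) R / B + e)"
  have Nle: "N i c \<le> sA c" if "i < B" for i c
    using f(2,3)[OF that] group[where Q="\<lambda>r. f r = i" and c=c] unfolding N_def sA_def by (cases c) auto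
  have sAT: "2 * (sA True + sA False) = T"
  proof -
    have "sA True + sA False = real n / B + 2 * e" unfolding sA_def tot[symmetric] by (simp add: add_divide_distrib)
    moreover have "real B = 2 * real (h - 1)" unfolding B_def by simp
    ultimately show ?thesis unfolding T(1) by simp
  qed
  have sA0: "0 \<le> sA c" for c using Nle[OF B, of c] by (auto simp: N_def intro: order_trans[rotated])
  (* Bins 2 (k - 1) and 2 (k - 1) + 1 belong to pair k; the parity is the orientation. *)
  define k where "k = (\<lambda>t. f (piece t) div 2 + 1)"
  define blk where "blk = (\<lambda>t. if col t = odd (f (piece t)) then low_block h (k t) else high_block h (k t))"
  define J where "J = (\<lambda>t. block L (blk t))"
  have fB: "f (piece t) < B" if "t < n" for t using f(1) that unfolding R_def by auto
  have k: "1 \<le> k t" "k t < h" if "t < n" for t using fB[OF that] h unfolding k_def B_def by auto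
  have blkh: "blk t < h" if "t < n" for t
    using high_block_less[OF k[OF that]] unfolding blk_def high_block_def by auto
  have Jsub: "J t \<subseteq> {0..<int (h * L)}" if "t < n" for t
  proof -
    have "Suc (blk t) * L \<le> h * L" using blkh[OF that] by (intro mult_le_mono1) simp
    then have "int (Suc (blk t) * L) \<le> int (h * L)" by (simp only: of_nat_le_iff)
    then show ?thesis unfolding J_def block_def by auto
  qed
  have hL: "- 1 < int h * int L" by (rule less_le_trans[of _ 0]) auto
  interpret layout n L par jump J "-1" "{-1..<int (h * L)}"
  proof
    show "J t \<subseteq> {-1..<int (h * L)}" if "t < n" for t using Jsub[OF that] by auto
  qed (use par j0 L h hL in \<open>auto simp: J_def\<close>)
  have type_load: "real (card {t. t < n \<and> k t = k'}) \<le> T" if "1 \<le> k'" "k' < h" for k'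
  proof -
    have "{t. t < n \<and> k t = k'} \<subseteq> (\<Union>i\<in>{2 * (k' - 1), 2 * (k' - 1) + 1}. \<Union>c. {t. t < n \<and> f (piece t) = i \<and> col t = c})"
    proof
      fix t assume "t \<in> {t. t < n \<and> k t = k'}"
      then have "t < n" "f (piece t) div 2 = k' - 1" by (auto simp: k_def)
      then have "f (piece t) = 2 * (k' - 1) \<or> f (piece t) = 2 * (k' - 1) + 1" by presburger
      then show "t \<in> (\<Union>i\<in>{2 * (k' - 1), 2 * (k' - 1) + 1}. \<Union>c. {t. t < n \<and> f (piece t) = i \<and> col t = c})" using \<open>t < n\<close> by auto
    qed
    then have "card {t. t < n \<and> k t = k'} \<le> card (\<Union>i\<in>{2 * (k' - 1), 2 * (k' - 1) + 1}. \<Union>c. {t. t < n \<and> f (piece t) = i \<and> col t = c})"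
      by (intro card_mono) auto
    also have "\<dots> \<le> (\<Sum>i\<in>{2 * (k' - 1), 2 * (k' - 1) + 1}. \<Sum>c\<in>UNIV. card {t. t < n \<and> f (piece t) = i \<and> col t = c})"
      by (intro order.trans[OF card_UN_le] sum_mono card_UN_le) auto
    finally have "real (card {t. t < n \<and> k t = k'}) \<le> (\<Sum>i\<in>{2 * (k' - 1), 2 * (k' - 1) + 1}. \<Sum>c\<in>UNIV. N i c)"
      unfolding N_def by (simp only: of_nat_le_iff flip: of_nat_sum)
    also have "\<dots> \<le> (\<Sum>i\<in>{2 * (k' - 1), 2 * (k' - 1) + 1}. \<Sum>c\<in>UNIV. sA c)"
      using that by (intro sum_mono Nle) (auto simp: B_def)
    also have "\<dots> = T" using sAT by (simp add: UNIV_bool)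
    finally show ?thesis .
  qed
  have block_load: "real (card {t. t < n \<and> blk t = b}) \<le> T" for b
  proof -
    (* For each pair, b receives one colour class from the bin of either orientation. *)
  define KB where "KB = {k \<in> {1..<h}. low_block h k = b \<or> high_block h k = b}"
    have KB2: "card KB \<le> 2" unfolding KB_def by (rule few_types_per_block)
    have one: "real (card {t. t < n \<and> blk t = b \<and> k t = k'}) \<le> sA True + sA False" if k': "k' \<in> KB" for k'
    proof -
      have k1: "1 \<le> k'" "k' < h" using k' by (auto simp: KB_def)
      have ne: "low_block h k' \<noteq> high_block h k'" using k1 by (simp add: high_block_def)
      define lo where "lo \<longleftrightarrow> low_block h k' = b"
      let ?S = "\<lambda>i c. {t. t < n \<and> f (piece t) = i \<and> col t = c}"
      have "{t. t < n \<and> blk t = b \<and> k t = k'} \<subseteq> ?S (2 * (k' - 1)) (\<not> lo) \<union> ?S (2 * (k' - 1) + 1) lo"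
      proof
        fix t assume "t \<in> {t. t < n \<and> blk t = b \<and> k t = k'}"
        then have t: "t < n" "blk t = b" "k t = k'" by auto
        have "f (piece t) div 2 = k' - 1" using t by (auto simp: k_def)
        then have "f (piece t) = 2 * (k' - 1) \<or> f (piece t) = 2 * (k' - 1) + 1" by presburger
        moreover have "(col t = odd (f (piece t))) = lo" using t(2,3) ne unfolding blk_def lo_def by (auto split: if_splits)
        ultimately show "t \<in> ?S (2 * (k' - 1)) (\<not> lo) \<union> ?S (2 * (k' - 1) + 1) lo" using t(1) by auto
      qed
      then have "card {t. t < n \<and> blk t = b \<and> k t = k'} \<le> card (?S (2 * (k' - 1)) (\<not> lo) \<union> ?S (2 * (k' - 1) + 1) lo)"
        by (intro card_mono) auto
      also have "\<dots> \<le> card (?S (2 * (k' - 1)) (\<not> lo)) + card (?S (2 * (k' - 1) + 1) lo)" by (rule card_Un_le)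
      finally have "real (card {t. t < n \<and> blk t = b \<and> k t = k'}) \<le> N (2 * (k' - 1)) (\<not> lo) + N (2 * (k' - 1) + 1) lo"
        unfolding N_def by simp
      also have "\<dots> \<le> sA (\<not> lo) + sA lo" using k1 by (intro add_mono Nle) (auto simp: B_def)
      finally show ?thesis by (cases lo) auto
    qed
    have "{t. t < n \<and> blk t = b} \<subseteq> (\<Union>k'\<in>KB. {t. t < n \<and> blk t = b \<and> k t = k'})"
    proof
      fix t assume "t \<in> {t. t < n \<and> blk t = b}"
      then have "t < n" "blk t = b" by auto
      moreover from this have "k t \<in> KB" using k[of t] unfolding KB_def blk_def by (auto split: if_splits)
      ultimately show "t \<in> (\<Union>k'\<in>KB. {t. t < n \<and> blk t = b \<and> k t = k'})" by blast
    qed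
    then have "card {t. t < n \<and> blk t = b} \<le> card (\<Union>k'\<in>KB. {t. t < n \<and> blk t = b \<and> k t = k'})"
      by (intro card_mono) (auto simp: KB_def)
    also have "\<dots> \<le> (\<Sum>k'\<in>KB. card {t. t < n \<and> blk t = b \<and> k t = k'})" by (rule card_UN_le) (auto simp: KB_def)
    finally have "real (card {t. t < n \<and> blk t = b}) \<le> (\<Sum>k'\<in>KB. real (card {t. t < n \<and> blk t = b \<and> k t = k'}))"
      by (simp only: of_nat_le_iff flip: of_nat_sum)
    also have "\<dots> \<le> real (card KB) * (sA True + sA False)" by (rule sum_bounded_above) (rule one)
    also have "\<dots> \<le> 2 * (sA True + sA False)" using KB2 sA0 by (intro mult_right_mono) (auto intro: add_nonneg_nonneg)
    finally show ?thesis using sAT by simp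
  qed
  have Lp: "real L > 0" using L by simp
  have parn: "par c < n" if "c < n" "\<not> jump c" for c using par[of c] nonjump_pos that by fastforce
  have load_label: "(\<Sum>s<n. planned s (Inl y)) \<le> 1 - \<kappa>" for y
  proof -
    have "planned s (Inl y) \<le> (if y \<in> J s then 1 else 0) / L" if "s < n" for s
    proof (cases "jump s")
      case False
      have "hits z s (Inl y) = (if y \<in> J s then 1 else 0)" for z
      proof -
        have "{y' \<in> J s. Inl y \<in> move z y'} = (if y \<in> J s then {y} else {})" by (auto simp: move_def)
        then show ?thesis unfolding hits_def by simp
      qed
      then show ?thesis using False card_J[OF parn[OF that False]] Lp by (simp add: planned_def power2_eq_square)
    qed (simp add: planned_def)
    then have "(\<Sum>s<n. planned s (Inl y)) \<le> (\<Sum>s<n. (if y \<in> J s then 1 else 0) / L)" by (intro sum_mono) auto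
    also have "\<dots> = real (card {s. s < n \<and> y \<in> J s}) / L"
      by (simp add: sum_divide_distrib[symmetric] sum.If_cases Int_def)
    also have "\<dots> \<le> T / L"
    proof (intro divide_right_mono)
      have "{s. s < n \<and> y \<in> J s} \<subseteq> {s. s < n \<and> blk s = nat (y div int L)}" unfolding J_def by (auto simp: block_iff[OF L])
      then have "card {s. s < n \<and> y \<in> J s} \<le> card {s. s < n \<and> blk s = nat (y div int L)}" by (intro card_mono) auto
      then show "real (card {s. s < n \<and> y \<in> J s}) \<le> T" using block_load[of "nat (y div int L)"] by linarith
    qed simp
    also have "\<dots> \<le> 1 - \<kappa>" using T(2) Lp by (simp add: pos_divide_le_eq)
    finally show ?thesis .
  qed
  have load_diff: "(\<Sum>s<n. planned s (Inr d)) \<le> 1 - \<kappa>" for d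
  proof -
    have ub: "planned s (Inr d) \<le> real (shift_count h L (k s) d) / real L ^ 2" if s: "s < n" for s
    proof (cases "jump s")
      case False
      have pq: "piece s = piece (par s)" "col s = (\<not> col (par s))" using pc[OF s False] by auto
      define lo where "lo = block L (low_block h (k s))"
      define hi where "hi = block L (high_block h (k s))"
      have lohi: "z < y" if "z \<in> lo" "y \<in> hi" for z y
      proof -
        have "Suc (low_block h (k s)) * L \<le> high_block h (k s) * L" using k[OF s] by (intro mult_le_mono1) (simp add: high_block_def)
        then have "int (Suc (low_block h (k s)) * L) \<le> int (high_block h (k s) * L)" by (simp only: of_nat_le_iff)
        then show ?thesis using that unfolding lo_def hi_def block_def by simp
      qed
      have fin: "finite lo" "finite hi" by (auto simp: lo_def hi_def block_def)
      have Jc: "J (par s) = lo \<and> J s = hi \<or> J (par s) = hi \<and> J s = lo"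
        unfolding J_def blk_def lo_def hi_def k_def using pq by auto
      have c: "hits z s (Inr d) = real (card {y \<in> J s. \<bar>y - z\<bar> = d})" for z
        unfolding hits_def move_def by (intro arg_cong[where f=real] arg_cong[where f=card]) auto
      have "(\<Sum>z\<in>J (par s). card {y \<in> J s. \<bar>y - z\<bar> = d}) \<le> card {z \<in> lo. z + d \<in> hi}"
        using Jc sum_card_differences[OF fin lohi, of d] by auto
      then have "(\<Sum>z\<in>J (par s). hits z s (Inr d)) \<le> real (shift_count h L (k s) d)"
        unfolding c shift_count_def lo_def hi_def by (simp only: of_nat_le_iff flip: of_nat_sum)
      then show ?thesis using False by (simp add: planned_def divide_right_mono)
    qed (simp add: planned_def)
    then have "(\<Sum>s<n. planned s (Inr d)) \<le> (\<Sum>s<n. real (shift_count h L (k s) d) / real L ^ 2)" by (intro sum_mono) auto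
    also have "\<dots> = (\<Sum>k'\<in>{1..<h}. \<Sum>s | s \<in> {..<n} \<and> k s = k'. real (shift_count h L (k s) d) / real L ^ 2)"
      by (rule sum.group[symmetric]) (use k in auto)
    also have "\<dots> = (\<Sum>k'\<in>{1..<h}. real (card {s. s < n \<and> k s = k'}) * (real (shift_count h L k' d) / real L ^ 2))"
      by (intro sum.cong refl) simp
    also have "\<dots> \<le> (\<Sum>k'\<in>{1..<h}. T * (real (shift_count h L k' d) / real L ^ 2))"
      using type_load by (intro sum_mono mult_right_mono) auto
    also have "\<dots> = T * (real (\<Sum>k'\<in>{1..<h}. shift_count h L k' d) / real L ^ 2)"
      by (simp add: sum_distrib_left sum_divide_distrib)
    also have "\<dots> \<le> T * (real L / real L ^ 2)"
      using sum_shift_count[OF L, of h d] sAT sA0 by (intro mult_left_mono divide_right_mono) (auto simp flip: sAT simp del: of_nat_sum intro: add_nonneg_nonneg)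
    also have "\<dots> = T / L" by (simp add: power2_eq_square)
    also have "\<dots> \<le> 1 - \<kappa>" using T(2) Lp by (simp add: pos_divide_le_eq)
    finally show ?thesis .
  qed
  have "greedy n L par jump J (-1) {-1..<int (h * L)} \<kappa>"
  proof
    fix t \<omega> assume t: "t \<le> n"
    have "(\<Sum>s<t. planned s \<omega>) \<le> (\<Sum>s<n. planned s \<omega>)" using t planned_bounds(1) by (intro sum_mono2) auto
    also have "\<dots> \<le> 1 - \<kappa>" using load_label load_diff by (cases \<omega>) auto
    finally show "\<kappa> \<le> \<alpha> t \<omega>" unfolding \<alpha>_def by linarith
  qed (use \<kappa> in auto)
  then show ?thesis using Jsub by blast
qed

section \<open>Graceful labellings\<close>

text \<open>
  With \<open>h\<close> blocks there are only \<open>h - 1\<close> pairs, which costs a factor \<open>h / (h - 1)\<close>; this and the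
  imbalance of the bins are paid from the surplus \<open>\<gamma>\<close>, up to the part \<open>\<kappa>\<close>.
\<close>

lemma window_parameters:
  fixes \<gamma> :: real
  assumes "\<gamma> > 0"
  obtains h :: nat and \<kappa> \<epsilon> :: real where "h \<ge> 2" "0 < \<kappa>" "\<kappa> \<le> 1" "\<epsilon> > 0"
    "\<And>n L :: nat. real n \<ge> 1 / \<epsilon> \<Longrightarrow> real L \<ge> (1 + \<gamma>) * real n / real h - 1 \<Longrightarrow>
       real n / real (h - 1) + 4 * (\<epsilon> * real n) \<le> (1 - \<kappa>) * real L \<and> real n \<le> real h * real L"
proof -
  define g where "g = min \<gamma> 1"
  have g: "0 < g" "g \<le> 1" "g \<le> \<gamma>" using assms by (auto simp: g_def)
  define h where "h = nat \<lceil>4 / g\<rceil> + 2"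
  have hg: "real h - 1 \<ge> 4 / g" "h \<ge> 2" unfolding h_def using real_nat_ceiling_ge[of "4 / g"] by simp_all
  define \<epsilon> where "\<epsilon> = g / (16 * real h)"
  have hp: "real h > 0" using hg by simp
  have \<epsilon>: "\<epsilon> > 0" unfolding \<epsilon>_def using g hp by simp
  show thesis
  proof (rule that[of h "g / 8" \<epsilon>])
    show "h \<ge> 2" "0 < g / 8" "g / 8 \<le> 1" "\<epsilon> > 0" using hg g \<epsilon> by auto
    fix n L :: nat
    assume n: "real n \<ge> 1 / \<epsilon>" and L: "real L \<ge> (1 + \<gamma>) * real n / real h - 1"
    define N where "N = real n / real h"
    have N0: "N \<ge> 0" unfolding N_def by simp
    have N1: "N * g \<ge> 16"
    proof -
      have "real n * \<epsilon> \<ge> 1" using n \<epsilon> by (simp add: pos_divide_le_eq)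
      then show ?thesis unfolding N_def \<epsilon>_def using hp by (simp add: field_simps)
    qed
    have a: "real n / real (h - 1) \<le> N * (1 + g / 4)"
    proof -
      have h1: "real (h - 1) = real h - 1" using hg by simp
      have hp1: "real h - 1 > 0" using hg(2) by simp
      have "1 \<le> (real h - 1) * (g / 4)" using mult_right_mono[OF hg(1), of "g / 4"] g by simp
      then have "real h \<le> (real h - 1) * (1 + g / 4)" by (simp add: algebra_simps)
      then have "N * real h \<le> N * ((real h - 1) * (1 + g / 4))" using N0 by (rule mult_left_mono)
      then have "real n \<le> N * (1 + g / 4) * (real h - 1)" unfolding N_def using hp by (simp add: mult_ac)
      then show ?thesis unfolding h1 using hp1 by (simp add: pos_divide_le_eq)
    qed
    have b: "4 * (\<epsilon> * real n) = N * (g / 4)" unfolding \<epsilon>_def N_def using hp by (simp add: field_simps)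
    have c: "real L \<ge> N * (1 + 3 * g / 4)"
    proof -
      have "(1 + g) * N \<le> (1 + \<gamma>) * N" using g N0 by (intro mult_right_mono) auto
      then have "real L \<ge> (1 + g) * N - 1" using L unfolding N_def by simp
      moreover have "N * (g / 4) \<ge> 1" using N1 by simp
      ultimately show ?thesis by (simp add: algebra_simps)
    qed
    have "N * (1 + g / 4) + N * (g / 4) = N * (1 + g / 2)" by (simp add: algebra_simps)
    also have "\<dots> \<le> N * ((1 - g / 8) * (1 + 3 * g / 4))"
    proof (rule mult_left_mono[OF _ N0])
      have "g * g \<le> g * 1" using g by (intro mult_left_mono) auto
      then show "1 + g / 2 \<le> (1 - g / 8) * (1 + 3 * g / 4)" using g by (simp add: field_simps)
    qed
    also have "\<dots> = (1 - g / 8) * (N * (1 + 3 * g / 4))" by simp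
    also have "\<dots> \<le> (1 - g / 8) * real L" using c g by (intro mult_left_mono) auto
    finally have "N * (1 + g / 4) + N * (g / 4) \<le> (1 - g / 8) * real L" .
    moreover have "real n / real (h - 1) + 4 * (\<epsilon> * real n) \<le> N * (1 + g / 4) + N * (g / 4)"
      unfolding b using a by (rule add_right_mono)
    ultimately have "real n / real (h - 1) + 4 * (\<epsilon> * real n) \<le> (1 - g / 8) * real L" by (rule order_trans[rotated])
    moreover have "real n \<le> real h * real L"
    proof -
      have "N * 1 \<le> N * (1 + 3 * g / 4)" using N0 g by (intro mult_left_mono) auto
      then have "N \<le> real L" using c by linarith
      then show ?thesis unfolding N_def using hp by (simp add: pos_divide_le_eq mult.commute)
    qed
    ultimately show "real n / real (h - 1) + 4 * (\<epsilon> * real n) \<le> (1 - g / 8) * real L \<and> real n \<le> real h * real L" ..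
  qed
qed

lemma eventually_ln_small: "c > 0 \<Longrightarrow> \<exists>n0::nat. \<forall>n\<ge>n0. ln (real n) \<le> c * real n"
proof -
  assume c: "c > 0"
  obtain n0 :: nat where n0: "real n0 \<ge> 4 / c\<^sup>2" using real_arch_simple by blast
  have "ln (real n) \<le> c * real n" if "n \<ge> max n0 1" for n
  proof -
    have n: "real n \<ge> 1" "real n \<ge> 4 / c\<^sup>2" using that n0 by auto
    have s: "sqrt (real n) > 0" using n by simp
    have "ln (real n) = 2 * ln (sqrt (real n))" using n by (simp add: ln_sqrt)
    also have "\<dots> \<le> 2 * sqrt (real n)" using s ln_le_minus_one[OF s] by linarith
    also have "\<dots> \<le> c * sqrt (real n) * sqrt (real n)"
    proof (intro mult_right_mono)
      have "(2 / c)\<^sup>2 \<le> real n" using n by (simp add: power_divide)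
      then have "2 / c \<le> sqrt (real n)" using c by (intro real_le_rsqrt) auto
      then show "2 \<le> c * sqrt (real n)" using c by (simp add: pos_divide_le_eq mult.commute)
    qed (use n in auto)
    also have "\<dots> = c * real n" using n by simp
    finally show ?thesis .
  qed
  then show ?thesis by blast
qed

text \<open>
  Labels start at 0 in the process and at 1 in a graceful labelling.
\<close>

lemma (in greedy) valid_gives_graceful:
  assumes v: "valid \<psi> n" and J: "\<And>t. t < n \<Longrightarrow> J t \<subseteq> {0..<int N}" and m: "int N \<le> m"
    and bij: "bij_betw w {..<n} V" and E: "E = (\<lambda>t. {w t, w (par t)}) ` {0<..<n}"
  shows "\<exists>\<phi>. graceful_labelling m V E \<phi>"
proof -
  define \<phi> where "\<phi> = (\<lambda>a. \<psi> (inv_into {..<n} w a) + 1)"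
  have \<phi>w: "\<phi> (w t) = \<psi> t + 1" if "t < n" for t
    unfolding \<phi>_def using bij that by (simp add: bij_betw_inv_into_left)
  have V: "V = w ` {..<n}" using bij by (simp add: bij_betw_def)
  have rng: "0 \<le> \<psi> t" "\<psi> t < int N" if "t < n" for t using v J[OF that] that by (auto simp: valid_def)
  have inj: "inj_on \<psi> {..<n}" by (rule valid_inj[OF v])
  have parn: "par t < t" "par t < n" if "0 < t" "t < n" for t using par_less[OF that] that by auto
  have edge: "induced_edge_map \<phi> {w t, w (par t)} = \<bar>\<psi> t - \<psi> (par t)\<bar>" if "0 < t" "t < n" for t
    using \<phi>w[OF that(2)] \<phi>w[OF parn(2)[OF that]] by (simp add: induced_edge_map_doubleton)
  have ne: "\<bar>\<psi> r - \<psi> (par r)\<bar> \<noteq> \<bar>\<psi> s - \<psi> (par s)\<bar>" if "0 < r" "r < s" "s < n" for r s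
  proof
    assume e: "\<bar>\<psi> r - \<psi> (par r)\<bar> = \<bar>\<psi> s - \<psi> (par s)\<bar>"
    have "Inr \<bar>\<psi> r - \<psi> (par r)\<bar> \<in> move (parent_label \<psi> r) (\<psi> r)" using that by (simp add: move_def parent_label_def)
    then have "Inr \<bar>\<psi> r - \<psi> (par r)\<bar> \<in> used \<psi> s" unfolding used_def using that(2) by blast
    moreover have "Inr \<bar>\<psi> s - \<psi> (par s)\<bar> \<in> move (parent_label \<psi> s) (\<psi> s)" using that by (simp add: move_def parent_label_def)
    ultimately show False using v that e unfolding valid_def by (metis disjoint_iff)
  qed
  have "graceful_labelling m V E \<phi>"
    unfolding graceful_labelling_def
  proof (intro conjI)
    show "\<phi> ` V \<subseteq> {1..m}"
    proof
      fix a assume "a \<in> \<phi> ` V"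
      then obtain t where "t < n" "a = \<psi> t + 1" using V \<phi>w by auto
      then show "a \<in> {1..m}" using rng[of t] m by auto
    qed
    show "inj_on \<phi> V"
    proof (rule inj_onI)
      fix a b assume "a \<in> V" "b \<in> V" and eq: "\<phi> a = \<phi> b"
      then obtain s t where st: "s < n" "t < n" "a = w s" "b = w t" unfolding V by blast
      then have "\<psi> s = \<psi> t" using eq \<phi>w[of s] \<phi>w[of t] by simp
      then have "s = t" using inj st by (simp add: inj_on_eq_iff)
      then show "a = b" using st by simp
    qed
    show "induced_edge_map \<phi> ` E \<subseteq> {1..m - 1}"
    proof
      fix d assume "d \<in> induced_edge_map \<phi> ` E"
      then obtain t where t: "0 < t" "t < n" "d = \<bar>\<psi> t - \<psi> (par t)\<bar>" unfolding E using edge by auto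
      have "\<psi> t \<noteq> \<psi> (par t)" using inj_on_eq_iff[OF inj, of t "par t"] parn[OF t(1,2)] t by auto
      then show "d \<in> {1..m - 1}" using t rng[of t] rng[of "par t"] parn[OF t(1,2)] m by auto
    qed
    show "inj_on (induced_edge_map \<phi>) E"
    proof (rule inj_onI)
      fix e e' assume "e \<in> E" "e' \<in> E" and eq: "induced_edge_map \<phi> e = induced_edge_map \<phi> e'"
      then obtain s t where st: "0 < s" "s < n" "e = {w s, w (par s)}" "0 < t" "t < n" "e' = {w t, w (par t)}" unfolding E by auto
      have "\<bar>\<psi> s - \<psi> (par s)\<bar> = \<bar>\<psi> t - \<psi> (par t)\<bar>" using eq edge st by simp
      then have "s = t" using ne[of s t] ne[of t s] st by (metis linorder_neqE_nat)
      then show "e = e'" using st by simp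
    qed
  qed
  then show ?thesis by blast
qed

theorem theorem4:
  fixes \<gamma> :: real
  assumes "\<gamma> > 0"
  shows "\<exists>\<eta>::real. \<eta> > 0 \<and> (\<exists>n\<^sub>0::nat. \<forall>n::nat. n > n\<^sub>0 \<longrightarrow>
           (\<forall>(V :: 'a set) (E :: 'a set set).
              tree_graph V E \<and> card V = n \<and>
              real (max_vertex_degree V E) \<le> \<eta> * real n / ln (real n) \<longrightarrow>
              (\<exists>\<psi> :: 'a \<Rightarrow> int. graceful_labelling \<lceil>(1 + \<gamma>) * real n\<rceil> V E \<psi>)))"
proof -
  obtain h :: nat and \<kappa> \<epsilon> :: real where h: "h \<ge> 2" and \<kappa>: "0 < \<kappa>" "\<kappa> \<le> 1" and \<epsilon>: "\<epsilon> > 0"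
    and win: "\<And>n L :: nat. real n \<ge> 1 / \<epsilon> \<Longrightarrow> real L \<ge> (1 + \<gamma>) * real n / real h - 1 \<Longrightarrow>
       real n / real (h - 1) + 4 * (\<epsilon> * real n) \<le> (1 - \<kappa>) * real L \<and> real n \<le> real h * real L"
    using window_parameters[OF assms] by metis
  have hp: "real h > 0" using h by simp
  have "real h + 1 > 0" by simp
  from greedy_process_succeeds[OF \<kappa> this] obtain \<delta> L0 where \<delta>: "\<delta> > 0" and proc:
    "\<And>n L par jump J p0 P M \<Delta>.
     greedy n L par jump J p0 P \<kappa> \<Longrightarrow> n > 0 \<Longrightarrow> (\<forall>t<n. p0 \<notin> J t) \<Longrightarrow>
     (\<forall>s<n. card {c. 0 < c \<and> c < n \<and> par c = s} \<le> \<Delta>) \<Longrightarrow>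
     (\<forall>c<n. \<not> jump c \<longrightarrow> c \<le> par c + M) \<Longrightarrow> real n \<le> (real h + 1) * real L \<Longrightarrow> real (card P) \<le> (real h + 1) * real L \<Longrightarrow>
     L0 \<le> real L \<Longrightarrow> real M \<le> \<delta> * real L \<Longrightarrow> real (card {c. c < n \<and> jump c}) \<le> \<delta> * real L \<Longrightarrow>
     (1 + real \<Delta>) * ln (real L) \<le> \<delta> * real L \<Longrightarrow> (\<exists>\<psi>. greedy.valid par J p0 \<psi> n)"
    by blast
  define d where "d = \<delta> / real h"
  have d: "d > 0" unfolding d_def using \<delta> hp by simp
  define \<mu> where "\<mu> = min (\<epsilon>\<^sup>2) d"
  have \<mu>: "\<mu> > 0" "\<mu> \<le> \<epsilon>\<^sup>2" "\<mu> \<le> d" unfolding \<mu>_def using \<epsilon> d by auto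
  define \<eta> where "\<eta> = min (d / 4) (d * \<mu> / 8)"
  have \<eta>: "\<eta> > 0" "\<eta> \<le> d / 4" "\<eta> \<le> d * \<mu> / 8" unfolding \<eta>_def using d \<mu> by auto
  obtain n1 where n1: "\<And>n. n \<ge> n1 \<Longrightarrow> ln (real n) \<le> d / 4 * real n"
    using eventually_ln_small[of "d / 4"] d by auto
  define bounds where "bounds = {1 / \<epsilon>, real h * \<bar>L0\<bar>, 3 + \<gamma>, 2 / \<mu>, (2 + 4 / \<mu>) / d, real h, 4}"
  have fin_bounds: "finite bounds" unfolding bounds_def by simp
  obtain n2 :: nat where n2: "Max bounds \<le> real n2"
    using real_arch_simple by blast
  show ?thesis
  proof (intro exI[of _ \<eta>] conjI \<eta>(1) exI[of _ "max n1 n2"] allI impI)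
    fix n :: nat and V :: "'a set" and E :: "'a set set"
    assume n: "n > max n1 n2" and T: "tree_graph V E \<and> card V = n \<and> real (max_vertex_degree V E) \<le> \<eta> * real n / ln (real n)"
    define \<Delta> where "\<Delta> = max_vertex_degree V E"
    have big: "1 / \<epsilon> \<le> real n" "real h * \<bar>L0\<bar> \<le> real n" "3 + \<gamma> \<le> real n" "2 / \<mu> \<le> real n" "(2 + 4 / \<mu>) / d \<le> real n"
      "real h \<le> real n" "4 \<le> real n"
    proof -
      have "c \<le> real n" if "c \<in> bounds" for c using Max_ge[OF fin_bounds that] n2 n by linarith
      then show "1 / \<epsilon> \<le> real n" "real h * \<bar>L0\<bar> \<le> real n" "3 + \<gamma> \<le> real n" "2 / \<mu> \<le> real n" "(2 + 4 / \<mu>) / d \<le> real n"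
        "real h \<le> real n" "4 \<le> real n" unfolding bounds_def by blast+
    qed
    have np: "n > 0" using big(7) by simp
    have lnn: "ln (real n) \<ge> 1"
    proof -
      have "exp 1 \<le> real n" using big(7) exp_le by linarith
      then show ?thesis using np by (subst ln_ge_iff) auto
    qed
    have \<Delta>: "real \<Delta> * ln (real n) \<le> \<eta> * real n" using T lnn unfolding \<Delta>_def by (simp add: pos_le_divide_eq)
    have \<Delta>': "real \<Delta> \<le> \<eta> * real n"
    proof -
      have "real \<Delta> * 1 \<le> real \<Delta> * ln (real n)" using lnn by (intro mult_left_mono) auto
      then show ?thesis using \<Delta> by linarith
    qed
    define m where "m = \<lceil>(1 + \<gamma>) * real n\<rceil>"
    have m0: "(1 + \<gamma>) * real n \<le> real_of_int m" "real_of_int m \<le> (1 + \<gamma>) * real n + 1" "m \<ge> 0"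
    proof -
      show "(1 + \<gamma>) * real n \<le> real_of_int m" "real_of_int m \<le> (1 + \<gamma>) * real n + 1" unfolding m_def by linarith+
      moreover have "0 \<le> (1 + \<gamma>) * real n" using assms by simp
      ultimately show "m \<ge> 0" by linarith
    qed
    define L where "L = nat (m div int h)"
    have Lh: "int (h * L) \<le> m"
    proof -
      have "int L = m div int h" unfolding L_def using m0(3) by (simp add: div_int_pos_iff)
      then have "int (h * L) = int h * (m div int h)" by simp
      also have "\<dots> \<le> m" using h by (simp add: minus_mod_eq_mult_div[symmetric])
      finally show ?thesis .
    qed
    have Llow: "real L \<ge> (1 + \<gamma>) * real n / real h - 1"
    proof -
      have "int L = m div int h" unfolding L_def using m0(3) by (simp add: div_int_pos_iff)
      then have "m = int h * int L + m mod int h" by simp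
      moreover have "m mod int h < int h" using h by simp
      ultimately have "m \<le> int (h * L + h)" by simp
      then have "real_of_int m \<le> real_of_int (int (h * L + h))" by (simp only: of_int_le_iff)
      also have "\<dots> = (real L + 1) * real h" by (simp add: algebra_simps)
      finally have "real_of_int m / real h \<le> real L + 1" using hp by (simp only: pos_divide_le_eq)
      then have "real_of_int m / real h - 1 \<le> real L" by linarith
      moreover have "(1 + \<gamma>) * real n / real h \<le> real_of_int m / real h" using m0 hp by (intro divide_right_mono) auto
      ultimately show ?thesis by linarith
    qed
    have W: "real n / real (h - 1) + 4 * (\<epsilon> * real n) \<le> (1 - \<kappa>) * real L" "real n \<le> real h * real L"
      using win[OF big(1) Llow] by auto
    have Ln: "real n / real h \<le> real L" using W(2) hp by (simp add: pos_divide_le_eq mult.commute)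
    have dL: "d * real n \<le> \<delta> * real L"
      using mult_left_mono[OF Ln, of \<delta>] \<delta> unfolding d_def by simp
    have L1: "real L \<ge> 1"
    proof -
      have "1 \<le> real n / real h" using big(6) hp by (simp add: pos_le_divide_eq)
      then show ?thesis using Ln by linarith
    qed
    then have Lpos: "L > 0" by simp
    have Lup: "real L \<le> real n ^ 2"
    proof -
      have "real 1 * real L \<le> real h * real L" using h by (intro mult_right_mono) auto
      also have "\<dots> \<le> real_of_int m" using Lh by (simp flip: of_nat_mult)
      also have "\<dots> \<le> (1 + \<gamma>) * real n + 1 * real n" using m0(2) np by linarith
      also have "\<dots> = (2 + \<gamma>) * real n" by (simp add: algebra_simps)
      also have "\<dots> \<le> real n * real n" using big(3) by (intro mult_right_mono) auto
      finally show ?thesis by (simp add: power2_eq_square)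
    qed
    have lnL: "ln (real L) \<le> 2 * ln (real n)" "0 \<le> ln (real L)"
    proof -
      have "ln (real L) \<le> ln (real n ^ 2)" using Lup L1 by (intro ln_mono) auto
      then show "ln (real L) \<le> 2 * ln (real n)" by (simp add: ln_realpow)
      show "0 \<le> ln (real L)" using L1 by simp
    qed
    define M where "M = nat \<lfloor>\<mu> * real n\<rfloor>"
    have M: "real M \<le> \<mu> * real n" "real M \<ge> \<mu> * real n / 2" "M \<ge> 1"
    proof -
      have "\<mu> * real n \<ge> 2" using big(4) \<mu> by (simp add: pos_divide_le_eq mult.commute)
      then show "real M \<le> \<mu> * real n" "real M \<ge> \<mu> * real n / 2" "M \<ge> 1" unfolding M_def by linarith+
    qed
    have MdL: "real M \<le> \<delta> * real L"
    proof -
      have "\<mu> * real n \<le> d * real n" using \<mu> by (intro mult_right_mono) auto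
      then show ?thesis using M dL by linarith
    qed
    obtain w par piece col jump where lay: "bij_betw w {..<n} V" "E = (\<lambda>t. {w t, w (par t)}) ` {0<..<n}"
      "\<forall>t. 0 < t \<longrightarrow> t < n \<longrightarrow> par t < t" "jump 0"
      "\<forall>t<n. \<not> jump t \<longrightarrow> piece t = piece (par t) \<and> col t = (\<not> col (par t)) \<and> t \<le> par t + M"
      "\<forall>r::nat. card {t. t < n \<and> piece t = r} \<le> M" "card {t. t < n \<and> jump t} * M \<le> M + n * (1 + \<Delta>)"
      "\<forall>s<n. card {t. 0 < t \<and> t < n \<and> par t = s} \<le> \<Delta>"
      using tree_layout[of V E n \<Delta> M] T M(3) unfolding \<Delta>_def by blast
    have jumps: "real (card {c. c < n \<and> jump c}) \<le> \<delta> * real L"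
    proof -
      have "real (card {c. c < n \<and> jump c}) * real M \<le> real M + real n * (1 + real \<Delta>)"
        using lay(7) by (simp flip: of_nat_mult of_nat_add of_nat_Suc) 
      then have "real (card {c. c < n \<and> jump c}) \<le> 1 + real n * (1 + real \<Delta>) / real M"
        using M(3) by (simp add: field_simps)
      also have "real n * (1 + real \<Delta>) / real M \<le> real n * (1 + real \<Delta>) / (\<mu> * real n / 2)"
        using M \<mu> np by (intro divide_left_mono mult_nonneg_nonneg) auto
      also have "\<dots> = 2 / \<mu> * (1 + real \<Delta>)" using np by simp
      also have "\<dots> \<le> 2 / \<mu> * (1 + \<eta> * real n)" using \<mu> \<Delta>' by (intro mult_left_mono) auto
      also have "\<dots> \<le> 2 / \<mu> * (1 + d * \<mu> / 8 * real n)" using \<mu> \<eta> by (intro mult_left_mono add_left_mono mult_right_mono) auto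
      also have "\<dots> = 2 / \<mu> + d * real n / 4" using \<mu> by (simp add: field_simps)
      finally have "real (card {c. c < n \<and> jump c}) \<le> 1 + 2 / \<mu> + d * real n / 4" by linarith
      moreover have "1 + 2 / \<mu> \<le> d * real n / 2" using big(5) d by (simp add: pos_divide_le_eq mult.commute)
      moreover have "d * real n \<ge> 0" using d by simp
      ultimately show ?thesis using dL by linarith
    qed
    have deg: "(1 + real \<Delta>) * ln (real L) \<le> \<delta> * real L"
    proof -
      have "(1 + real \<Delta>) * ln (real L) \<le> (1 + real \<Delta>) * (2 * ln (real n))" using lnL by (intro mult_left_mono) auto
      also have "\<dots> = 2 * ln (real n) + 2 * (real \<Delta> * ln (real n))" by (simp add: algebra_simps)
      also have "\<dots> \<le> 2 * (d / 4 * real n) + 2 * (\<eta> * real n)" using n1[of n] n \<Delta> by auto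
      also have "\<dots> \<le> 2 * (d / 4 * real n) + 2 * (d / 4 * real n)" using \<eta> by (intro add_left_mono mult_left_mono mult_right_mono) auto
      finally show ?thesis using dL by simp
    qed
    have "\<exists>J. greedy n L par jump J (-1) {-1..<int (h * L)} \<kappa> \<and> (\<forall>t<n. J t \<subseteq> {0..<int (h * L)})"
    proof (rule balanced_windows[OF h Lpos, where piece=piece and col=col and M=M and e="\<epsilon> * real n"
          and T="real n / real (h - 1) + 4 * (\<epsilon> * real n)"])
      show "real M * real n \<le> (\<epsilon> * real n)\<^sup>2"
      proof -
        have "real M * real n \<le> \<mu> * real n * real n" using M by (intro mult_right_mono) auto
        also have "\<dots> \<le> \<epsilon>\<^sup>2 * real n * real n" using \<mu> by (intro mult_right_mono) auto
        finally show ?thesis by (simp add: power2_eq_square mult_ac)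
      qed
      show "piece t = piece (par t) \<and> col t = (\<not> col (par t))" if "t < n" "\<not> jump t" for t
        using lay(5) that by blast
      show "card {t. t < n \<and> piece t = r} \<le> M" for r using lay(6) by blast
    qed (use lay(3,4) W(1) \<kappa> \<epsilon> in simp_all)
    then obtain J where J: "greedy n L par jump J (-1) {-1..<int (h * L)} \<kappa>" "\<forall>t<n. J t \<subseteq> {0..<int (h * L)}" by blast
    have "\<exists>\<psi>. greedy.valid par J (-1) \<psi> n"
    proof (rule proc[OF J(1) np _ lay(8), where M=M])
      show "\<forall>t<n. - 1 \<notin> J t" using J(2) by force
      show "\<forall>c<n. \<not> jump c \<longrightarrow> c \<le> par c + M" using lay(5) by blast
      show "real n \<le> (real h + 1) * real L" using W(2) L1 by (simp add: distrib_right)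
      show "real (card {-1..<int (h * L)}) \<le> (real h + 1) * real L" using L1 by (simp add: distrib_right nat_add_distrib)
      show "L0 \<le> real L"
      proof -
        have "\<bar>L0\<bar> \<le> real n / real h" using big(2) hp by (simp add: pos_le_divide_eq mult.commute)
        then show ?thesis using Ln by linarith
      qed
    qed (use MdL jumps deg in auto)
    then obtain \<psi> where "greedy.valid par J (-1) \<psi> n" by blast
    then show "\<exists>\<psi> :: 'a \<Rightarrow> int. graceful_labelling \<lceil>(1 + \<gamma>) * real n\<rceil> V E \<psi>"
      using greedy.valid_gives_graceful[OF J(1), of \<psi> "h * L" m w V E] J(2) Lh lay unfolding m_def by blast
  qed
qed

end
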